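(* Let $P\subset M_{\mathbb{R}}$ be a smooth reflexive polytope of dimension $n$ whose barycenter is the origin. Then for every proper nonzero linear subspace $F\subsetneq N_{\mathbb{Q}}$, $$\frac{1}{\dim F}\sum_{\rho\,:\,v_\rho\in F}\operatorname{vol}(P^\rho)\;\le\;\frac1n\sum_{\rho}\operatorname{vol}(P^\rho),$$ where $\rho$ runs over the rays of the normal fan of $P$.
   Context: $M$ is a lattice of rank $n$ with dual lattice $N$. A lattice polytope $P\subset M_{\mathbb{R}}$ containing the origin in its interior is reflexive if $P=\{u\in M_{\mathbb{R}}:\langle u,v_\rho\rangle\ge-1\text{ for all }\rho\}$ where the $v_\rho\in N$ are the primitive inner facet normals (the primitive generators of the rays $\rho$ of the normal fan); it is smooth if for each vertex the primitive inner normals of the facets containing it form a basis of $N$. $P^\rho$ is the facet with inner normal $v_\rho$. $\operatorname{vol}(P^\rho)$ is the lattice volume of the facet inside its affine span with respect to the lattice induced by $M$, normalized so that a unimodular simplex has volume $1$. *)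

theory Defs
  imports "HOL-Analysis.Analysis"
begin

text \<open>
  Coordinates are fixed once and for all: \<open>M\<close> and \<open>N\<close> are both the lattice of integer vectors
  of \<open>real ^ 'n\<close>, with \<open>n = CARD('n)\<close>, and the pairing of \<open>M\<close> with \<open>N\<close> is the inner product.
\<close>

definition int_lattice :: "(real ^ 'n) set" where
  "int_lattice = {x. \<forall>i. x $ i \<in> \<int>}"

definition lattice_basis :: "(real ^ 'n) set \<Rightarrow> (real ^ 'n) set \<Rightarrow> bool" where
  "lattice_basis B L \<longleftrightarrow>
     independent B \<and> L = {\<Sum>b\<in>B. of_int (k b) *\<^sub>R b | k :: real ^ 'n \<Rightarrow> int. True}"

definition primitive :: "real ^ 'n \<Rightarrow> bool" where
  "primitive v \<longleftrightarrow> v \<in> int_lattice \<and> v \<noteq> 0 \<and>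
     (\<forall>w\<in>int_lattice. \<forall>k::nat. v = of_nat k *\<^sub>R w \<longrightarrow> k = 1)"

definition lattice_polytope :: "(real ^ 'n) set \<Rightarrow> bool" where
  "lattice_polytope P \<longleftrightarrow> (\<exists>V. finite V \<and> V \<subseteq> int_lattice \<and> P = convex hull V)"

text \<open>Normals point inwards: a covector is in the cone of \<open>F\<close> if it is minimal on \<open>P\<close> along \<open>F\<close>.\<close>

definition normal_cone :: "(real ^ 'n) set \<Rightarrow> (real ^ 'n) set \<Rightarrow> (real ^ 'n) set" where
  "normal_cone P F = {v. \<forall>u\<in>F. \<forall>w\<in>P. u \<bullet> v \<le> w \<bullet> v}"

definition normal_fan :: "(real ^ 'n) set \<Rightarrow> (real ^ 'n) set set" where
  "normal_fan P = {normal_cone P F | F. F face_of P \<and> F \<noteq> {}}"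

definition rays :: "(real ^ 'n) set \<Rightarrow> (real ^ 'n) set set" where
  "rays P = {\<rho> \<in> normal_fan P. dim \<rho> = 1}"

definition ray_gen :: "(real ^ 'n) set \<Rightarrow> real ^ 'n" where
  "ray_gen \<rho> = (THE v. v \<in> \<rho> \<and> primitive v)"

text \<open>The facet of \<open>P\<close> with inner normal \<open>ray_gen \<rho>\<close>.\<close>

definition ray_facet :: "(real ^ 'n) set \<Rightarrow> (real ^ 'n) set \<Rightarrow> (real ^ 'n) set" where
  "ray_facet P \<rho> = {u \<in> P. \<forall>w\<in>P. u \<bullet> ray_gen \<rho> \<le> w \<bullet> ray_gen \<rho>}"

definition reflexive_polytope :: "(real ^ 'n) set \<Rightarrow> bool" where
  "reflexive_polytope P \<longleftrightarrow> lattice_polytope P \<and> 0 \<in> interior P \<and>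
     P = {u. \<forall>\<rho>\<in>rays P. u \<bullet> ray_gen \<rho> \<ge> -1}"

definition smooth_polytope :: "(real ^ 'n) set \<Rightarrow> bool" where
  "smooth_polytope P \<longleftrightarrow>
     (\<forall>x. x extreme_point_of P \<longrightarrow>
        lattice_basis {ray_gen \<rho> | \<rho>. \<rho> \<in> rays P \<and> x \<in> ray_facet P \<rho>} int_lattice)"

definition barycenter :: "(real ^ 'n) set \<Rightarrow> real ^ 'n" where
  "barycenter P = (1 / measure lborel P) *\<^sub>R (LINT x:P|lborel. x)"

text \<open>The lattice induced by \<open>M\<close> on the linear space parallel to the affine span of \<open>S\<close>.\<close>

definition induced_lattice :: "(real ^ 'n) set \<Rightarrow> (real ^ 'n) set" where
  "induced_lattice S =
     int_lattice \<inter> {x - y | x y. x \<in> affine hull S \<and> y \<in> affine hull S}"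

text \<open>
  The Lebesgue volume of \<open>S\<close> in the coordinates on its affine span given by a base point \<open>p\<close> and
  a basis \<open>B\<close> of the induced lattice; none of the choices matters. The factorial of
  the dimension \<open>card B\<close> gives a unimodular simplex volume 1.
\<close>

definition lattice_volume :: "(real ^ 'n) set \<Rightarrow> real" where
  "lattice_volume S =
     (let B = (SOME B. lattice_basis B (induced_lattice S));
          p = (SOME p. p \<in> affine hull S)
      in fact (card B) *
         measure (\<Pi>\<^sub>M b\<in>B. lborel)
           {c \<in> B \<rightarrow>\<^sub>E UNIV. p + (\<Sum>b\<in>B. c b *\<^sub>R b) \<in> S})"

text \<open>The inclusion of the rational points of \<open>N\<close> into the real ones.\<close>

definition of_rat_vec :: "rat ^ 'n \<Rightarrow> real ^ 'n" where
  "of_rat_vec x = (\<chi> i. of_rat (x $ i))"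

end

theory Submission
  imports Defs
begin

text \<open>
  All facets of a reflexive polytope \<open>P\<close> lie at lattice distance 1 from the origin. Hence the lattice
  volume of a facet is \<open>n!\<close> times the Lebesgue volume of the cone over it with apex 0
  (\<open>measure_cone_slab_ray_facet\<close>), and these cones tile \<open>P\<close>. The theorem therefore says that the cones
  over the facets with normal in \<open>F\<close> fill at most the fraction \<open>dim F / n\<close> of \<open>P\<close>. This is the subspace
  concentration condition for the cone volumes of a convex body with centroid at the origin, and it is
  proved here by convex geometry.

  Let \<open>U\<close> be the real span of \<open>F\<close>, let \<open>d = dim U\<close>, and let \<open>S\<close> be the volume of the cones in question.
  For \<open>0 < t < 1\<close> push the facets with normal in \<open>F\<close> inwards, so that they lie at distance \<open>t\<close>; what remains
  of \<open>P\<close> is \<open>K\<close>. Each of the cones loses the part beyond its copy scaled by \<open>t\<close>, which is the fraction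
  \<open>1 - t ^ n\<close> of its volume, so \<open>vol K \<le> vol P - (1 - t ^ n) S\<close>. On the other hand
  \<open>vol K \<ge> t ^ d vol P\<close> (\<open>centered_convex_body_squeeze\<close>). Comparing both estimates as \<open>t\<close> tends to 1 gives
  \<open>n S \<le> d vol P\<close> (\<open>power_gap_limit\<close>).

  The lower bound for \<open>vol K\<close> is where the barycenter enters. Let \<open>f y\<close> be the volume of the slice of \<open>P\<close>
  through \<open>y \<in> U\<close> parallel to the orthogonal complement of \<open>U\<close>. By Prekopa's theorem
  (\<open>log_concave_marginals\<close>) \<open>f\<close> is log-concave, so \<open>ln f\<close> has a supergradient \<open>a\<close> at 0, that is
  \<open>f y \<le> f 0 * exp (a \<bullet> y)\<close> (\<open>log_concave_supergradient\<close>). Log-concavity along the segment from 0 to \<open>y\<close> yields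
  \<open>f (t y) \<ge> f 0 powr (1 - t) * f y powr t \<ge> f y * (1 - (1 - t) (a \<bullet> y))\<close>. In the integral over \<open>U\<close> the
  linear term vanishes because the barycenter of \<open>P\<close> is 0, and scaling \<open>U\<close> by \<open>t\<close> costs the factor \<open>t ^ d\<close>.

  The lattice enters as follows. Rays of the normal fan are rational and so have primitive
  generators (\<open>ray_gen_primitive\<close>); integrality makes the height of a facet exactly \<open>-1\<close>
  (\<open>ray_facet_height\<close>); a vertex of the facet provides, by smoothness, a basis of the
  lattice of normals, whose dual basis contains a basis of the lattice of the facet
  (\<open>dual_lattice_basis\<close>); and coordinates in a lattice basis preserve Lebesgue measure
  (\<open>lborel_lattice_basis\<close>).
\<close>

section \<open>The Prekopa-Leindler inequality on the line\<close>

text \<open>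
  Brunn-Minkowski on the line. Convex sets are intervals up to end points, and every point strictly
  between the two end points of the Minkowski combination is attained.
\<close>

lemma emeasure_Minkowski_intervals:
  fixes I J T :: "real set"
  assumes I: "convex I" "I \<noteq> {}" "bounded I" and J: "convex J" "J \<noteq> {}" "bounded J"
    and l: "0 < l" "l < 1" and T: "T \<in> sets borel"
    and sub: "\<And>x y. x \<in> I \<Longrightarrow> y \<in> J \<Longrightarrow> (1 - l) * x + l * y \<in> T"
  shows "ennreal (1 - l) * emeasure lborel I + ennreal l * emeasure lborel J \<le> emeasure lborel T"
proof -
  have bI: "bdd_below I" "bdd_above I" "bdd_below J" "bdd_above J"
    using I(3) J(3) by (auto simp: bounded_imp_bdd_above bounded_imp_bdd_below)
  define a b c d where "a = Inf I" "b = Sup I" "c = Inf J" "d = Sup J"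
  note abcd = this
  have ab: "a \<le> b" "c \<le> d" 
    unfolding abcd using I J bI by (auto intro!: cInf_le_cSup)
  have mI: "emeasure lborel I \<le> ennreal (b - a)"
  proof -
    have "I \<subseteq> {a..b}" using bI unfolding abcd by (auto intro: cInf_lower cSup_upper)
    then have "emeasure lborel I \<le> emeasure lborel {a..b}" by (intro emeasure_mono) auto
    then show ?thesis using ab by simp
  qed
  have mJ: "emeasure lborel J \<le> ennreal (d - c)"
  proof -
    have "J \<subseteq> {c..d}" using bI unfolding abcd by (auto intro: cInf_lower cSup_upper)
    then have "emeasure lborel J \<le> emeasure lborel {c..d}" by (intro emeasure_mono) auto
    then show ?thesis using ab by simp
  qed
  define L where "L = {x + y | x y. x \<in> (\<lambda>x. (1 - l) * x) ` I \<and> y \<in> (\<lambda>x. l * x) ` J}"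
  have "L = (\<Union>x\<in>(\<lambda>x. (1 - l) * x) ` I. \<Union>y\<in>(\<lambda>x. l * x) ` J. {x + y})" unfolding L_def by auto
  then have cL: "convex L"
    using convex_sums[OF convex_scaling[OF I(1), of "1 - l"] convex_scaling[OF J(1), of l]]
    by simp
  have LT: "L \<subseteq> T" using sub by (auto simp: L_def)
  have "{(1-l)*a + l*c <..< (1-l)*b + l*d} \<subseteq> T"
  proof
    fix x assume x: "x \<in> {(1-l)*a + l*c <..< (1-l)*b + l*d}"
    \<comment> \<open>Choose points of \<open>I\<close> and \<open>J\<close> within \<open>e\<close> of their end points, so that \<open>x\<close> lies between the combinations.\<close>
    define e where "e = min (x - ((1-l)*a + l*c)) ((1-l)*b + l*d - x)"
    have e: "e > 0" using x by (auto simp: e_def)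
    obtain y1 where y1: "y1 \<in> I" "y1 < a + e" using I bI e cInf_less_iff[of I "a + e"] by (auto simp: abcd)
    obtain z1 where z1: "z1 \<in> J" "z1 < c + e" using J bI e cInf_less_iff[of J "c + e"] by (auto simp: abcd)
    obtain y2 where y2: "y2 \<in> I" "y2 > b - e" using I bI e less_cSup_iff[of I "b - e"] by (auto simp: abcd)
    obtain z2 where z2: "z2 \<in> J" "z2 > d - e" using J bI e less_cSup_iff[of J "d - e"] by (auto simp: abcd)
    have "(1-l)*y1 + l*z1 < (1-l)*(a+e) + l*(c+e)"
      using y1 z1 l by (intro add_strict_mono mult_strict_left_mono) auto
    also have "\<dots> \<le> x" by (auto simp: e_def algebra_simps)
    finally have p: "(1-l)*y1 + l*z1 < x" .
    have "x \<le> (1-l)*(b-e) + l*(d-e)" by (auto simp: e_def algebra_simps)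
    also have "\<dots> < (1-l)*y2 + l*z2"
      using y2 z2 l by (intro add_strict_mono mult_strict_left_mono) auto
    finally have q: "x < (1-l)*y2 + l*z2" .
    have "(1-l)*y1 + l*z1 \<in> L" "(1-l)*y2 + l*z2 \<in> L" using y1 y2 z1 z2 by (auto simp: L_def)
    then have "x \<in> L" using cL p q
      by (meson is_interval_convex_1 less_imp_le mem_is_interval_1_I)
    then show "x \<in> T" using LT by auto
  qed
  then have "emeasure lborel {(1-l)*a + l*c <..< (1-l)*b + l*d} \<le> emeasure lborel T"
    using T by (intro emeasure_mono) auto
  moreover have "(1-l)*a + l*c \<le> (1-l)*b + l*d" using ab l by (intro add_mono mult_left_mono) auto
  ultimately have "ennreal ((1-l)*(b-a) + l*(d-c)) \<le> emeasure lborel T"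
    by (simp add: algebra_simps)
  moreover have "ennreal ((1-l)*(b-a) + l*(d-c)) = ennreal (1-l) * ennreal (b-a) + ennreal l * ennreal (d-c)"
    using ab l by (simp add: ennreal_plus ennreal_mult)
  moreover have "ennreal (1-l) * emeasure lborel I + ennreal l * emeasure lborel J
      \<le> ennreal (1-l) * ennreal (b-a) + ennreal l * ennreal (d-c)"
    using mI mJ by (intro add_mono mult_left_mono) auto
  ultimately show ?thesis by simp
qed

text \<open>
  The scaling by \<open>M\<close> serves to compare functions with different suprema on the same range of
  levels.
\<close>

lemma layer_cake_scaled:
  fixes f :: "real \<Rightarrow> real"
  assumes [measurable]: "f \<in> borel_measurable borel" and M: "M > 0"
  shows "(\<integral>\<^sup>+x. ennreal (f x) \<partial>lborel) =
     ennreal M * (\<integral>\<^sup>+s. indicator {0..} s * emeasure lborel {x. M * s < f x} \<partial>lborel)"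
proof -
  have "(\<integral>\<^sup>+x. ennreal (f x) \<partial>lborel) = (\<integral>\<^sup>+x. (\<integral>\<^sup>+s. indicator {0..<f x} s \<partial>lborel) \<partial>lborel)"
  proof (intro nn_integral_cong)
    fix x :: real
    have "(\<integral>\<^sup>+s. indicator {0..<f x} s \<partial>lborel) = emeasure lborel {0..<f x}" by simp
    also have "\<dots> = ennreal (f x)" by (cases "0 \<le> f x") (auto simp: ennreal_neg)
    finally show "ennreal (f x) = (\<integral>\<^sup>+s. indicator {0..<f x} s \<partial>lborel)" by simp
  qed
  also have "\<dots> = (\<integral>\<^sup>+x. (\<integral>\<^sup>+s. indicator {0..} s * (if s < f x then 1 else 0) \<partial>lborel) \<partial>lborel)"
    by (intro nn_integral_cong) (auto simp: indicator_def)
  also have "\<dots> = (\<integral>\<^sup>+s. (\<integral>\<^sup>+x. indicator {0..} s * (if s < f x then 1 else 0) \<partial>lborel) \<partial>lborel)"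
    by (rule lborel_pair.Fubini') measurable
  also have "\<dots> = ennreal M * (\<integral>\<^sup>+s. (\<integral>\<^sup>+x. indicator {0..} (0 + M * s) * (if 0 + M * s < f x then 1 else 0) \<partial>lborel) \<partial>lborel)"
    using M by (subst nn_integral_real_affine[where c = M and t = 0]) auto
  also have "(\<integral>\<^sup>+s. (\<integral>\<^sup>+x. indicator {0..} (0 + M * s) * (if 0 + M * s < f x then 1 else 0) \<partial>lborel) \<partial>lborel)
     = (\<integral>\<^sup>+s. indicator {0..} s * emeasure lborel {x. M * s < f x} \<partial>lborel)"
  proof (intro nn_integral_cong)
    fix s :: real
    have "(\<integral>\<^sup>+x. indicator {0..} (0 + M * s) * (if 0 + M * s < f x then 1 else 0) \<partial>lborel) 
       = (\<integral>\<^sup>+x. indicator {0..} s * indicator {x. M * s < f x} x \<partial>lborel)"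
      using M by (intro nn_integral_cong) (auto simp: indicator_def zero_le_mult_iff)
    then show "(\<integral>\<^sup>+x. indicator {0..} (0 + M * s) * (if 0 + M * s < f x then 1 else 0) \<partial>lborel) 
       = indicator {0..} s * emeasure lborel {x. M * s < f x}"
      by (simp add: nn_integral_cmult)
  qed
  finally show ?thesis .
qed

lemma integrable_bounded_support:
  fixes f :: "real \<Rightarrow> real"
  assumes "f \<in> borel_measurable borel" "\<And>x. \<bar>f x\<bar> \<le> B" "\<And>x. f x \<noteq> 0 \<Longrightarrow> \<bar>x\<bar> \<le> R"
  shows "integrable lborel f"
proof (rule Bochner_Integration.integrable_bound)
  show "integrable lborel (\<lambda>x. B * indicator {-R..R} x)"
    by (intro integrable_mult_right integrable_real_indicator) (auto simp: emeasure_lborel_Icc_eq)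
  show "f \<in> borel_measurable lborel" using assms by simp
  have "0 \<le> B" using assms(2)[of 0] by linarith
  then have "norm (f x) \<le> norm (B * indicator {-R..R} x)" for x 
    using assms(2)[of x] assms(3)[of x] by (cases "f x = 0") (auto simp: indicator_def abs_le_iff)
  then show "AE x in lborel. norm (f x) \<le> norm (B * indicator {-R..R} x)" by auto
qed

text \<open>
  After division by the suprema \<open>Mu\<close> and \<open>Mv\<close>, the superlevel sets of \<open>u\<close> and \<open>v\<close> are
  nonempty for the same levels \<open>s < 1\<close>, and their Minkowski combination lies in the superlevel set of \<open>w\<close>
  at level \<open>m * s\<close>. Integrating the one-dimensional Brunn-Minkowski inequality over the levels bounds
  the integral of \<open>w\<close> below by an arithmetic mean, which dominates the geometric mean. As the superlevel
  sets are assumed to be convex, Brunn-Minkowski is needed for intervals only.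
\<close>

lemma Prekopa_Leindler_interval:
  fixes u v w :: "real \<Rightarrow> real"
  assumes meas: "u \<in> borel_measurable borel" "v \<in> borel_measurable borel" "w \<in> borel_measurable borel"
    and nn: "\<And>x. 0 \<le> u x" "\<And>x. 0 \<le> v x" "\<And>x. 0 \<le> w x"
    and bd: "\<And>x. u x \<le> B" "\<And>x. v x \<le> B" "\<And>x. w x \<le> B"
    and sp: "\<And>x. u x \<noteq> 0 \<Longrightarrow> \<bar>x\<bar> \<le> R" "\<And>x. v x \<noteq> 0 \<Longrightarrow> \<bar>x\<bar> \<le> R" "\<And>x. w x \<noteq> 0 \<Longrightarrow> \<bar>x\<bar> \<le> R"
    and cv: "\<And>c. 0 \<le> c \<Longrightarrow> convex {x. c < u x}" "\<And>c. 0 \<le> c \<Longrightarrow> convex {x. c < v x}"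
    and l: "0 < l" "l < 1"
    and w: "\<And>x y. u x powr (1 - l) * v y powr l \<le> w ((1 - l) * x + l * y)"
  shows "(\<integral>x. u x \<partial>lborel) powr (1 - l) * (\<integral>x. v x \<partial>lborel) powr l \<le> (\<integral>x. w x \<partial>lborel)"
proof (cases "(\<exists>x. u x > 0) \<and> (\<exists>x. v x > 0)")
  case False
  have "(\<integral>x. u x \<partial>lborel) = 0 \<or> (\<integral>x. v x \<partial>lborel) = 0"
  proof -
    have "u = (\<lambda>x. 0) \<or> v = (\<lambda>x. 0)" using False nn by (metis (no_types, lifting) ext less_eq_real_def)
    then show ?thesis by auto
  qed
  moreover have "(\<integral>x. w x \<partial>lborel) \<ge> 0" using nn by simp
  ultimately show ?thesis by auto
next
  case True
  then obtain x0 y0 where xy: "u x0 > 0" "v y0 > 0" by auto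
  note [measurable] = meas
  have iu: "integrable lborel u" "integrable lborel v" "integrable lborel w"
    using integrable_bounded_support[OF meas(1), of B R] integrable_bounded_support[OF meas(2), of B R]
      integrable_bounded_support[OF meas(3), of B R] nn bd sp by auto
  define Mu Mv where "Mu = (SUP x. u x)" and "Mv = (SUP x. v x)"
  have bdd: "bdd_above (range u)" "bdd_above (range v)" using bd by (auto intro!: bdd_aboveI[of _ B])
  have Mu: "Mu > 0" "Mv > 0" unfolding Mu_def Mv_def
    using xy bdd by (auto intro: less_le_trans[OF _ cSUP_upper])
  define m where "m = Mu powr (1 - l) * Mv powr l"
  have m: "m > 0" using Mu by (simp add: m_def)
  have mono: "indicator {0..<1} s * (ennreal (1-l) * emeasure lborel {x. Mu * s < u x} + ennreal l * emeasure lborel {x. Mv * s < v x})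
     \<le> indicator {0..} s * emeasure lborel {x. m * s < w x}" for s :: real
  proof (cases "s \<in> {0..<1}")
    case True
    have le: "{x. Mu * s < u x} \<noteq> {}" "{x. Mv * s < v x} \<noteq> {}"
    proof -
      have "Mu * s < Mu * 1" "Mv * s < Mv * 1" using True Mu by (auto intro!: mult_strict_left_mono)
      then show "{x. Mu * s < u x} \<noteq> {}" "{x. Mv * s < v x} \<noteq> {}"
        using less_cSUP_iff[of UNIV u "Mu * s"] less_cSUP_iff[of UNIV v "Mv * s"] bdd 
        by (auto simp: Mu_def Mv_def)
    qed
    have bb: "bounded {x. Mu * s < u x}" "bounded {x. Mv * s < v x}"
    proof -
      have p: "0 \<le> Mu * s" "0 \<le> Mv * s" using Mu True by auto
      have "{x. Mu * s < u x} \<subseteq> cball 0 R" 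
        proof
        fix x assume "x \<in> {x. Mu * s < u x}"
        then have "u x \<noteq> 0" using p(1) by auto
        then show "x \<in> cball 0 R" using sp(1) by simp
      qed
      moreover have "{x. Mv * s < v x} \<subseteq> cball 0 R"
        proof
        fix x assume "x \<in> {x. Mv * s < v x}"
        then have "v x \<noteq> 0" using p(2) by auto
        then show "x \<in> cball 0 R" using sp(2) by simp
      qed
      ultimately show "bounded {x. Mu * s < u x}" "bounded {x. Mv * s < v x}"
        using bounded_cball bounded_subset by blast+
    qed
    have "ennreal (1-l) * emeasure lborel {x. Mu * s < u x} + ennreal l * emeasure lborel {x. Mv * s < v x}
      \<le> emeasure lborel {x. m * s < w x}"
    proof (rule emeasure_Minkowski_intervals)
      show "convex {x. Mu * s < u x}" "convex {x. Mv * s < v x}" using Mu True by (auto intro!: cv)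
      fix x y assume xy: "x \<in> {x. Mu * s < u x}" "y \<in> {x. Mv * s < v x}"
      have "m * s = (Mu * s) powr (1-l) * (Mv * s) powr l"
      proof (cases "s = 0")
        case False
        then have "s > 0" using True by auto
        have "(Mu * s) powr (1-l) * (Mv * s) powr l = m * (s powr (1-l) * s powr l)"
          using Mu \<open>s > 0\<close> by (simp add: m_def powr_mult)
        also have "s powr (1-l) * s powr l = s" using \<open>s > 0\<close> by (simp add: powr_add[symmetric])
        finally show ?thesis by simp
      qed (use l in auto)
      also have "\<dots> < u x powr (1-l) * v y powr l"
      proof (rule mult_strict_mono)
        have p: "0 \<le> Mu * s" "0 \<le> Mv * s" using Mu True by auto
        then show "(Mu * s) powr (1-l) < u x powr (1-l)" "(Mv * s) powr l < v y powr l"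
          using xy l by (auto intro!: powr_less_mono2)
        show "0 < u x powr (1-l)" using p(1) xy by auto
      qed auto
      also have "\<dots> \<le> w ((1 - l) * x + l * y)" by (rule w)
      finally show "(1 - l) * x + l * y \<in> {x. m * s < w x}" by simp
    qed (use le bb l in auto)
    then show ?thesis using True by auto
  qed auto
  have emp: "{x. Mu * s < u x} = {}" "{x. Mv * s < v x} = {}" if "s \<ge> 1" for s
  proof -
    have "Mu * 1 \<le> Mu * s" "Mv * 1 \<le> Mv * s" using that Mu by (auto intro!: mult_left_mono)
    then show "{x. Mu * s < u x} = {}" "{x. Mv * s < v x} = {}"
      using cSUP_upper[OF UNIV_I bdd(1)] cSUP_upper[OF UNIV_I bdd(2)] unfolding Mu_def Mv_def
      by (auto simp: not_less intro: order_trans)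
  qed
  define Iu Iv Iw where "Iu = (\<integral>\<^sup>+s. indicator {0..} s * emeasure lborel {x. Mu * s < u x} \<partial>lborel)"
    and "Iv = (\<integral>\<^sup>+s. indicator {0..} s * emeasure lborel {x. Mv * s < v x} \<partial>lborel)"
    and "Iw = (\<integral>\<^sup>+s. indicator {0..} s * emeasure lborel {x. m * s < w x} \<partial>lborel)"
  have meas2: "(\<lambda>s. emeasure lborel {x. c * s < f x}) \<in> borel_measurable borel"
    if [measurable]: "f \<in> borel_measurable borel" for c :: real and f :: "real \<Rightarrow> real"
  proof -
    have "(\<lambda>s. emeasure lborel {x \<in> space lborel. c * s < f x}) \<in> borel_measurable borel"
      by (rule lborel.measurable_emeasure) measurable
    then show ?thesis by simp
  qed
  note [measurable] = meas2[OF meas(1)] meas2[OF meas(2)] meas2[OF meas(3)]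
  have "ennreal (1-l) * Iu + ennreal l * Iv 
     = (\<integral>\<^sup>+s. ennreal (1-l) * (indicator {0..} s * emeasure lborel {x. Mu * s < u x}) + ennreal l * (indicator {0..} s * emeasure lborel {x. Mv * s < v x}) \<partial>lborel)"
    unfolding Iu_def Iv_def by (subst nn_integral_add) (auto simp: nn_integral_cmult)
  also have "\<dots> = (\<integral>\<^sup>+s. indicator {0..<1} s * (ennreal (1-l) * emeasure lborel {x. Mu * s < u x} + ennreal l * emeasure lborel {x. Mv * s < v x}) \<partial>lborel)"
  proof (intro nn_integral_cong)
    fix s :: real
    show "ennreal (1-l) * (indicator {0..} s * emeasure lborel {x. Mu * s < u x}) + ennreal l * (indicator {0..} s * emeasure lborel {x. Mv * s < v x})
     = indicator {0..<1} s * (ennreal (1-l) * emeasure lborel {x. Mu * s < u x} + ennreal l * emeasure lborel {x. Mv * s < v x})"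
      using emp[of s] by (cases "s \<ge> 1") (auto simp: indicator_def)
  qed
  also have "\<dots> \<le> Iw" unfolding Iw_def by (intro nn_integral_mono mono)
  finally have key: "ennreal (1-l) * Iu + ennreal l * Iv \<le> Iw" .
  have lc: "ennreal (\<integral>x. u x \<partial>lborel) = ennreal Mu * Iu" "ennreal (\<integral>x. v x \<partial>lborel) = ennreal Mv * Iv"
    "ennreal (\<integral>x. w x \<partial>lborel) = ennreal m * Iw"
    using iu nn layer_cake_scaled[OF meas(1) Mu(1)] layer_cake_scaled[OF meas(2) Mu(2)] layer_cake_scaled[OF meas(3) m]
    by (auto simp: nn_integral_eq_integral Iu_def Iv_def Iw_def)
  define iu iv iw where "iu = (\<integral>x. u x \<partial>lborel)" "iv = (\<integral>x. v x \<partial>lborel)" "iw = (\<integral>x. w x \<partial>lborel)"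
  note ii = this
  have i0: "iu \<ge> 0" "iv \<ge> 0" "iw \<ge> 0" unfolding ii using nn by simp_all
  have div: "X = ennreal (i / M)" if "ennreal i = ennreal M * X" "M > 0" "i \<ge> 0" for X i M
  proof -
    have "ennreal (i / M) = ennreal M * X / ennreal M" using that by (simp add: divide_ennreal flip: that(1))
    also have "\<dots> = X" using that
      by (simp add: ennreal_mult_divide_eq mult.commute[of "ennreal M"])
    finally show ?thesis by simp
  qed
  have "Iu = ennreal (iu / Mu)" "Iv = ennreal (iv / Mv)" "Iw = ennreal (iw / m)"
    using lc[folded ii] i0 Mu m by (auto intro!: div)
  with key have "ennreal (1-l) * ennreal (iu/Mu) + ennreal l * ennreal (iv/Mv) \<le> ennreal (iw / m)"
    by simp
  moreover have "ennreal ((1-l) * (iu/Mu) + l * (iv/Mv)) = ennreal (1-l) * ennreal (iu/Mu) + ennreal l * ennreal (iv/Mv)"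
    using i0 Mu l by (subst ennreal_plus) (auto simp flip: ennreal_mult)
  ultimately have "ennreal ((1-l) * (iu/Mu) + l * (iv/Mv)) \<le> ennreal (iw / m)" by simp
  then have *: "(1-l) * (iu/Mu) + l * (iv/Mv) \<le> iw / m"
    using i0 m by (subst (asm) ennreal_le_iff) auto
  have "(iu/Mu) powr (1-l) * (iv/Mv) powr l \<le> (1-l) * (iu/Mu) + l * (iv/Mv)"
  proof (cases "iu = 0 \<or> iv = 0")
    case True
    then show ?thesis using i0 Mu l by (auto intro!: add_nonneg_nonneg)
  next
    case False
    then show ?thesis using i0 Mu l
      using Youngs_inequality_0[of "1 - l" l "iu/Mu" "iv/Mv"] by auto
  qed
  with * have "(iu/Mu) powr (1-l) * (iv/Mv) powr l \<le> iw / m" by simp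
  moreover have "(iu/Mu) powr (1-l) * (iv/Mv) powr l = iu powr (1-l) * iv powr l / m"
    using i0 Mu by (simp add: powr_divide m_def)
  ultimately show ?thesis using m unfolding ii by (simp add: divide_le_cancel)
qed

section \<open>Marginals of log-concave functions\<close>

definition marginal :: "'a::euclidean_space \<Rightarrow> ('a \<Rightarrow> real) \<Rightarrow> 'a \<Rightarrow> real" where
  "marginal e h x = (\<integral>s. h (x + s *\<^sub>R e) \<partial>lborel)"

text \<open>
  Directions are integrated out one at a time, so that the one-dimensional inequality suffices.
\<close>

fun marginals :: "'a::euclidean_space list \<Rightarrow> ('a \<Rightarrow> real) \<Rightarrow> 'a \<Rightarrow> real" where
  "marginals [] h = h"
| "marginals (e # es) h = marginals es (marginal e h)"

definition orthonormal :: "'a::euclidean_space set \<Rightarrow> bool" where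
  "orthonormal E \<longleftrightarrow> pairwise orthogonal E \<and> (\<forall>e\<in>E. norm e = 1)"

text \<open>
  A class of functions closed under integrating out directions of \<open>D\<close>, on which all the
  iterated integrals converge. The support is required to be bounded only along \<open>D\<close>, because a
  marginal is constant along the directions that have already been integrated out.
\<close>

definition tame :: "'a::euclidean_space set \<Rightarrow> ('a \<Rightarrow> real) \<Rightarrow> bool" where
  "tame D h \<longleftrightarrow> h \<in> borel_measurable borel \<and> (\<exists>B. \<forall>x. \<bar>h x\<bar> \<le> B) \<and>
     (\<exists>R. \<forall>x. h x \<noteq> 0 \<longrightarrow> (\<forall>e\<in>D. \<bar>x \<bullet> e\<bar> \<le> R))"

definition log_concave :: "('a::real_vector \<Rightarrow> real) \<Rightarrow> bool" where
  "log_concave h \<longleftrightarrow> (\<forall>x. 0 \<le> h x) \<and>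
     (\<forall>x y l. 0 < l \<longrightarrow> l < 1 \<longrightarrow> h x powr (1 - l) * h y powr l \<le> h ((1 - l) *\<^sub>R x + l *\<^sub>R y))"

lemma orthonormal_inner:
  assumes "orthonormal E" "a \<in> E" "b \<in> E"
  shows "a \<bullet> b = (if a = b then 1 else 0)"
  using assms by (auto simp: orthonormal_def pairwise_def orthogonal_def norm_eq_1)

lemma orthonormal_subset: "orthonormal E \<Longrightarrow> D \<subseteq> E \<Longrightarrow> orthonormal D"
  by (auto simp: orthonormal_def pairwise_def)

lemma tame_mult:
  assumes "tame D h" "q \<in> borel_measurable borel" "\<And>x. \<bar>q x\<bar> \<le> C"
  shows "tame D (\<lambda>x. q x * h x)"
proof -
  obtain B where B: "\<And>x. \<bar>h x\<bar> \<le> B" using assms(1) unfolding tame_def by blast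
  have "\<bar>q x * h x\<bar> \<le> C * B" for x
    using B[of x] assms(3)[of x] unfolding abs_mult by (intro mult_mono) auto
  moreover have "(\<lambda>x. q x * h x) \<in> borel_measurable borel" using assms unfolding tame_def by auto
  moreover obtain R where "\<And>x e. h x \<noteq> 0 \<Longrightarrow> e \<in> D \<Longrightarrow> \<bar>x \<bullet> e\<bar> \<le> R" using assms(1) unfolding tame_def by blast
  then have "\<exists>R. \<forall>x. q x * h x \<noteq> 0 \<longrightarrow> (\<forall>e\<in>D. \<bar>x \<bullet> e\<bar> \<le> R)" by (intro exI[of _ R]) auto
  ultimately show ?thesis unfolding tame_def by blast
qed

lemma tame_line:
  assumes "tame D h" "e \<in> D" "norm e = 1"
  obtains B R where "\<And>y. \<bar>h y\<bar> \<le> B" "\<And>y s. h (y + s *\<^sub>R e) \<noteq> 0 \<Longrightarrow> s \<in> {- (y \<bullet> e) - R .. - (y \<bullet> e) + R}" "R \<ge> 0"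
    "\<And>y. (\<lambda>s. h (y + s *\<^sub>R e)) \<in> borel_measurable borel"
proof -
  obtain B where B: "\<And>x. \<bar>h x\<bar> \<le> B" using assms(1) unfolding tame_def by blast
  obtain R where R: "\<And>x e. h x \<noteq> 0 \<Longrightarrow> e \<in> D \<Longrightarrow> \<bar>x \<bullet> e\<bar> \<le> R" using assms(1) unfolding tame_def by blast
  have [measurable]: "h \<in> borel_measurable borel" using assms(1) unfolding tame_def by blast
  show ?thesis
  proof (rule that[of B "max R 0"])
    fix y s assume "h (y + s *\<^sub>R e) \<noteq> 0"
    then have "\<bar>(y + s *\<^sub>R e) \<bullet> e\<bar> \<le> R" using R assms by blast
    moreover have "e \<bullet> e = 1" using assms by (simp add: norm_eq_1)
    ultimately have "\<bar>y \<bullet> e + s\<bar> \<le> R" by (simp add: inner_add_left)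
    then show "s \<in> {- (y \<bullet> e) - max R 0 .. - (y \<bullet> e) + max R 0}" by (auto simp: max_def)
  qed (use B in \<open>auto\<close>)
qed

lemma integrable_tame_line:
  assumes "tame D h" "e \<in> D" "norm e = 1"
  shows "integrable lborel (\<lambda>s. h (y + s *\<^sub>R e))"
proof -
  obtain B R where BR: "\<And>y. \<bar>h y\<bar> \<le> B" "\<And>y s. h (y + s *\<^sub>R e) \<noteq> 0 \<Longrightarrow> s \<in> {- (y \<bullet> e) - R .. - (y \<bullet> e) + R}" "R \<ge> 0"
    "\<And>y. (\<lambda>s. h (y + s *\<^sub>R e)) \<in> borel_measurable borel"
    using tame_line[OF assms] by blast
  show ?thesis
  proof (rule integrable_bounded_support[of _ B "R + \<bar>y \<bullet> e\<bar>"])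
    fix s assume "h (y + s *\<^sub>R e) \<noteq> 0"
    then have "s \<in> {- (y \<bullet> e) - R .. - (y \<bullet> e) + R}" using BR by blast
    then show "\<bar>s\<bar> \<le> R + \<bar>y \<bullet> e\<bar>" by auto
  qed (use BR in auto)
qed

lemma tame_marginal:
  assumes h: "tame (insert e D) h" and E: "orthonormal (insert e D)" and e: "e \<notin> D"
  shows "tame D (marginal e h)"
proof -
  have e1: "norm e = 1" using E by (auto simp: orthonormal_def)
  obtain B R where BR: "\<And>y. \<bar>h y\<bar> \<le> B" "\<And>y s. h (y + s *\<^sub>R e) \<noteq> 0 \<Longrightarrow> s \<in> {- (y \<bullet> e) - R .. - (y \<bullet> e) + R}" "R \<ge> 0"
    "\<And>y. (\<lambda>s. h (y + s *\<^sub>R e)) \<in> borel_measurable borel"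
    using tame_line[OF h insertI1 e1] by blast
  have [measurable]: "h \<in> borel_measurable borel" using h unfolding tame_def by blast
  have m: "marginal e h \<in> borel_measurable borel"
    unfolding marginal_def by (intro lborel.borel_measurable_lebesgue_integral) measurable
  have bd: "\<bar>marginal e h x\<bar> \<le> B * (2 * R)" for x
  proof -
    let ?I = "{- (x \<bullet> e) - R .. - (x \<bullet> e) + R}"
    have "\<bar>marginal e h x\<bar> \<le> (\<integral>s. \<bar>h (x + s *\<^sub>R e)\<bar> \<partial>lborel)"
      unfolding marginal_def by (rule integral_abs_bound)
    also have "\<dots> \<le> (\<integral>s. B * indicator ?I s \<partial>lborel)"
    proof (rule integral_mono)
      show "integrable lborel (\<lambda>s. \<bar>h (x + s *\<^sub>R e)\<bar>)"
        using integrable_tame_line[OF h _ e1] by auto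
      show "integrable lborel (\<lambda>s. B * indicator ?I s)"
        by (intro integrable_mult_right integrable_real_indicator) (auto simp: emeasure_lborel_Icc_eq)
      have "0 \<le> B" using BR(1)[of 0] by linarith
      then show "\<bar>h (x + s *\<^sub>R e)\<bar> \<le> B * indicator ?I s" for s
        using BR(1)[of "x + s *\<^sub>R e"] BR(2)[of x s] by (cases "h (x + s *\<^sub>R e) = 0") auto
    qed
    also have "\<dots> = B * (2 * R)" using BR(3) by simp
    finally show ?thesis .
  qed
  obtain R' where R': "\<And>x b. h x \<noteq> 0 \<Longrightarrow> b \<in> D \<Longrightarrow> \<bar>x \<bullet> b\<bar> \<le> R'" using h unfolding tame_def by blast
  have "\<bar>x \<bullet> b\<bar> \<le> R'" if nz: "marginal e h x \<noteq> 0" and b: "b \<in> D" for x b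
  proof -
    have "\<exists>s. h (x + s *\<^sub>R e) \<noteq> 0"
    proof (rule ccontr)
      assume "\<not> ?thesis" then have "marginal e h x = 0" unfolding marginal_def by simp
      then show False using nz by simp
    qed
    then obtain s where "h (x + s *\<^sub>R e) \<noteq> 0" by blast
    then have "\<bar>(x + s *\<^sub>R e) \<bullet> b\<bar> \<le> R'" using R' b by blast
    moreover have "e \<bullet> b = 0" using orthonormal_inner[OF E, of e b] b e by auto
    ultimately show ?thesis by (simp add: inner_add_left)
  qed
  then show ?thesis using m bd unfolding tame_def by blast
qed

lemma log_concave_superlevel_convex:
  assumes h: "log_concave h" and c: "0 \<le> c"
  shows "convex {s. c < h (x + s *\<^sub>R e)}"
  unfolding convex_alt
proof (intro ballI allI impI)
  fix p q l :: real assume pq: "p \<in> {s. c < h (x + s *\<^sub>R e)}" "q \<in> {s. c < h (x + s *\<^sub>R e)}" and l: "0 \<le> l \<and> l \<le> 1"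
  consider "l = 0" | "l = 1" | "0 < l" "l < 1" using l by linarith
  then show "(1 - l) *\<^sub>R p + l *\<^sub>R q \<in> {s. c < h (x + s *\<^sub>R e)}"
  proof cases
    case 3
    have "c = c powr (1 - l) * c powr l" using c 3
      by (cases "c = 0") (auto simp flip: powr_add)
    also have "\<dots> < h (x + p *\<^sub>R e) powr (1 - l) * h (x + q *\<^sub>R e) powr l"
      using pq c 3 by (intro mult_strict_mono) (auto intro!: powr_less_mono2)
    also have "\<dots> \<le> h ((1 - l) *\<^sub>R (x + p *\<^sub>R e) + l *\<^sub>R (x + q *\<^sub>R e))"
      using h 3 unfolding log_concave_def by blast
    also have "(1 - l) *\<^sub>R (x + p *\<^sub>R e) + l *\<^sub>R (x + q *\<^sub>R e) = x + ((1 - l) *\<^sub>R p + l *\<^sub>R q) *\<^sub>R e"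
      by (simp add: algebra_simps)
    finally show ?thesis by simp
  qed (use pq in auto)
qed

text \<open>
  Prekopa's theorem for one direction: apply the Prekopa-Leindler inequality to the restrictions of
  \<open>h\<close> to the three parallel lines through \<open>x\<close>, \<open>y\<close> and their convex combination.
\<close>

lemma log_concave_marginal:
  assumes h: "log_concave h" and t: "tame D h" "e \<in> D" "norm e = 1"
  shows "log_concave (marginal e h)"
  unfolding log_concave_def
proof (intro conjI allI impI)
  have nn: "0 \<le> h y" for y using h unfolding log_concave_def by blast
  then show "0 \<le> marginal e h x" for x unfolding marginal_def by simp
  fix x y :: 'a and l :: real assume l: "0 < l" "l < 1"
  let ?z = "(1 - l) *\<^sub>R x + l *\<^sub>R y"
  obtain B R where BR: "\<And>y. \<bar>h y\<bar> \<le> B" "\<And>y s. h (y + s *\<^sub>R e) \<noteq> 0 \<Longrightarrow> s \<in> {- (y \<bullet> e) - R .. - (y \<bullet> e) + R}" "R \<ge> 0"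
    "\<And>y. (\<lambda>s. h (y + s *\<^sub>R e)) \<in> borel_measurable borel"
    using tame_line[OF t] by blast
  define R' where "R' = R + \<bar>x \<bullet> e\<bar> + \<bar>y \<bullet> e\<bar> + \<bar>?z \<bullet> e\<bar>"
  have sp: "\<bar>s\<bar> \<le> R'" if "h (w + s *\<^sub>R e) \<noteq> 0" "w \<in> {x, y, ?z}" for w s
  proof -
    have "s \<in> {- (w \<bullet> e) - R .. - (w \<bullet> e) + R}" using BR that by blast
    then have "\<bar>s\<bar> \<le> R + \<bar>w \<bullet> e\<bar>" by auto
    also have "\<dots> \<le> R'" using that(2) unfolding R'_def by (auto simp del: inner_add_left inner_scaleR_left)
    finally show ?thesis .
  qed
  show "marginal e h x powr (1 - l) * marginal e h y powr l \<le> marginal e h ?z"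
    unfolding marginal_def
  proof (rule Prekopa_Leindler_interval[where B = B and R = R'])
    fix p q :: real
    have "h (x + p *\<^sub>R e) powr (1 - l) * h (y + q *\<^sub>R e) powr l 
       \<le> h ((1 - l) *\<^sub>R (x + p *\<^sub>R e) + l *\<^sub>R (y + q *\<^sub>R e))"
      using h l unfolding log_concave_def by blast
    also have "(1 - l) *\<^sub>R (x + p *\<^sub>R e) + l *\<^sub>R (y + q *\<^sub>R e) = ?z + ((1 - l) * p + l * q) *\<^sub>R e"
      by (simp add: algebra_simps)
    finally show "h (x + p *\<^sub>R e) powr (1 - l) * h (y + q *\<^sub>R e) powr l 
       \<le> h (?z + ((1 - l) * p + l * q) *\<^sub>R e)" .
  qed (use BR(4) nn l sp BR(1) log_concave_superlevel_convex[OF h] in \<open>auto intro: order_trans[OF abs_ge_self]\<close>)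
qed

lemma marginal_pos_ball:
  assumes h: "\<And>x. x \<in> ball 0 r \<Longrightarrow> 0 < h x" and nn: "\<And>x. 0 \<le> h x"
    and t: "tame D h" "e \<in> D" "norm e = 1" and x: "x \<in> ball 0 r"
  shows "0 < marginal e h x"
proof -
  have nz: "marginal e h x \<noteq> 0"
  proof
    assume "marginal e h x = 0"
    then have "AE s in lborel. h (x + s *\<^sub>R e) = 0"
      unfolding marginal_def using integral_nonneg_eq_0_iff_AE[OF integrable_tame_line[OF t]] nn by auto
    moreover have "AE s in lborel. s \<in> {0<..<r - norm x} \<longrightarrow> h (x + s *\<^sub>R e) \<noteq> 0"
    proof (rule AE_I2, rule impI)
      fix s assume s: "s \<in> {0<..<r - norm x}"
      have "norm (x + s *\<^sub>R e) \<le> norm x + s" using norm_triangle_ineq[of x "s *\<^sub>R e"] t(3) s by simp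
      then have "x + s *\<^sub>R e \<in> ball 0 r" using s by auto
      then show "h (x + s *\<^sub>R e) \<noteq> 0" using h by force
    qed
    ultimately have "AE s in lborel. s \<notin> {0<..<r - norm x}" by eventually_elim auto
    then have "emeasure lborel {0<..<r - norm x} = 0"
      by (subst (asm) AE_iff_measurable[OF _ refl]) (auto simp: greaterThanLessThan_def greaterThan_def lessThan_def Int_def)
    then show False using x by simp
  qed
  moreover have "0 \<le> marginal e h x" unfolding marginal_def using nn by simp
  ultimately show ?thesis by simp
qed

lemma marginal_mult_invariant:
  assumes "\<And>x s. q (x + s *\<^sub>R e) = q x"
  shows "marginal e (\<lambda>x. q x * h x) = (\<lambda>x. q x * marginal e h x)"
  using assms by (auto simp: marginal_def)

lemma integrable_tame_PiM:
  fixes D :: "'a::euclidean_space set"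
  assumes D: "finite D" "orthonormal D" and h: "tame D h"
  shows "integrable (\<Pi>\<^sub>M b\<in>D. lborel) (\<lambda>c. h (\<Sum>b\<in>D. c b *\<^sub>R b))"
proof -
  interpret product_sigma_finite "\<lambda>_::'a. lborel :: real measure" by standard
  obtain B where B: "\<And>x. \<bar>h x\<bar> \<le> B" using h unfolding tame_def by blast
  obtain R where R: "\<And>x e. h x \<noteq> 0 \<Longrightarrow> e \<in> D \<Longrightarrow> \<bar>x \<bullet> e\<bar> \<le> R" using h unfolding tame_def by blast
  have [measurable]: "h \<in> borel_measurable borel" using h unfolding tame_def by blast
  have B0: "0 \<le> B" using B[of 0] by linarith
  let ?X = "PiE D (\<lambda>_. {-R..R})"
  have X: "?X \<in> sets (\<Pi>\<^sub>M b\<in>D. lborel)" using D by (intro sets_PiM_I_finite) auto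
  have eX: "emeasure (\<Pi>\<^sub>M b\<in>D. lborel) ?X < \<infinity>"
    by (subst emeasure_PiM[OF D(1)]) (auto simp: emeasure_lborel_Icc_eq power_less_top_ennreal power_0_left)
  show ?thesis
  proof (rule Bochner_Integration.integrable_bound)
    show "integrable (\<Pi>\<^sub>M b\<in>D. lborel) (\<lambda>c. B * indicator ?X c)"
      using X eX by (intro integrable_mult_right integrable_real_indicator) auto
    show "(\<lambda>c. h (\<Sum>b\<in>D. c b *\<^sub>R b)) \<in> borel_measurable (\<Pi>\<^sub>M b\<in>D. lborel)" by measurable
    show "AE c in (\<Pi>\<^sub>M b\<in>D. lborel). norm (h (\<Sum>b\<in>D. c b *\<^sub>R b)) \<le> norm (B * indicator ?X c)"
    proof (rule AE_I2)
      fix c assume c: "c \<in> space (\<Pi>\<^sub>M b\<in>D. lborel :: real measure)"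
      show "norm (h (\<Sum>b\<in>D. c b *\<^sub>R b)) \<le> norm (B * indicator ?X c)"
      proof (cases "h (\<Sum>b\<in>D. c b *\<^sub>R b) = 0")
        case False
        have "\<bar>c e\<bar> \<le> R" if e: "e \<in> D" for e
        proof -
          have "(\<Sum>b\<in>D. c b *\<^sub>R b) \<bullet> e = (\<Sum>b\<in>D. if b = e then c b else 0)"
            unfolding inner_sum_left by (intro sum.cong) (auto simp: orthonormal_inner[OF D(2)] e)
          then have "(\<Sum>b\<in>D. c b *\<^sub>R b) \<bullet> e = c e" using D e by simp
          then show ?thesis using R[OF False e] by simp
        qed
        then have "c \<in> ?X" using c by (force simp: space_PiM PiE_def abs_le_iff Pi_def)
        then show ?thesis using B B0 by simp
      qed auto
    qed
  qed
qed

lemma integral_marginal: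
  fixes D :: "'a::euclidean_space set"
  assumes D: "finite D" "orthonormal (insert e D)" "e \<notin> D" and h: "tame (insert e D) h"
  shows "(\<integral>c. h (\<Sum>b\<in>insert e D. c b *\<^sub>R b) \<partial>(\<Pi>\<^sub>M b\<in>insert e D. lborel))
     = (\<integral>c. marginal e h (\<Sum>b\<in>D. c b *\<^sub>R b) \<partial>(\<Pi>\<^sub>M b\<in>D. lborel))"
proof -
  interpret product_sigma_finite "\<lambda>_::'a. lborel :: real measure" by standard
  have "(\<Sum>b\<in>insert e D. (c(e := s)) b *\<^sub>R b) = (\<Sum>b\<in>D. c b *\<^sub>R b) + s *\<^sub>R e" for c :: "'a \<Rightarrow> real" and s
  proof -
    have "(\<Sum>b\<in>D. (c(e := s)) b *\<^sub>R b) = (\<Sum>b\<in>D. c b *\<^sub>R b)" using D by (intro sum.cong) auto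
    then show ?thesis using D by (simp add: add.commute)
  qed
  then show ?thesis
    using D(1,3) integrable_tame_PiM[OF _ D(2) h]
    by (subst product_integral_insert) (auto simp: marginal_def add.commute)
qed

lemma marginals_facts:
  fixes D :: "'a::euclidean_space set"
  assumes "distinct es" "set es \<inter> D = {}" "finite D" "orthonormal (set es \<union> D)" "tame (set es \<union> D) h"
  shows integral_marginals: "(\<integral>c. h (\<Sum>b\<in>set es \<union> D. c b *\<^sub>R b) \<partial>(\<Pi>\<^sub>M b\<in>set es \<union> D. lborel))
     = (\<integral>c. marginals es h (\<Sum>b\<in>D. c b *\<^sub>R b) \<partial>(\<Pi>\<^sub>M b\<in>D. lborel))"
    and tame_marginals: "tame D (marginals es h)"
    and log_concave_marginals: "log_concave h \<Longrightarrow> log_concave (marginals es h)"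
    and marginals_pos_ball: "log_concave h \<Longrightarrow> \<forall>x\<in>ball 0 r. 0 < h x \<Longrightarrow> \<forall>x\<in>ball 0 r. 0 < marginals es h x"
proof -
  have "(\<integral>c. h (\<Sum>b\<in>set es \<union> D. c b *\<^sub>R b) \<partial>(\<Pi>\<^sub>M b\<in>set es \<union> D. lborel))
     = (\<integral>c. marginals es h (\<Sum>b\<in>D. c b *\<^sub>R b) \<partial>(\<Pi>\<^sub>M b\<in>D. lborel)) \<and> tame D (marginals es h) \<and>
     (log_concave h \<longrightarrow> log_concave (marginals es h)) \<and>
     (log_concave h \<longrightarrow> (\<forall>x\<in>ball 0 r. 0 < h x) \<longrightarrow> (\<forall>x\<in>ball 0 r. 0 < marginals es h x))"
    using assms
  proof (induction es arbitrary: h)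
    case (Cons e es)
    let ?E = "set es \<union> D"
    have E: "set (e # es) \<union> D = insert e ?E" "e \<notin> ?E" "finite ?E" using Cons.prems by auto
    have o: "orthonormal (insert e ?E)" and t: "tame (insert e ?E) h"
      using Cons.prems(4,5) unfolding E(1) by blast+
    have e1: "norm e = 1" using o by (auto simp: orthonormal_def)
    have 1: "tame ?E (marginal e h)" by (rule tame_marginal[OF t o E(2)])
    have 2: "orthonormal ?E" using o by (rule orthonormal_subset) auto
    have 3: "log_concave h \<Longrightarrow> log_concave (marginal e h)" by (rule log_concave_marginal[OF _ t _ e1]) auto
    have 4: "\<forall>x\<in>ball 0 r. 0 < marginal e h x" if "log_concave h" "\<forall>x\<in>ball 0 r. 0 < h x"
      using marginal_pos_ball[OF _ _ t _ e1] that unfolding log_concave_def by blast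
    have d: "distinct es" "set es \<inter> D = {}" using Cons.prems by auto
    show ?case
      unfolding E(1) marginals.simps integral_marginal[OF E(3) o E(2) t]
      using Cons.IH[OF d Cons.prems(3) 2 1] 3 4 by blast
  qed auto
  then show "(\<integral>c. h (\<Sum>b\<in>set es \<union> D. c b *\<^sub>R b) \<partial>(\<Pi>\<^sub>M b\<in>set es \<union> D. lborel))
     = (\<integral>c. marginals es h (\<Sum>b\<in>D. c b *\<^sub>R b) \<partial>(\<Pi>\<^sub>M b\<in>D. lborel))" "tame D (marginals es h)"
     "log_concave h \<Longrightarrow> log_concave (marginals es h)"
     "log_concave h \<Longrightarrow> \<forall>x\<in>ball 0 r. 0 < h x \<Longrightarrow> \<forall>x\<in>ball 0 r. 0 < marginals es h x"
    by blast+
qed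

lemma marginals_mult_invariant:
  assumes "\<And>x s e. e \<in> set es \<Longrightarrow> q (x + s *\<^sub>R e) = q x"
  shows "marginals es (\<lambda>x. q x * h x) = (\<lambda>x. q x * marginals es h x)"
  using assms
proof (induction es arbitrary: h)
  case (Cons e es)
  then show ?case using marginal_mult_invariant[of q e h] by simp
qed auto

text \<open>
  The region strictly below the graph of the concave function \<open>ln f - ln (f 0)\<close> is convex and misses the
  origin. A hyperplane separating them is not vertical, since \<open>f\<close> is positive around 0; its slope is
  the supergradient.
\<close>

lemma log_concave_supergradient:
  fixes f :: "'a::euclidean_space \<Rightarrow> real"
  assumes f: "log_concave f" and r: "r > 0" and pos: "\<forall>x\<in>ball 0 r. 0 < f x"
  obtains a where "\<And>y. f y \<le> f 0 * exp (a \<bullet> y)"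
proof -
  define S where "S = {p. 0 < f (fst p) \<and> snd p < ln (f (fst p)) - ln (f 0)}"
  have lcv: "(1 - l) * ln (f x) + l * ln (f y) \<le> ln (f ((1 - l) *\<^sub>R x + l *\<^sub>R y)) \<and> 0 < f ((1 - l) *\<^sub>R x + l *\<^sub>R y)"
    if fxy: "0 < f x" "0 < f y" "0 \<le> l" "l \<le> 1" for x y and l :: real
  proof -
    consider "l = 0" | "l = 1" | "0 < l" "l < 1" using fxy by linarith
    then show ?thesis
    proof cases
      case 3
      have "f x powr (1 - l) * f y powr l \<le> f ((1 - l) *\<^sub>R x + l *\<^sub>R y)"
        using f 3 unfolding log_concave_def by blast
      moreover have "0 < f x powr (1 - l) * f y powr l" using fxy by simp
      ultimately have "ln (f x powr (1 - l) * f y powr l) \<le> ln (f ((1 - l) *\<^sub>R x + l *\<^sub>R y))" 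
        "0 < f ((1 - l) *\<^sub>R x + l *\<^sub>R y)" by auto
      then show ?thesis using fxy by (simp add: ln_mult ln_powr)
    qed (use fxy in auto)
  qed
  have "convex S"
    unfolding convex_alt
  proof (intro ballI allI impI)
    fix p q and l :: real assume pq: "p \<in> S" "q \<in> S" and l: "0 \<le> l \<and> l \<le> 1"
    have "(1 - l) * snd p + l * snd q < (1 - l) * (ln (f (fst p)) - ln (f 0)) + l * (ln (f (fst q)) - ln (f 0))"
    proof (cases "l = 0")
      case False
      then show ?thesis using pq l unfolding S_def
        by (intro add_le_less_mono mult_left_mono mult_strict_left_mono) auto
    qed (use pq in \<open>auto simp: S_def\<close>)
    also have "\<dots> = (1 - l) * ln (f (fst p)) + l * ln (f (fst q)) - ln (f 0)" by (simp add: algebra_simps)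
    finally show "(1 - l) *\<^sub>R p + l *\<^sub>R q \<in> S" using lcv[of "fst p" "fst q" l] pq l by (auto simp: S_def)
  qed
  moreover have "0 \<notin> S" using r pos by (auto simp: S_def)
  ultimately obtain w where w: "w \<noteq> 0" "\<And>p. p \<in> S \<Longrightarrow> 0 \<le> w \<bullet> p"
    using separating_hyperplane_set_0[of S] by blast
  obtain al be where ab: "w = (al, be)" by (cases w)
  have W: "0 \<le> al \<bullet> y + be * s" if "0 < f y" "s < ln (f y) - ln (f 0)" for y s
    using w(2)[of "(y, s)"] that by (simp add: S_def ab)
  have f0: "0 < f 0" using r pos by auto
  have "be \<le> 0" using W[of 0 "-1"] f0 by simp
  moreover have "be \<noteq> 0"
  proof
    assume b0: "be = 0"
    then have al: "al \<noteq> 0" using w(1) ab by (auto simp: zero_prod_def)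
    define y where "y = - (r / (2 * norm al)) *\<^sub>R al"
    have "norm y < r" using al r by (simp add: y_def)
    then have "0 < f y" using pos by auto
    then have "0 \<le> al \<bullet> y" using W[of y "ln (f y) - ln (f 0) - 1"] b0 by simp
    moreover have "al \<bullet> y < 0" using al r by (simp add: y_def)
    ultimately show False by simp
  qed
  ultimately have be: "be < 0" by simp
  show ?thesis
  proof (rule that[of "(- 1 / be) *\<^sub>R al"])
    fix y
    have fy: "0 \<le> f y" using f unfolding log_concave_def by blast
    show "f y \<le> f 0 * exp (((- 1 / be) *\<^sub>R al) \<bullet> y)"
    proof (cases "f y = 0")
      case False
      then have fy: "0 < f y" using fy by simp
      have "ln (f y) - ln (f 0) \<le> - (al \<bullet> y) / be"
      proof (rule dense_le)
        fix s assume "s < ln (f y) - ln (f 0)"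
        then have "0 \<le> al \<bullet> y + be * s" using W fy by blast
        then show "s \<le> - (al \<bullet> y) / be" using be by (simp add: field_simps)
      qed
      then have "exp (ln (f y) - ln (f 0)) \<le> exp (- (al \<bullet> y) / be)" by simp
      moreover have "exp (ln (f y) - ln (f 0)) = f y / f 0" using fy f0 by (simp add: exp_diff)
      ultimately show ?thesis using f0 by (simp add: field_simps)
    qed (use f0 in auto)
  qed
qed

section \<open>Lebesgue measure in the coordinates of a basis\<close>

text \<open>
  By Fubini, along the axis \<open>m\<close> a shear is a translation.
\<close>

lemma lborel_shear:
  fixes m n :: "'n::finite"
  assumes mn: "m \<noteq> n" and X: "X \<in> sets borel"
  defines "f \<equiv> \<lambda>x :: real^'n. \<chi> i. if i = m then x $ m + x $ n else x $ i"
  shows "emeasure lborel (f -` X) = emeasure lborel X"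
proof -
  interpret product_sigma_finite "\<lambda>_::real^'n. lborel :: real measure" by standard
  define am where "am = axis m (1::real)"
  define an where "an = axis n (1::real)"
  define B where "B = Basis - {am}"
  have am: "am \<in> Basis" "an \<in> B" using mn by (auto simp: am_def an_def B_def axis_eq_axis)
  have B: "Basis = insert am B" "finite B" "am \<notin> B" using am by (auto simp: B_def)
  define S where "S c = (\<Sum>b\<in>B. c b *\<^sub>R b)" for c :: "real^'n \<Rightarrow> real"
  have S[measurable]: "S \<in> borel_measurable (Pi\<^sub>M B (\<lambda>_. lborel))" unfolding S_def[abs_def] by measurable
  have f: "linear f" unfolding f_def by (intro linearI) (auto simp: vec_eq_iff algebra_simps)
  have fx: "f x = x + (x \<bullet> an) *\<^sub>R am" for x
    by (simp add: f_def am_def an_def vec_eq_iff inner_axis) (auto simp: axis_def)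
  have [measurable]: "f \<in> borel_measurable borel"
    using f by (simp add: borel_measurable_continuous_onI linear_continuous_on linear_conv_bounded_linear)
  have Sm: "S c $ m = 0" and Sn: "S c \<bullet> an = c an" for c
  proof -
    have "S c $ m = (\<Sum>b\<in>B. c b * (b \<bullet> am))" unfolding S_def by (simp add: am_def inner_axis)
    also have "\<dots> = 0" by (intro sum.neutral) (use am(1) in \<open>auto simp: inner_Basis B_def\<close>)
    finally show "S c $ m = 0" .
    have "S c \<bullet> an = (\<Sum>b\<in>B. if b = an then c b else 0)" unfolding S_def inner_sum_left
      by (intro sum.cong) (use am in \<open>auto simp: inner_Basis B_def\<close>)
    then show "S c \<bullet> an = c an" using B am by simp
  qed
  have key: "emeasure lborel Y = (\<integral>\<^sup>+c. (\<integral>\<^sup>+y. indicator Y (y *\<^sub>R am + S c) \<partial>lborel) \<partial>Pi\<^sub>M B (\<lambda>_. lborel))"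
    if Y[measurable]: "Y \<in> sets borel" for Y
  proof -
    have "emeasure lborel Y = (\<integral>\<^sup>+x. indicator Y x \<partial>lborel)" by simp
    also have "\<dots> = (\<integral>\<^sup>+c. indicator Y (\<Sum>b\<in>Basis. c b *\<^sub>R b) \<partial>(\<Pi>\<^sub>M b\<in>Basis. lborel))"
      by (subst lborel_eq, subst nn_integral_distr) auto
    also have "\<dots> = (\<integral>\<^sup>+c. (\<integral>\<^sup>+y. indicator Y (\<Sum>b\<in>insert am B. (c(am := y)) b *\<^sub>R b) \<partial>lborel) \<partial>Pi\<^sub>M B (\<lambda>_. lborel))"
      unfolding B(1) using B(2,3) by (subst product_nn_integral_insert) auto
    also have "(\<Sum>b\<in>insert am B. (c(am := y)) b *\<^sub>R b) = y *\<^sub>R am + S c" for c y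
    proof -
      have "(\<Sum>b\<in>B. (c(am := y)) b *\<^sub>R b) = S c" unfolding S_def using B(3) by (intro sum.cong) auto
      then show ?thesis using B(2,3) by simp
    qed
    then have "(\<integral>\<^sup>+c. (\<integral>\<^sup>+y. indicator Y (\<Sum>b\<in>insert am B. (c(am := y)) b *\<^sub>R b) \<partial>lborel) \<partial>Pi\<^sub>M B (\<lambda>_. lborel))
       = (\<integral>\<^sup>+c. (\<integral>\<^sup>+y. indicator Y (y *\<^sub>R am + S c) \<partial>lborel) \<partial>Pi\<^sub>M B (\<lambda>_. lborel))" by presburger
    finally show ?thesis .
  qed
  have an: "am \<bullet> an = 0" using mn by (simp add: am_def an_def inner_axis_axis)
  have fX: "f -` X \<in> sets borel" using X measurable_sets[of f borel borel X] by simp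
  note [measurable] = X
  have "emeasure lborel (f -` X) = (\<integral>\<^sup>+c. (\<integral>\<^sup>+y. indicator X (f (y *\<^sub>R am + S c)) \<partial>lborel) \<partial>Pi\<^sub>M B (\<lambda>_. lborel))"
    unfolding key[OF fX] by (simp add: indicator_vimage)
  also have "f (y *\<^sub>R am + S c) = (c an + 1 * y) *\<^sub>R am + S c" for y c
    by (simp add: fx inner_add_left an Sn algebra_simps)
  then have "(\<integral>\<^sup>+c. (\<integral>\<^sup>+y. indicator X (f (y *\<^sub>R am + S c)) \<partial>lborel) \<partial>Pi\<^sub>M B (\<lambda>_. lborel))
     = (\<integral>\<^sup>+c. (\<integral>\<^sup>+y. indicator X ((c an + 1 * y) *\<^sub>R am + S c) \<partial>lborel) \<partial>Pi\<^sub>M B (\<lambda>_. lborel))" by presburger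
  also have "\<dots> = (\<integral>\<^sup>+c. (\<integral>\<^sup>+y. indicator X (y *\<^sub>R am + S c) \<partial>lborel) \<partial>Pi\<^sub>M B (\<lambda>_. lborel))"
  proof (rule nn_integral_cong)
    fix c
    show "(\<integral>\<^sup>+y. indicator X ((c an + 1 * y) *\<^sub>R am + S c) \<partial>lborel) = (\<integral>\<^sup>+y. indicator X (y *\<^sub>R am + S c) \<partial>lborel)"
      using nn_integral_real_affine[of "\<lambda>y. indicator X (y *\<^sub>R am + S c)" 1 "c an"] by simp
  qed
  also have "\<dots> = emeasure lborel X" using key[OF X] by simp
  finally show ?thesis .
qed

text \<open>
  A linear map is a composition of elementary ones. The claim is multiplicative in the map,
  singular factors are excluded by the determinant, and the remaining elementary maps are diagonal
  maps, transpositions and shears.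
\<close>

lemma emeasure_lborel_linear_vimage:
  fixes f :: "real^'n \<Rightarrow> real^'n"
  assumes "linear f" "det (matrix f) \<noteq> 0" "X \<in> sets borel"
  shows "emeasure lborel X = ennreal \<bar>det (matrix f)\<bar> * emeasure lborel (f -` X)"
proof -
  have vim: "g -` X \<in> sets borel" if "linear g" "X \<in> sets borel" for g :: "real^'n \<Rightarrow> real^'n" and X
    using measurable_sets[of g borel borel X] that
    by (simp add: borel_measurable_continuous_onI linear_continuous_on linear_conv_bounded_linear)
  have "linear f \<and> (det (matrix f) \<noteq> 0 \<longrightarrow> (\<forall>X\<in>sets borel. emeasure lborel X = ennreal \<bar>det (matrix f)\<bar> * emeasure lborel (f -` X)))"
  proof (rule induct_linear_elementary[OF assms(1)], goal_cases)
    case (1 f g)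
    have d: "det (matrix (f \<circ> g)) = det (matrix f) * det (matrix g)"
      using 1 by (simp add: matrix_compose det_mul)
    have "emeasure lborel X = ennreal \<bar>det (matrix f) * det (matrix g)\<bar> * emeasure lborel ((f \<circ> g) -` X)"
      if "det (matrix f) * det (matrix g) \<noteq> 0" "X \<in> sets borel" for X
    proof -
      have "emeasure lborel X = ennreal \<bar>det (matrix f)\<bar> * emeasure lborel (f -` X)" using that 1 by auto
      also have "emeasure lborel (f -` X) = ennreal \<bar>det (matrix g)\<bar> * emeasure lborel (g -` (f -` X))"
        using that 1 vim[of f X] by auto
      finally show ?thesis by (simp add: abs_mult ennreal_mult mult.assoc vimage_comp)
    qed
    moreover have "linear (f \<circ> g)" using 1 linear_compose by blast
    ultimately show ?case unfolding d by blast
  next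
    case (2 f i)
    have "row i (matrix f) = 0" using 2 by (auto simp: row_def matrix_def vec_eq_iff)
    then show ?case using 2 det_zero_row(2)[of i "matrix f"] by simp
  next
    case (3 c)
    let ?f = "\<lambda>x::real^'n. \<chi> i. c i * x $ i"
    have lin: "linear ?f" by (intro linearI) (auto simp: vec_eq_iff algebra_simps)
    have m: "matrix ?f = (\<chi> i j. if i = j then c i else 0)" by (auto simp: matrix_def vec_eq_iff axis_def)
    have d: "det (matrix ?f) = (\<Prod>i\<in>UNIV. c i)" unfolding m by (subst det_diagonal) auto
    have "emeasure lborel X = ennreal \<bar>\<Prod>i\<in>UNIV. c i\<bar> * emeasure lborel (?f -` X)"
      if nz: "(\<Prod>i\<in>UNIV. c i) \<noteq> 0" and X: "X \<in> sets borel" for X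
    proof -
      define c' where "c' b = b \<bullet> (\<chi> i. c i)" for b :: "real^'n"
      have T: "0 + (\<Sum>j\<in>Basis. (c' j * (x \<bullet> j)) *\<^sub>R j) = ?f x" for x
        by (rule euclidean_eqI) (auto simp: inner_sum_left inner_Basis if_distrib Basis_vec_def c'_def inner_axis axis_eq_axis inner_axis' sum.If_cases cong: if_cong)
      have nz': "c' j \<noteq> 0" if "j \<in> Basis" for j
        using that nz by (auto simp: Basis_vec_def c'_def inner_axis')
      have p: "(\<Prod>j\<in>Basis. \<bar>c' j\<bar>) = \<bar>\<Prod>i\<in>UNIV. c i\<bar>"
      proof -
        have "bij_betw (\<lambda>i. axis i (1::real)) (UNIV::'n set) Basis"
          by (auto simp: bij_betw_def inj_on_def axis_eq_axis Basis_vec_def)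
        then have "(\<Prod>j\<in>Basis. \<bar>c' j\<bar>) = (\<Prod>i\<in>UNIV. \<bar>c' (axis i 1)\<bar>)"
          by (rule prod.reindex_bij_betw[symmetric])
        then show ?thesis by (simp add: c'_def inner_axis' abs_prod)
      qed
      have "lborel = density (distr lborel borel ?f) (\<lambda>_. (\<Prod>j\<in>Basis. \<bar>c' j\<bar>))"
        using lborel_affine_euclidean[of c' 0, OF nz'] unfolding T .
      then have "emeasure lborel X = emeasure (density (distr lborel borel ?f) (\<lambda>_. (\<Prod>j\<in>Basis. \<bar>c' j\<bar>))) X" by simp
      also have "\<dots> = ennreal \<bar>\<Prod>i\<in>UNIV. c i\<bar> * emeasure (distr lborel borel ?f) X"
        using X by (subst emeasure_density) (auto simp: nn_integral_cmult p)
      also have "emeasure (distr lborel borel ?f) X = emeasure lborel (?f -` X)"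
        using X vim[OF lin X] lin
        by (subst emeasure_distr) (auto simp: borel_measurable_continuous_onI linear_continuous_on linear_conv_bounded_linear)
      finally show ?thesis .
    qed
    then show ?case using d lin by simp
  next
    case (4 m n)
    let ?f = "\<lambda>x::real^'n. \<chi> i. x $ Transposition.transpose m n i"
    have lin: "linear ?f" by (intro linearI) (auto simp: vec_eq_iff algebra_simps)
    have "?f \<circ> ?f = id" by (auto simp: fun_eq_iff vec_eq_iff)
    then have "det (matrix ?f) * det (matrix ?f) = det (matrix (id :: real^'n \<Rightarrow> real^'n))"
      using matrix_compose[OF lin lin] det_mul by metis
    then have d: "\<bar>det (matrix ?f)\<bar> = 1" by (simp add: matrix_id_mat_1 abs_square_eq_1 flip: power2_eq_square)
    have mf: "?f \<in> borel_measurable borel"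
      using lin by (simp add: borel_measurable_continuous_onI linear_continuous_on linear_conv_bounded_linear)
    have "lborel = distr lborel borel ?f"
    proof (rule lborel_eqI)
      fix l u :: "real^'n" assume lu: "\<And>b. b \<in> Basis \<Longrightarrow> l \<bullet> b \<le> u \<bullet> b"
      have "?f -` box l u = box (?f l) (?f u)"
      proof (rule set_eqI)
        fix x
        have "(\<forall>i. l $ i < x $ Transposition.transpose m n i \<and> x $ Transposition.transpose m n i < u $ i) \<longleftrightarrow>
          (\<forall>i. l $ Transposition.transpose m n i < x $ i \<and> x $ i < u $ Transposition.transpose m n i)"
          by (metis transpose_involutory)
        then show "x \<in> ?f -` box l u \<longleftrightarrow> x \<in> box (?f l) (?f u)" by (auto simp: mem_box_cart)
      qed
      moreover have "(\<Prod>b\<in>Basis. (?f u - ?f l) \<bullet> b) = (\<Prod>b\<in>Basis. (u - l) \<bullet> b)"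
      proof -
        have b: "bij_betw (\<lambda>i. axis i (1::real)) (UNIV::'n set) Basis"
          by (auto simp: bij_betw_def inj_on_def axis_eq_axis Basis_vec_def)
        have "(\<Prod>b\<in>Basis. (?f u - ?f l) \<bullet> b) = (\<Prod>i\<in>UNIV. (\<lambda>i. u $ i - l $ i) (Transposition.transpose m n i))"
          using prod.reindex_bij_betw[OF b, of "\<lambda>b. (?f u - ?f l) \<bullet> b"] by (simp add: inner_axis)
        also have "\<dots> = (\<Prod>i\<in>UNIV. u $ i - l $ i)"
          by (rule prod.reindex_bij_betw) simp
        also have "\<dots> = (\<Prod>b\<in>Basis. (u - l) \<bullet> b)"
          using prod.reindex_bij_betw[OF b, of "\<lambda>b. (u - l) \<bullet> b"] by (simp add: inner_axis)
        finally show ?thesis .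
      qed
      moreover have "?f l \<bullet> b \<le> ?f u \<bullet> b" if "b \<in> Basis" for b
      proof -
        have "l $ i \<le> u $ i" for i using lu[of "axis i 1"] by (simp add: inner_axis)
        then show ?thesis using that by (auto simp: Basis_vec_def inner_axis)
      qed
      ultimately show "emeasure (distr lborel borel ?f) (box l u) = (\<Prod>b\<in>Basis. (u - l) \<bullet> b)"
        using mf by (subst emeasure_distr) (auto simp: emeasure_lborel_box)
    qed simp
    then have L: "emeasure lborel X = emeasure (distr lborel borel ?f) X" for X by (rule arg_cong)
    have "emeasure lborel X = emeasure lborel (?f -` X)" if "X \<in> sets borel" for X
      unfolding L[of X] by (subst emeasure_distr) (use mf that in auto)
    then show ?case using d lin by simp
  next
    case (5 m n)
    let ?f = "\<lambda>x::real^'n. \<chi> i. if i = m then x $ m + x $ n else x $ i"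
    have lin: "linear ?f" by (intro linearI) (auto simp: vec_eq_iff algebra_simps)
    have "matrix ?f = (\<chi> k. if k = m then row m (mat 1) + 1 *s row n (mat 1) else row k (mat 1))"
      by (auto simp: matrix_def vec_eq_iff row_def mat_def axis_def)
    then have "det (matrix ?f) = det (mat 1 :: real^'n^'n)"
      using det_row_operation[OF 5, where A = "mat 1 :: real^'n^'n" and c = 1] by presburger
    then have "det (matrix ?f) = 1" by simp
    then show ?case using lborel_shear[OF 5] lin by simp
  qed
  then show ?thesis using assms by blast
qed

lemma lborel_eq_coordinates:
  fixes e :: "'n::finite \<Rightarrow> 'b"
  assumes e: "bij_betw e UNIV E"
  shows "(lborel :: (real^'n) measure) = distr (\<Pi>\<^sub>M b\<in>E. lborel) borel (\<lambda>c. \<chi> i. c (e i))"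
proof (rule lborel_eqI)
  interpret product_sigma_finite "\<lambda>_::'b. lborel :: real measure" by standard
  have E: "finite E" using bij_betw_finite[OF e] by simp
  have eE: "e i \<in> E" for i using e by (auto simp: bij_betw_def)
  have m: "(\<lambda>c. \<chi> i. c (e i)) \<in> borel_measurable (\<Pi>\<^sub>M b\<in>E. (lborel::real measure))"
  proof (subst borel_measurable_euclidean_space, rule ballI)
    fix b :: "real^'n" assume "b \<in> Basis"
    then obtain i where "b = axis i 1" by (auto simp: Basis_vec_def)
    then show "(\<lambda>c. (\<chi> i. c (e i)) \<bullet> b) \<in> borel_measurable (\<Pi>\<^sub>M b\<in>E. (lborel::real measure))"
      using measurable_component_singleton[OF eE[of i], of "\<lambda>_. lborel :: real measure"] by (simp add: inner_axis)
  qed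
  fix l u :: "real^'n" assume lu: "\<And>b. b \<in> Basis \<Longrightarrow> l \<bullet> b \<le> u \<bullet> b"
  define g where "g = inv_into UNIV e"
  have g: "e (g b) = b" if "b \<in> E" for b using that e by (auto simp: g_def bij_betw_def f_inv_into_f)
  have g': "g (e i) = i" for i using e by (auto simp: g_def bij_betw_def)
  have *: "(\<lambda>c. \<chi> i. c (e i)) -` box l u \<inter> space (\<Pi>\<^sub>M b\<in>E. (lborel::real measure)) = (\<Pi>\<^sub>E b\<in>E. {l $ g b <..< u $ g b})"
    (is "?L = ?R")
  proof (rule set_eqI)
    fix c
    have "(\<forall>i. l $ i < c (e i) \<and> c (e i) < u $ i) \<longleftrightarrow> (\<forall>b\<in>E. l $ g b < c b \<and> c b < u $ g b)"
    proof safe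
      fix b assume h: "\<forall>i. l $ i < c (e i) \<and> c (e i) < u $ i" and b: "b \<in> E"
      show "l $ g b < c b" "c b < u $ g b" using spec[OF h, of "g b"] g[OF b] by auto
    next
      fix i assume h: "\<forall>b\<in>E. l $ g b < c b \<and> c b < u $ g b"
      show "l $ i < c (e i)" "c (e i) < u $ i" using bspec[OF h eE[of i]] g'[of i] by auto
    qed
    then show "c \<in> ?L \<longleftrightarrow> c \<in> ?R" by (auto simp: mem_box_cart space_PiM PiE_def Pi_def)
  qed
  have b: "bij_betw (\<lambda>i. axis i (1::real)) (UNIV::'n set) Basis"
    by (auto simp: bij_betw_def inj_on_def axis_eq_axis Basis_vec_def)
  have lu': "l $ i \<le> u $ i" for i using lu[of "axis i 1"] by (simp add: inner_axis)
  have "emeasure (distr (\<Pi>\<^sub>M b\<in>E. lborel) borel (\<lambda>c. \<chi> i. c (e i))) (box l u) = (\<Prod>b\<in>E. emeasure lborel {l $ g b <..< u $ g b})"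
    using m E by (subst emeasure_distr) (auto simp: * emeasure_PiM)
  also have "\<dots> = (\<Prod>b\<in>E. ennreal (u $ g b - l $ g b))" using lu' by simp
  also have "\<dots> = (\<Prod>i\<in>UNIV. ennreal (u $ i - l $ i))"
    using prod.reindex_bij_betw[OF e, of "\<lambda>b. ennreal (u $ g b - l $ g b)"] by (simp add: g')
  also have "\<dots> = ennreal (\<Prod>i\<in>UNIV. u $ i - l $ i)" using lu' by (simp add: prod_ennreal)
  also have "(\<Prod>i\<in>UNIV. u $ i - l $ i) = (\<Prod>b\<in>Basis. (u - l) \<bullet> b)"
    using prod.reindex_bij_betw[OF b, of "\<lambda>b. (u - l) \<bullet> b"] by (simp add: inner_axis)
  finally show "emeasure (distr (\<Pi>\<^sub>M b\<in>E. lborel) borel (\<lambda>c. \<chi> i. c (e i))) (box l u) = (\<Prod>b\<in>Basis. (u - l) \<bullet> b)" .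
qed simp

lemma lborel_basis_det:
  fixes E :: "(real^'n) set" and e :: "'n \<Rightarrow> real^'n"
  assumes E: "independent E" and e: "bij_betw e UNIV E"
  shows "det (\<chi> i j. e j $ i) \<noteq> 0"
    and "(lborel :: (real^'n) measure) = density (distr (\<Pi>\<^sub>M b\<in>E. lborel) borel (\<lambda>c. \<Sum>b\<in>E. c b *\<^sub>R b)) (\<lambda>_. ennreal \<bar>det (\<chi> i j. e j $ i)\<bar>)"
proof -
  have fE: "finite E" using bij_betw_finite[OF e] by simp
  have eE: "e i \<in> E" for i using e by (auto simp: bij_betw_def)
  define f where "f x = (\<Sum>i\<in>UNIV. x $ i *\<^sub>R e i)" for x :: "real^'n"
  have lin: "linear f" unfolding f_def
    by (intro linearI) (auto simp: algebra_simps sum.distrib scaleR_sum_right)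
  have fm: "f \<in> borel_measurable borel"
    using lin by (simp add: borel_measurable_continuous_onI linear_continuous_on linear_conv_bounded_linear)
  have mf: "matrix f = (\<chi> i j. e j $ i)"
  proof -
    have "f (axis j 1) = (\<Sum>i\<in>UNIV. if i = j then e i else 0)" for j
      unfolding f_def by (intro sum.cong) (auto simp: axis_def)
    then show ?thesis by (simp add: matrix_def)
  qed
  define g where "g = inv_into UNIV e"
  have g': "g (e i) = i" for i using e by (auto simp: g_def bij_betw_def)
  have "inj f"
  proof (subst linear_injective_0[OF lin], intro allI impI)
    fix x assume "f x = 0"
    moreover have "f x = (\<Sum>b\<in>E. x $ g b *\<^sub>R b)"
      unfolding f_def using sum.reindex_bij_betw[OF e, of "\<lambda>b. x $ g b *\<^sub>R b"] by (simp add: g')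
    ultimately have "\<forall>b\<in>E. x $ g b = 0" using E fE by (auto simp: independent_explicit)
    then show "x = 0" using eE g' by (metis vec_eq_iff zero_index)
  qed
  then show d: "det (\<chi> i j. e j $ i) \<noteq> 0" using det_nz_iff_inj[OF lin] mf by simp
  have m: "(\<lambda>c. \<chi> i. c (e i)) \<in> borel_measurable (\<Pi>\<^sub>M b\<in>E. (lborel::real measure))"
  proof (subst borel_measurable_euclidean_space, rule ballI)
    fix b :: "real^'n" assume "b \<in> Basis"
    then obtain i where "b = axis i 1" by (auto simp: Basis_vec_def)
    then show "(\<lambda>c. (\<chi> i. c (e i)) \<bullet> b) \<in> borel_measurable (\<Pi>\<^sub>M b\<in>E. (lborel::real measure))"
      using measurable_component_singleton[OF eE[of i], of "\<lambda>_. lborel :: real measure"] by (simp add: inner_axis)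
  qed
  have fs: "f (\<chi> i. c (e i)) = (\<Sum>b\<in>E. c b *\<^sub>R b)" for c
    unfolding f_def using sum.reindex_bij_betw[OF e, of "\<lambda>b. c b *\<^sub>R b"] by simp
  have "distr lborel borel f = distr (distr (\<Pi>\<^sub>M b\<in>E. lborel) borel (\<lambda>c. \<chi> i. c (e i))) borel f"
    using lborel_eq_coordinates[OF e] by simp
  also have "\<dots> = distr (\<Pi>\<^sub>M b\<in>E. lborel) borel (\<lambda>c. \<Sum>b\<in>E. c b *\<^sub>R b)"
    using m fm by (subst distr_distr) (auto simp: comp_def fs)
  finally have 1: "distr (\<Pi>\<^sub>M b\<in>E. lborel) borel (\<lambda>c. \<Sum>b\<in>E. c b *\<^sub>R b) = distr lborel borel f" by simp
  show "(lborel :: (real^'n) measure) = density (distr (\<Pi>\<^sub>M b\<in>E. lborel) borel (\<lambda>c. \<Sum>b\<in>E. c b *\<^sub>R b)) (\<lambda>_. ennreal \<bar>det (\<chi> i j. e j $ i)\<bar>)"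
    unfolding 1
  proof (rule measure_eqI)
    fix X assume "X \<in> sets (lborel :: (real^'n) measure)"
    then have X: "X \<in> sets borel" by simp
    show "emeasure lborel X = emeasure (density (distr lborel borel f) (\<lambda>_. ennreal \<bar>det (\<chi> i j. e j $ i)\<bar>)) X"
      using emeasure_lborel_linear_vimage[OF lin _ X] d mf X fm
      by (simp add: emeasure_density nn_integral_cmult emeasure_distr)
  qed simp
qed

lemma lborel_basis:
  fixes E :: "(real^'n) set"
  assumes E: "independent E" "card E = CARD('n)"
  obtains D where "D > 0" "(lborel :: (real^'n) measure) = density (distr (\<Pi>\<^sub>M b\<in>E. lborel) borel (\<lambda>c. \<Sum>b\<in>E. c b *\<^sub>R b)) (\<lambda>_. ennreal D)"
proof -
  have "\<exists>e. bij_betw e (UNIV::'n set) E"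
    by (rule finite_same_card_bij) (use E independent_imp_finite[OF E(1)] in simp_all)
  then obtain e where e: "bij_betw e (UNIV::'n set) E" ..
  show ?thesis using lborel_basis_det[OF E(1) e] by (intro that[of "\<bar>det (\<chi> i j. e j $ i)\<bar>"]) simp_all
qed

lemma axis_in_int_lattice: "axis i 1 \<in> int_lattice"
  by (auto simp: int_lattice_def axis_def)

lemma lattice_basis_subset:
  fixes B :: "(real ^ 'n) set"
  assumes "lattice_basis B L"
  shows "B \<subseteq> L"
proof
  fix b assume b: "b \<in> B"
  have fin: "finite B" using assms by (auto simp: lattice_basis_def intro: independent_imp_finite)
  have H: "(\<Sum>a\<in>B. of_int ((\<lambda>a. if a = b then 1 else 0) a) *\<^sub>R a) = b"
    using fin b by (simp add: if_distrib[of of_int] if_distrib[of "\<lambda>x. x *\<^sub>R _"] cong: if_cong)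
  have "\<exists>k :: real^'n \<Rightarrow> int. b = (\<Sum>a\<in>B. of_int (k a) *\<^sub>R a) \<and> True"
    by (rule exI, rule conjI, rule H[symmetric], rule TrueI)
  moreover have "L = {\<Sum>b\<in>B. of_int (k b) *\<^sub>R b | k :: real ^ 'n \<Rightarrow> int. True}"
    using assms by (simp add: lattice_basis_def)
  ultimately show "b \<in> L" by blast
qed

lemma lattice_basis_span:
  fixes E :: "(real^'n) set"
  assumes "lattice_basis E int_lattice"
  shows "span E = UNIV" "card E = CARD('n)" "finite E" "independent E" "E \<subseteq> int_lattice"
proof -
  show ind: "independent E" using assms by (simp add: lattice_basis_def)
  then show fin: "finite E" by (rule independent_imp_finite)
  have L: "int_lattice = {\<Sum>b\<in>E. of_int (k b) *\<^sub>R b | k :: real ^ 'n \<Rightarrow> int. True}"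
    using assms by (simp add: lattice_basis_def)
  have "int_lattice \<subseteq> span E" unfolding L by (auto intro: span_sum span_scale span_base)
  then have "axis i 1 \<in> span E" for i using axis_in_int_lattice by blast
  then have "Basis \<subseteq> span E" by (auto simp: Basis_vec_def)
  then show sp: "span E = UNIV" by (metis span_Basis span_mono span_span top.extremum_unique)
  show "card E = CARD('n)" using dim_eq_card[OF _ ind, of UNIV] sp by simp
  show "E \<subseteq> int_lattice" by (rule lattice_basis_subset[OF assms])
qed

text \<open>
  A lattice basis and its inverse coordinate matrix are both integral, so the determinant is a unit
  of the integers.
\<close>

lemma lborel_lattice_basis:
  fixes E :: "(real^'n) set"
  assumes LB: "lattice_basis E int_lattice"
  shows "(lborel :: (real^'n) measure) = distr (\<Pi>\<^sub>M b\<in>E. lborel) borel (\<lambda>c. \<Sum>b\<in>E. c b *\<^sub>R b)"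
proof -
  note E = lattice_basis_span[OF LB]
  have "\<exists>e. bij_betw e (UNIV::'n set) E"
    by (rule finite_same_card_bij) (use E in simp_all)
  then obtain e where e: "bij_betw e (UNIV::'n set) E" ..
  have eE: "e i \<in> E" for i using e by (auto simp: bij_betw_def)
  have L: "int_lattice = {\<Sum>b\<in>E. of_int (k b) *\<^sub>R b | k :: real ^ 'n \<Rightarrow> int. True}"
    using LB by (simp add: lattice_basis_def)
  have "\<exists>k :: real^'n \<Rightarrow> int. axis j 1 = (\<Sum>b\<in>E. of_int (k b) *\<^sub>R b)" for j
    using axis_in_int_lattice[of j] unfolding L by blast
  then obtain k :: "'n \<Rightarrow> real^'n \<Rightarrow> int" where k: "\<And>j. axis j 1 = (\<Sum>b\<in>E. of_int (k j b) *\<^sub>R b)" by metis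
  let ?A = "\<chi> i j. e j $ i" and ?G = "\<chi> i j. real_of_int (k j (e i))"
  have "?A ** ?G = mat 1"
  proof -
    have "(\<Sum>l\<in>UNIV. e l $ i * of_int (k j (e l))) = axis j 1 $ i" for i j
    proof -
      have "axis j 1 $ i = (\<Sum>b\<in>E. of_int (k j b) * b $ i)" unfolding k by simp
      also have "\<dots> = (\<Sum>l\<in>UNIV. e l $ i * of_int (k j (e l)))"
        using sum.reindex_bij_betw[OF e, of "\<lambda>b. of_int (k j b) * b $ i"] by (simp add: mult.commute)
      finally show ?thesis by simp
    qed
    then show ?thesis by (auto simp: matrix_matrix_mult_def mat_def vec_eq_iff axis_def)
  qed
  then have prod: "det ?A * det ?G = 1" by (metis det_I det_mul)
  have "det ?A \<in> \<int>" using E(5) eE unfolding det_def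
    by (intro Ints_sum Ints_mult Ints_prod) (auto simp: int_lattice_def subset_iff)
  moreover have "det ?G \<in> \<int>" unfolding det_def
    by (intro Ints_sum Ints_mult Ints_prod) auto
  ultimately obtain p q :: int where pq: "det ?A = of_int p" "det ?G = of_int q" by (auto elim!: Ints_cases)
  then have "of_int (p * q) = (1 :: real)" using prod by simp
  then have "p * q = 1" by linarith
  then have "\<bar>p\<bar> = 1" using abs_zmult_eq_1[of p q] by simp
  then have "\<bar>det ?A\<bar> = 1" using pq by (simp flip: of_int_abs)
  then have "ennreal \<bar>det ?A\<bar> = 1" by simp
  with lborel_basis_det(2)[OF E(4) e] show ?thesis by (simp add: density_1)
qed

lemma nn_integral_PiM_scale_shift:
  fixes I :: "'b set"
  assumes I: "finite I" and t: "t > (0::real)" and f: "f \<in> borel_measurable (\<Pi>\<^sub>M b\<in>I. lborel)"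
  shows "(\<integral>\<^sup>+c. f c \<partial>(\<Pi>\<^sub>M b\<in>I. lborel)) = ennreal (t ^ card I) * (\<integral>\<^sup>+c. f (\<lambda>b\<in>I. r b + t * c b) \<partial>(\<Pi>\<^sub>M b\<in>I. lborel))"
  using I f
proof (induction I arbitrary: f)
  case empty
  then show ?case by (simp add: PiM_empty nn_integral_count_space_finite restrict_def)
next
  case (insert i I)
  interpret product_sigma_finite "\<lambda>_::'b. lborel :: real measure" by standard
  note [measurable] = insert.prems
  let ?J = "insert i I"
  have [measurable]: "(\<lambda>c. \<lambda>b\<in>?J. r b + t * c b) \<in> measurable (\<Pi>\<^sub>M b\<in>?J. lborel) (\<Pi>\<^sub>M b\<in>?J. lborel)"
    by (intro measurable_restrict) simp
  have u: "(\<lambda>b\<in>?J. r b + t * (c(i := y)) b) = (\<lambda>b\<in>I. r b + t * c b)(i := r i + t * y)" for c y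
    using insert.hyps by (auto simp: fun_eq_iff restrict_def)
  have m2: "(\<lambda>y. f (c(i := y))) \<in> borel_measurable borel" if "c \<in> space (\<Pi>\<^sub>M b\<in>I. lborel)" for c
    using measurable_comp[OF measurable_component_update[OF that insert.hyps(2)] insert.prems] by (simp add: comp_def)
  have m3: "(\<lambda>c. \<integral>\<^sup>+y. f (c(i := y)) \<partial>lborel) \<in> borel_measurable (\<Pi>\<^sub>M b\<in>I. lborel)"
    by measurable
  have "(\<integral>\<^sup>+c. f c \<partial>(\<Pi>\<^sub>M b\<in>?J. lborel)) = (\<integral>\<^sup>+c. (\<integral>\<^sup>+y. f (c(i := y)) \<partial>lborel) \<partial>(\<Pi>\<^sub>M b\<in>I. lborel))"
    using insert.hyps by (subst product_nn_integral_insert) auto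
  also have "\<dots> = ennreal (t ^ card I) * (\<integral>\<^sup>+c. (\<integral>\<^sup>+y. f ((\<lambda>b\<in>I. r b + t * c b)(i := y)) \<partial>lborel) \<partial>(\<Pi>\<^sub>M b\<in>I. lborel))"
    by (rule insert.IH[OF m3])
  also have "(\<integral>\<^sup>+c. (\<integral>\<^sup>+y. f ((\<lambda>b\<in>I. r b + t * c b)(i := y)) \<partial>lborel) \<partial>(\<Pi>\<^sub>M b\<in>I. lborel))
     = (\<integral>\<^sup>+c. ennreal t * (\<integral>\<^sup>+y. f ((\<lambda>b\<in>I. r b + t * c b)(i := r i + t * y)) \<partial>lborel) \<partial>(\<Pi>\<^sub>M b\<in>I. lborel))"
  proof (rule nn_integral_cong)
    fix c :: "'b \<Rightarrow> real"
    have "(\<lambda>b\<in>I. r b + t * c b) \<in> space (\<Pi>\<^sub>M b\<in>I. lborel)" by (auto simp: space_PiM)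
    from m2[OF this] show "(\<integral>\<^sup>+y. f ((\<lambda>b\<in>I. r b + t * c b)(i := y)) \<partial>lborel)
      = ennreal t * (\<integral>\<^sup>+y. f ((\<lambda>b\<in>I. r b + t * c b)(i := r i + t * y)) \<partial>lborel)"
      using t by (subst nn_integral_real_affine[where c = t and t = "r i"]) auto
  qed
  also have "\<dots> = ennreal t * (\<integral>\<^sup>+c. (\<integral>\<^sup>+y. f (\<lambda>b\<in>?J. r b + t * (c(i := y)) b) \<partial>lborel) \<partial>(\<Pi>\<^sub>M b\<in>I. lborel))"
    unfolding u[symmetric] by (rule nn_integral_cmult) measurable
  also have "(\<integral>\<^sup>+c. (\<integral>\<^sup>+y. f (\<lambda>b\<in>?J. r b + t * (c(i := y)) b) \<partial>lborel) \<partial>(\<Pi>\<^sub>M b\<in>I. lborel))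
     = (\<integral>\<^sup>+c. f (\<lambda>b\<in>?J. r b + t * c b) \<partial>(\<Pi>\<^sub>M b\<in>?J. lborel))"
    using insert.hyps by (subst product_nn_integral_insert) auto
  also have "ennreal (t ^ card I) * (ennreal t * (\<integral>\<^sup>+c. f (\<lambda>b\<in>?J. r b + t * c b) \<partial>(\<Pi>\<^sub>M b\<in>?J. lborel)))
     = ennreal (t ^ card ?J) * (\<integral>\<^sup>+c. f (\<lambda>b\<in>?J. r b + t * c b) \<partial>(\<Pi>\<^sub>M b\<in>?J. lborel))"
    using insert.hyps t by (simp add: ennreal_mult ac_simps)
  finally show ?case .
qed

section \<open>Squeezing a convex body with centroid at the origin\<close>

lemma tame_compact_support:
  fixes P :: "'a::euclidean_space set"
  assumes P: "compact P" and q: "continuous_on UNIV q" and D: "orthonormal D"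
  shows "tame D (\<lambda>x. q x * indicator P x)" 
proof -
  have D': "compact (q ` P)" using P q by (metis compact_continuous_image continuous_on_subset subset_UNIV)
  obtain C where C: "\<And>x. x \<in> P \<Longrightarrow> \<bar>q x\<bar> \<le> C" using compact_imp_bounded[OF D'] by (auto simp: bounded_iff)
  obtain R where R: "\<And>x. x \<in> P \<Longrightarrow> norm x \<le> R" using compact_imp_bounded[OF P] by (auto simp: bounded_iff)
  have "\<bar>q x * indicator P x\<bar> \<le> max C 0" for x using C[of x] by (auto simp: indicator_def)
  moreover have "(\<lambda>x. q x * indicator P x :: real) \<in> borel_measurable borel"
    using q P by (intro borel_measurable_times borel_measurable_indicator borel_measurable_continuous_onI) (auto intro: borel_compact)
  moreover have "\<forall>x. q x * indicator P x \<noteq> 0 \<longrightarrow> (\<forall>e\<in>D. \<bar>x \<bullet> e\<bar> \<le> R)"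
  proof (intro allI impI ballI)
    fix x e assume "q x * indicator P x \<noteq> 0" and e: "e \<in> D"
    then have "norm x \<le> R" using R by (auto simp: indicator_def split: if_splits)
    moreover have "\<bar>x \<bullet> e\<bar> \<le> norm x * norm e" by (rule Cauchy_Schwarz_ineq2)
    moreover have "norm e = 1" using D e by (simp add: orthonormal_def)
    ultimately show "\<bar>x \<bullet> e\<bar> \<le> R" by simp
  qed
  ultimately show ?thesis unfolding tame_def by blast
qed

lemma log_concave_indicator:
  assumes "convex P"
  shows "log_concave (indicator P :: _ \<Rightarrow> real)"
  unfolding log_concave_def
proof (intro conjI allI impI)
  fix x y and l :: real assume l: "0 < l" "l < 1"
  show "indicator P x powr (1 - l) * indicator P y powr l \<le> (indicator P ((1 - l) *\<^sub>R x + l *\<^sub>R y) :: real)"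
  proof (cases "x \<in> P \<and> y \<in> P")
    case True
    then have "(1 - l) *\<^sub>R x + l *\<^sub>R y \<in> P" using assms l by (auto simp: convex_alt)
    then show ?thesis using True by simp
  qed (use l in \<open>auto simp: indicator_def\<close>)
qed auto

lemma tame_scale:
  assumes h: "tame D h" and t: "t > 0"
  shows "tame D (\<lambda>x. h (t *\<^sub>R x))"
proof -
  obtain R where R: "\<And>x e. h x \<noteq> 0 \<Longrightarrow> e \<in> D \<Longrightarrow> \<bar>x \<bullet> e\<bar> \<le> R" using h unfolding tame_def by blast
  have [measurable]: "h \<in> borel_measurable borel" using h unfolding tame_def by blast
  have "(\<lambda>x. h (t *\<^sub>R x)) \<in> borel_measurable borel" by measurable
  moreover have "\<bar>x \<bullet> e\<bar> \<le> R / t" if "h (t *\<^sub>R x) \<noteq> 0" "e \<in> D" for x e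
  proof -
    have "\<bar>(t *\<^sub>R x) \<bullet> e\<bar> \<le> R" using R that by blast
    then show ?thesis using t by (simp add: abs_mult field_simps)
  qed
  ultimately show ?thesis using h unfolding tame_def by blast
qed

text \<open>
  Dilation by \<open>t\<close> in the subspace spanned by \<open>D\<close>, written in coordinates.
\<close>

lemma integral_PiM_scale:
  fixes D :: "'a::euclidean_space set" and h :: "'a \<Rightarrow> real"
  assumes D: "finite D" and h: "h \<in> borel_measurable borel" "\<And>x. 0 \<le> h x" and t: "t > 0"
  shows "(\<integral>c. h (\<Sum>b\<in>D. c b *\<^sub>R b) \<partial>(\<Pi>\<^sub>M b\<in>D. lborel))
     = t ^ card D * (\<integral>c. h (t *\<^sub>R (\<Sum>b\<in>D. c b *\<^sub>R b)) \<partial>(\<Pi>\<^sub>M b\<in>D. lborel))"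
proof -
  note [measurable] = h(1)
  let ?M = "\<Pi>\<^sub>M b\<in>D. (lborel :: real measure)"
  have S: "(\<Sum>b\<in>D. (\<lambda>b\<in>D. 0 + t * c b) b *\<^sub>R b) = t *\<^sub>R (\<Sum>b\<in>D. c b *\<^sub>R b)" for c
    unfolding scaleR_sum_right by (intro sum.cong) auto
  have "(\<integral>\<^sup>+c. ennreal (h (\<Sum>b\<in>D. c b *\<^sub>R b)) \<partial>?M)
     = ennreal (t ^ card D) * (\<integral>\<^sup>+c. ennreal (h (\<Sum>b\<in>D. (\<lambda>b\<in>D. 0 + t * c b) b *\<^sub>R b)) \<partial>?M)"
    by (rule nn_integral_PiM_scale_shift[OF D t]) measurable
  then have *: "(\<integral>\<^sup>+c. ennreal (h (\<Sum>b\<in>D. c b *\<^sub>R b)) \<partial>?M)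
     = ennreal (t ^ card D) * (\<integral>\<^sup>+c. ennreal (h (t *\<^sub>R (\<Sum>b\<in>D. c b *\<^sub>R b))) \<partial>?M)"
    unfolding S .
  have "(\<integral>c. h (\<Sum>b\<in>D. c b *\<^sub>R b) \<partial>?M) = enn2real (\<integral>\<^sup>+c. ennreal (h (\<Sum>b\<in>D. c b *\<^sub>R b)) \<partial>?M)"
    using h(2) by (intro integral_eq_nn_integral) auto
  moreover have "(\<integral>c. h (t *\<^sub>R (\<Sum>b\<in>D. c b *\<^sub>R b)) \<partial>?M) = enn2real (\<integral>\<^sup>+c. ennreal (h (t *\<^sub>R (\<Sum>b\<in>D. c b *\<^sub>R b))) \<partial>?M)"
    using h(2) by (intro integral_eq_nn_integral) auto
  ultimately show ?thesis using t by (simp add: * enn2real_mult)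
qed

lemma integral_lborel_marginals:
  fixes g :: "real^'n \<Rightarrow> real"
  assumes D: "(lborel :: (real^'n) measure) = density (distr (\<Pi>\<^sub>M b\<in>E. lborel) borel (\<lambda>c. \<Sum>b\<in>E. c b *\<^sub>R b)) (\<lambda>_. ennreal D)"
    and D0: "0 < D"
    and E: "E = set es \<union> E1" "distinct es" "set es \<inter> E1 = {}" "finite E1" "orthonormal E" and g: "tame E g"
  shows "(\<integral>x. g x \<partial>lborel) = D * (\<integral>c. marginals es g (\<Sum>b\<in>E1. c b *\<^sub>R b) \<partial>(\<Pi>\<^sub>M b\<in>E1. lborel))"
proof -
  have [measurable]: "g \<in> borel_measurable borel" using g unfolding tame_def by blast
  have "(\<integral>x. g x \<partial>lborel) = (\<integral>x. g x \<partial>density (distr (\<Pi>\<^sub>M b\<in>E. lborel) borel (\<lambda>c. \<Sum>b\<in>E. c b *\<^sub>R b)) (\<lambda>_. ennreal D))"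
    using D by (rule arg_cong)
  also have "\<dots> = (\<integral>x. D *\<^sub>R g x \<partial>distr (\<Pi>\<^sub>M b\<in>E. lborel) borel (\<lambda>c. \<Sum>b\<in>E. c b *\<^sub>R b))"
    using D0 by (intro integral_density) auto
  also have "\<dots> = (\<integral>c. D *\<^sub>R g (\<Sum>b\<in>E. c b *\<^sub>R b) \<partial>(\<Pi>\<^sub>M b\<in>E. lborel))"
    by (rule integral_distr) measurable
  also have "\<dots> = D * (\<integral>c. g (\<Sum>b\<in>E. c b *\<^sub>R b) \<partial>(\<Pi>\<^sub>M b\<in>E. lborel))" by simp
  also have "(\<integral>c. g (\<Sum>b\<in>E. c b *\<^sub>R b) \<partial>(\<Pi>\<^sub>M b\<in>E. lborel)) = (\<integral>c. marginals es g (\<Sum>b\<in>E1. c b *\<^sub>R b) \<partial>(\<Pi>\<^sub>M b\<in>E1. lborel))"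
    unfolding E(1) by (rule integral_marginals) (use E g in auto)
  finally show ?thesis .
qed

text \<open>
  Moving the constraints with normals in \<open>U\<close> from distance 1 to distance \<open>t\<close> amounts to dilating
  \<open>P\<close> by \<open>t\<close> along \<open>U\<close>, except that the slices orthogonal to \<open>U\<close> are those over \<open>t y\<close> instead of
  those over \<open>y\<close>. On average over \<open>P\<close> the slices over \<open>t y\<close> are at least as large: the slice volume is
  log-concave, and the first-order term of the comparison vanishes because the centroid is 0.
\<close>

theorem centered_convex_body_squeeze:
  fixes P :: "(real^'n) set"
  assumes P: "convex P" "compact P" "0 \<in> interior P" and cent: "(LINT x:P|lborel. x) = 0"
    and U: "subspace U" and A: "finite A" "A \<subseteq> U" and PA: "\<And>x v. x \<in> P \<Longrightarrow> v \<in> A \<Longrightarrow> - 1 \<le> x \<bullet> v"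
    and t: "0 < t" "t < 1"
  shows "t ^ dim U * measure lborel P \<le> measure lborel {x \<in> P. \<forall>v\<in>A. - t \<le> x \<bullet> v}"
proof -
  obtain E1 where E1: "E1 \<subseteq> U" "pairwise orthogonal E1" "\<And>x. x \<in> E1 \<Longrightarrow> norm x = 1"
    "independent E1" "card E1 = dim U" "span E1 = U" 
    using orthonormal_basis_subspace[OF U] by blast
  define U' where "U' = {z. \<forall>x\<in>U. x \<bullet> z = 0}"
  have U': "subspace U'" unfolding U'_def by (auto simp: subspace_def inner_add_right)
  obtain E2 where E2: "E2 \<subseteq> U'" "pairwise orthogonal E2" "\<And>x. x \<in> E2 \<Longrightarrow> norm x = 1"
    "independent E2" "card E2 = dim U'" "span E2 = U'" 
    using orthonormal_basis_subspace[OF U'] by blast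
  have fin: "finite E1" "finite E2" using E1 E2 by (auto intro: independent_imp_finite)
  have perp: "x \<bullet> z = 0" if "x \<in> U" "z \<in> U'" for x z using that by (auto simp: U'_def)
  have disj: "E2 \<inter> E1 = {}"
  proof (rule ccontr)
    assume "E2 \<inter> E1 \<noteq> {}"
    then obtain b where b: "b \<in> E1" "b \<in> E2" by blast
    then have "b \<bullet> b = 0" using perp[of b b] E1(1) E2(1) by blast
    then show False using E1(3)[OF b(1)] by simp
  qed
  define E where "E = E2 \<union> E1"
  have oE: "orthonormal E"
    unfolding orthonormal_def
  proof (intro conjI ballI)
    show "pairwise orthogonal E"
      unfolding pairwise_def
    proof (intro ballI impI)
      fix x y assume xy: "x \<in> E" "y \<in> E" "x \<noteq> y"
      have "orthogonal x y" if "x \<in> E1" "y \<in> E2" for x y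
        using perp[of x y] that E1(1) E2(1) unfolding orthogonal_def by blast
      then show "orthogonal x y" using xy E1(2) E2(2) unfolding E_def pairwise_def
        by (metis Un_iff orthogonal_commute)
    qed
  qed (use E1 E2 in \<open>auto simp: E_def\<close>)
  have "0 \<notin> E" using E1(3) E2(3) by (force simp: E_def)
  then have indE: "independent E" using oE pairwise_orthogonal_independent by (auto simp: orthonormal_def)
  have "x \<in> span E" for x
  proof -
    obtain y z where yz: "y \<in> span U" "\<And>w. w \<in> span U \<Longrightarrow> orthogonal z w" "x = y + z"
      by (rule orthogonal_subspace_decomp_exists[of U x]) blast
    have "y \<in> span E1" using yz(1) U E1(6) by (simp add: span_eq_iff[THEN iffD2])
    moreover have "z \<in> span E2" unfolding E2(6) U'_def
      using yz(2) by (auto simp: orthogonal_def inner_commute intro: span_base)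
    ultimately show ?thesis unfolding yz(3) E_def
      by (meson Un_upper1 Un_upper2 span_add span_mono subsetD)
  qed
  then have "span E = UNIV" by blast
  then have cardE: "card E = CARD('n)" using dim_eq_card[of E "UNIV :: (real^'n) set"] indE by simp
  obtain D where D: "D > 0" "(lborel :: (real^'n) measure) = density (distr (\<Pi>\<^sub>M b\<in>E. lborel) borel (\<lambda>c. \<Sum>b\<in>E. c b *\<^sub>R b)) (\<lambda>_. ennreal D)"
    using lborel_basis[OF indE cardE] by blast
  obtain es where es: "set es = E2" "distinct es" using finite_distinct_list[OF fin(2)] by blast
  have Ees: "E = set es \<union> E1" "distinct es" "set es \<inter> E1 = {}" "finite E1" "orthonormal E"
    using es disj fin oE by (auto simp: E_def)
  note INT = integral_lborel_marginals[OF D(2) D(1) Ees]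
  note tm = tame_marginals[OF Ees(2-4) Ees(5)[unfolded Ees(1)]]
  have Pb: "P \<in> sets borel" using P(2) by (rule borel_compact)
  define h where "h = (indicator P :: real^'n \<Rightarrow> real)"
  have th: "tame E h" using tame_compact_support[OF P(2) _ oE, of "\<lambda>_. 1"] by (simp add: h_def)
  have th': "tame (set es \<union> E1) h" using th Ees(1) by simp
  define f where "f = marginals es h"
  have tf: "tame E1 f" unfolding f_def by (rule tm[OF th'])
  have lh: "log_concave h" unfolding h_def by (rule log_concave_indicator[OF P(1)])
  have lf: "log_concave f" unfolding f_def by (rule log_concave_marginals[OF Ees(2-4) Ees(5)[unfolded Ees(1)] th' lh])
  obtain r where r: "r > 0" "ball 0 r \<subseteq> P" using P(3) by (auto simp: mem_interior)
  have "\<forall>x\<in>ball 0 r. 0 < h x" using r by (auto simp: h_def)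
  then have pf: "\<forall>x\<in>ball 0 r. 0 < f x" unfolding f_def
    by (rule marginals_pos_ball[OF Ees(2-4) Ees(5)[unfolded Ees(1)] th' lh])
  obtain a where a: "\<And>y. f y \<le> f 0 * exp (a \<bullet> y)" using log_concave_supergradient[OF lf r(1) pf] by blast
  obtain a' a'' where aa: "a' \<in> span U" "\<And>w. w \<in> span U \<Longrightarrow> orthogonal a'' w" "a = a' + a''"
    by (rule orthogonal_subspace_decomp_exists[of U a]) blast
  have aU: "a' \<in> U" using aa(1) U by (simp add: span_eq_iff[THEN iffD2])
  \<comment> \<open>Only the part of the supergradient in \<open>U\<close> matters; it is invariant under the directions integrated out.\<close>
  have ay: "a \<bullet> y = a' \<bullet> y" if "y \<in> U" for y
    using aa(2)[OF span_base[OF that]] unfolding aa(3) orthogonal_def by (simp add: inner_add_left)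
  define Y where "Y c = (\<Sum>b\<in>E1. c b *\<^sub>R b)" for c :: "real^'n \<Rightarrow> real"
  have YU: "Y c \<in> U" for c unfolding Y_def using E1(1) U by (intro subspace_sum subspace_mul) auto
  define K where "K s = {x. \<forall>v\<in>A. - s \<le> x \<bullet> v}" for s :: real
  have inv: "indicator (K s) (x + u *\<^sub>R e) = (indicator (K s) x :: real)" if "e \<in> set es" for s x u e
  proof -
    have "(x + u *\<^sub>R e) \<bullet> v = x \<bullet> v" if "v \<in> A" for v
    proof -
      have "e \<bullet> v = 0" using perp[of v e] A(2) that \<open>e \<in> set es\<close> es(1) E2(1) by (auto simp: inner_commute)
      then show ?thesis by (simp add: inner_add_left)
    qed
    then show ?thesis by (simp add: K_def indicator_def)
  qed
  have Kb: "K s \<in> sets borel" for s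
  proof -
    have "K s = (\<Inter>v\<in>A. {x. - s \<le> x \<bullet> v})" by (auto simp: K_def)
    moreover have "closed (\<Inter>v\<in>A. {x. - s \<le> x \<bullet> v})"
      by (intro closed_INT ballI closed_Collect_le continuous_intros)
    ultimately show ?thesis by (simp add: borel_closed)
  qed
  have mK: "marginals es (\<lambda>x. indicator (K s) x * h x) = (\<lambda>x. indicator (K s) x * f x)" for s
    unfolding f_def by (rule marginals_mult_invariant) (rule inv)
  have "(\<lambda>x. indicator (K 1) x * h x) = h"
    using PA by (auto simp: fun_eq_iff h_def K_def indicator_def)
  then have fK: "indicator (K 1) x * f x = f x" for x using mK[of 1] by (metis f_def)
  have tK: "tame E (\<lambda>x. indicator (K s) x * h x)" "tame E1 (\<lambda>x. indicator (K s) x * f x)" for s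
    using th tf Kb by (auto intro!: tame_mult[where C = 1])
  note [measurable] = Kb
  let ?I = "\<lambda>g. (\<integral>c. g (Y c) \<partial>(\<Pi>\<^sub>M b\<in>E1. lborel))"
  have volP: "measure lborel P = D * ?I f"
    using INT[OF th] Pb by (simp add: f_def h_def Y_def)
  have "{x \<in> P. \<forall>v\<in>A. - t \<le> x \<bullet> v} = K t \<inter> P" by (auto simp: K_def)
  then have volK: "measure lborel {x \<in> P. \<forall>v\<in>A. - t \<le> x \<bullet> v} = D * ?I (\<lambda>x. indicator (K t) x * f x)"
  proof -
    assume eq: "{x \<in> P. \<forall>v\<in>A. - t \<le> x \<bullet> v} = K t \<inter> P"
    have "(\<integral>x. indicator (K t) x * h x \<partial>lborel) = D * ?I (\<lambda>x. indicator (K t) x * f x)"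
      using INT[OF tK(1)[of t]] unfolding mK Y_def .
    moreover have "(\<lambda>x. indicator (K t) x * h x) = indicator (K t \<inter> P)"
      by (auto simp: fun_eq_iff h_def indicator_def)
    ultimately show ?thesis using Pb Kb[of t] unfolding eq by simp
  qed
  have ta: "tame E (\<lambda>x. (a' \<bullet> x) * h x)" unfolding h_def
    by (rule tame_compact_support[OF P(2) _ oE]) (intro continuous_intros)
  have ma: "marginals es (\<lambda>x. (a' \<bullet> x) * h x) = (\<lambda>x. (a' \<bullet> x) * f x)"
    unfolding f_def
  proof (rule marginals_mult_invariant)
    fix x s e assume "e \<in> set es"
    then have "a' \<bullet> e = 0" using perp[OF aU, of e] es(1) E2(1) by blast
    then show "a' \<bullet> (x + s *\<^sub>R e) = a' \<bullet> x" by (simp add: inner_add_right)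
  qed
  have ta1: "tame E1 (\<lambda>x. (a' \<bullet> x) * f x)" using tm[of "\<lambda>x. (a' \<bullet> x) * h x"] ta ma Ees(1) by simp
  \<comment> \<open>The centroid condition, pushed forward to \<open>U\<close>.\<close>
  have ia: "?I (\<lambda>x. (a' \<bullet> x) * f x) = 0"
  proof -
    have i: "integrable lborel (\<lambda>x. indicator P x *\<^sub>R x)"
      using borel_integrable_compact[OF P(2), of "\<lambda>x. x"] by simp
    have "(\<integral>x. (a' \<bullet> x) * h x \<partial>lborel) = (\<integral>x. a' \<bullet> (indicator P x *\<^sub>R x) \<partial>lborel)"
      by (intro Bochner_Integration.integral_cong) (auto simp: h_def)
    also have "\<dots> = a' \<bullet> (LINT x:P|lborel. x)"
      unfolding set_lebesgue_integral_def by (rule integral_inner_right) (use i in blast)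
    finally have "D * ?I (\<lambda>x. (a' \<bullet> x) * f x) = 0" using INT[OF ta] ma cent by (simp add: Y_def)
    then show ?thesis using D(1) by simp
  qed
  have fnn: "0 \<le> f y" for y using lf unfolding log_concave_def by blast
  have f0: "0 < f 0" using pf r(1) by simp
  define G where "G x = indicator (K t) x * f x" for x
  have pw: "f y - (1 - t) * ((a' \<bullet> y) * f y) \<le> G (t *\<^sub>R y)" if "y \<in> U" for y
  proof (cases "f y = 0")
    case True
    then show ?thesis using fnn by (simp add: G_def)
  next
    case False
    then have fy: "0 < f y" using fnn[of y] by simp
    have "y \<in> K 1" using fK[of y] False by (auto simp: indicator_def split: if_splits)
    then have Kt: "t *\<^sub>R y \<in> K t" using t by (auto simp: K_def mult_le_cancel_left1 intro: mult_left_mono[of "-1", where c = t, simplified])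
    \<comment> \<open>The supergradient bounds \<open>f 0\<close> from below; then interpolate between 0 and \<open>y\<close>.\<close>
    have "f y * exp (- (a' \<bullet> y)) \<le> f 0"
      using a[of y] ay[OF that] by (simp add: exp_minus field_simps)
    then have "(f y * exp (- (a' \<bullet> y))) powr (1 - t) \<le> f 0 powr (1 - t)"
      using t fy by (intro powr_mono2) auto
    then have "(f y * exp (- (a' \<bullet> y))) powr (1 - t) * f y powr t \<le> f 0 powr (1 - t) * f y powr t"
      by (intro mult_right_mono) auto
    also have "\<dots> \<le> f (t *\<^sub>R y)"
      using lf t unfolding log_concave_def by (metis scaleR_zero_right add_0)
    also have "(f y * exp (- (a' \<bullet> y))) powr (1 - t) * f y powr t = f y * exp (- ((1 - t) * (a' \<bullet> y)))"
    proof -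
      have "(f y * exp (- (a' \<bullet> y))) powr (1 - t) = f y powr (1 - t) * exp (- ((1 - t) * (a' \<bullet> y)))"
        using fy by (simp add: powr_mult exp_powr_real mult.commute)
      moreover have "f y powr (1 - t) * f y powr t = f y" using fy by (simp flip: powr_add)
      ultimately show ?thesis by (simp add: mult.assoc mult.left_commute)
    qed
    finally have "f y * exp (- ((1 - t) * (a' \<bullet> y))) \<le> f (t *\<^sub>R y)" .
    moreover have "f y * (1 + - ((1 - t) * (a' \<bullet> y))) \<le> f y * exp (- ((1 - t) * (a' \<bullet> y)))"
      using fy by (intro mult_left_mono exp_ge_add_one_self) auto
    ultimately show ?thesis using Kt by (simp add: G_def algebra_simps)
  qed
  have oE1: "orthonormal E1" using oE by (rule orthonormal_subset) (auto simp: E_def)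
  note itg = integrable_tame_PiM[OF fin(1) oE1, folded Y_def]
  have tG: "tame E1 G" unfolding G_def[abs_def] by (rule tK(2))
  have Gt: "?I G = t ^ dim U * ?I (\<lambda>x. G (t *\<^sub>R x))"
    unfolding Y_def E1(5)[symmetric]
  proof (rule integral_PiM_scale[OF fin(1) _ _ t(1)])
    show "G \<in> borel_measurable borel" using tG by (simp add: tame_def)
    show "0 \<le> G x" for x using fnn by (simp add: G_def)
  qed
  have i1: "integrable (\<Pi>\<^sub>M b\<in>E1. lborel) (\<lambda>c. f (Y c))" by (rule itg[OF tf])
  have i2: "integrable (\<Pi>\<^sub>M b\<in>E1. lborel) (\<lambda>c. (a' \<bullet> Y c) * f (Y c))" by (rule itg[OF ta1])
  have "?I f = ?I f - (1 - t) * ?I (\<lambda>x. (a' \<bullet> x) * f x)" using ia by simp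
  also have "\<dots> = (\<integral>c. f (Y c) - (1 - t) * ((a' \<bullet> Y c) * f (Y c)) \<partial>(\<Pi>\<^sub>M b\<in>E1. lborel))"
    using i1 i2 by (subst Bochner_Integration.integral_diff) auto
  also have "\<dots> \<le> ?I (\<lambda>x. G (t *\<^sub>R x))"
    by (intro integral_mono Bochner_Integration.integrable_diff integrable_mult_right i1 i2 itg[OF tame_scale[OF tG t(1)]] pw YU)
  finally have "D * (t ^ dim U * ?I f) \<le> D * (t ^ dim U * ?I (\<lambda>x. G (t *\<^sub>R x)))"
    using D(1) t by (intro mult_left_mono) auto
  then show ?thesis unfolding volP volK G_def[symmetric] Gt by (simp add: mult.left_commute)
qed

section \<open>Rays of the normal fan of a lattice polytope\<close>

lemma exists_negative_inner:
  fixes P :: "'a::euclidean_space set"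
  assumes "0 \<in> interior P" "v \<noteq> 0"
  obtains w where "w \<in> P" "w \<bullet> v < 0"
proof -
  obtain r where r: "r > 0" "ball 0 r \<subseteq> P" using assms(1) by (auto simp: mem_interior)
  define w where "w = - (r / (2 * norm v)) *\<^sub>R v"
  have "norm w < r" using assms(2) r by (simp add: w_def)
  moreover have "w \<bullet> v < 0" using assms(2) r by (simp add: w_def)
  ultimately show ?thesis using that r by auto
qed

lemma int_lattice_closed:
  "0 \<in> int_lattice" 
  "x \<in> int_lattice \<Longrightarrow> y \<in> int_lattice \<Longrightarrow> x + y \<in> int_lattice"
  "x \<in> int_lattice \<Longrightarrow> y \<in> int_lattice \<Longrightarrow> x - y \<in> int_lattice"
  "x \<in> int_lattice \<Longrightarrow> of_int k *\<^sub>R x \<in> int_lattice"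
  by (auto simp: int_lattice_def)

lemma int_lattice_sum:
  "(\<And>i. i \<in> I \<Longrightarrow> f i \<in> int_lattice) \<Longrightarrow> (\<Sum>i\<in>I. f i) \<in> int_lattice"
  by (induction I rule: infinite_finite_induct) (auto simp: int_lattice_closed)

lemma int_lattice_inner: "x \<in> int_lattice \<Longrightarrow> y \<in> int_lattice \<Longrightarrow> x \<bullet> y \<in> \<int>"
  unfolding inner_vec_def int_lattice_def by (intro Ints_sum) auto

text \<open>
  Coordinate functionals of a Hamel basis. Applied to the entries of a real vector,
  such a functional preserves all linear relations with rational coefficients; it
  turns real solutions of rational linear systems into rational ones.
\<close>

lemma exists_rat_linear_functional:
  fixes a :: real
  assumes "a \<noteq> 0"
  obtains \<phi> :: "real \<Rightarrow> rat" where "\<And>x y. \<phi> (x + y) = \<phi> x + \<phi> y" "\<And>q x. \<phi> (of_rat q * x) = q * \<phi> x" "\<phi> a \<noteq> 0"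
proof -
  interpret Q: vector_space "\<lambda>(q::rat) (x::real). of_rat q * x"
    by unfold_locales (simp_all add: of_rat_add of_rat_mult algebra_simps)
  have ind: "Q.independent {a}" using assms by simp
  define B where "B = Q.extend_basis {a}"
  have B: "Q.independent B" "a \<in> B" "Q.span B = UNIV"
    using Q.independent_extend_basis[OF ind] Q.extend_basis_superset[OF ind] Q.span_extend_basis[OF ind]
    by (auto simp: B_def)
  show ?thesis
    by (rule that[of "\<lambda>x. Q.representation B x a"])
      (use B in \<open>auto simp: Q.representation_add Q.representation_scale Q.representation_basis\<close>)
qed

lemma rational_vector_to_lattice:
  fixes r :: "real^'n"
  assumes "\<And>i. r $ i \<in> \<rat>"
  obtains d :: nat where "d > 0" "of_nat d *\<^sub>R r \<in> int_lattice"
proof -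
  have "\<exists>b::nat. b > 0 \<and> of_nat b * r $ i \<in> \<int>" for i
  proof -
    obtain p q :: int where pq: "q > 0" "r $ i = of_int p / of_int q" using assms[of i] by (rule Rats_cases') 
    then have "of_nat (nat q) * r $ i = of_int p" by simp
    then show ?thesis using pq(1) by (intro exI[of _ "nat q"]) auto
  qed
  then obtain b :: "'n \<Rightarrow> nat" where b: "\<And>i. b i > 0" "\<And>i. of_nat (b i) * r $ i \<in> \<int>" by metis
  show ?thesis
  proof (rule that[of "\<Prod>i\<in>UNIV. b i"])
    show "(\<Prod>i\<in>UNIV. b i) > 0" using b by (simp add: prod_pos)
    have "of_nat (\<Prod>i\<in>UNIV. b i) * r $ i \<in> \<int>" for i
    proof -
      have "(\<Prod>i\<in>UNIV. b i) = b i * (\<Prod>j\<in>UNIV-{i}. b j)" by (rule prod.remove) auto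
      then have "of_nat (\<Prod>i\<in>UNIV. b i) * r $ i = of_nat (\<Prod>j\<in>UNIV-{i}. b j) * (of_nat (b i) * r $ i)" by simp
      also have "\<dots> \<in> \<int>" by (rule Ints_mult[OF Ints_of_nat b(2)])
      finally show ?thesis .
    qed
    then show "of_nat (\<Prod>i\<in>UNIV. b i) *\<^sub>R r \<in> int_lattice" by (simp add: int_lattice_def)
  qed
qed

lemma primitive_divisor:
  fixes w :: "real^'n"
  assumes w: "w \<in> int_lattice" "w \<noteq> 0"
  obtains k :: nat and v where "k > 0" "primitive v" "w = of_nat k *\<^sub>R v"
proof -
  define S where "S = {k::nat. k > 0 \<and> (1 / of_nat k) *\<^sub>R w \<in> int_lattice}"
  obtain i where i: "w $ i \<noteq> 0" using w(2) by (auto simp: vec_eq_iff)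
  have bd: "k \<le> nat \<lceil>\<bar>w $ i\<bar>\<rceil>" if "k \<in> S" for k
  proof -
    have k: "k > 0" "w $ i / of_nat k \<in> \<int>" using that by (auto simp: S_def int_lattice_def)
    then have "1 \<le> \<bar>w $ i / of_nat k\<bar>" using i by (intro Ints_nonzero_abs_ge1) auto
    then have "of_nat k \<le> \<bar>w $ i\<bar>" using k by (simp add: abs_divide field_simps)
    then show ?thesis by linarith
  qed
  then have fS: "finite S" by (meson atMost_iff finite_atMost finite_subset subsetI)
  have "1 \<in> S" using w by (simp add: S_def)
  define k where "k = Max S"
  have kS: "k \<in> S" unfolding k_def using fS \<open>1 \<in> S\<close> by (intro Max_in) auto
  define v where "v = (1 / of_nat k) *\<^sub>R w"
  have k: "k > 0" "v \<in> int_lattice" using kS by (auto simp: S_def v_def)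
  have wv: "w = of_nat k *\<^sub>R v" using k by (simp add: v_def)
  have "primitive v" unfolding primitive_def
  proof (intro conjI ballI allI impI)
    show "v \<in> int_lattice" by fact
    show v0: "v \<noteq> 0" using wv w by auto
    fix u and j :: nat assume u: "u \<in> int_lattice" "v = of_nat j *\<^sub>R u"
    have j: "j > 0" using u(2) v0 by (cases j) auto
    have "(1 / of_nat (k * j)) *\<^sub>R w = u" using wv u(2) j k(1) by simp
    then have "k * j \<in> S" using u(1) j k by (simp add: S_def)
    then have "k * j \<le> k" unfolding k_def using fS by (intro Max_ge) auto
    then show "j = 1" using k(1) j by simp
  qed
  then show ?thesis using that k(1) wv by blast
qed

text \<open>
  The factor is a positive rational number \<open>p / q\<close> in lowest terms. By Bezout, some integral
  combination \<open>u\<close> of both vectors satisfies \<open>v = q u\<close> and \<open>v' = p u\<close>, and primitivity gives \<open>p = q = 1\<close>.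
\<close>

lemma primitive_unique_on_ray:
  fixes v v' :: "real^'n"
  assumes v: "primitive v" "primitive v'" and l: "v' = l *\<^sub>R v" "l > 0"
  shows "v' = v"
proof -
  have vl: "v \<in> int_lattice" "v' \<in> int_lattice" "v \<noteq> 0" using v by (auto simp: primitive_def)
  obtain i where i: "v $ i \<noteq> 0" using vl(3) by (auto simp: vec_eq_iff)
  have "l = v' $ i / v $ i" using l(1) i by simp
  moreover have "v' $ i \<in> \<rat>" "v $ i \<in> \<rat>" using vl Ints_subset_Rats by (auto simp: int_lattice_def)
  ultimately have "l \<in> \<rat>" by simp
  then obtain p q :: int where pq: "q > 0" "coprime p q" "l = of_int p / of_int q" by (rule Rats_cases')
  have p: "p > 0" using pq l(2) by (simp add: zero_less_divide_iff)
  obtain a b where ab: "a * p + b * q = 1" using pq(2) bezout_int[of p q] by auto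
  have ab': "of_int a * of_int p + of_int b * of_int q = (1::real)" 
    using ab by (metis of_int_1 of_int_add of_int_mult)
  define u where "u = of_int a *\<^sub>R v' + of_int b *\<^sub>R v"
  have u: "u \<in> int_lattice" unfolding u_def using vl by (intro int_lattice_closed)
  have vq: "v = of_int q *\<^sub>R u"
  proof -
    have "of_int q *\<^sub>R u = (of_int a * (of_int q * l) + of_int b * of_int q) *\<^sub>R v"
      by (simp add: u_def l(1) algebra_simps)
    also have "of_int q * l = of_int p" using pq by simp
    finally show ?thesis using ab' by simp
  qed
  have vp: "v' = of_int p *\<^sub>R u"
  proof -
    have "v' = l *\<^sub>R (of_int q *\<^sub>R u)" by (simp flip: vq add: l(1))
    also have "\<dots> = of_int p *\<^sub>R u" using pq by simp
    finally show ?thesis .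
  qed
  have "nat q = 1" using v(1) u vq pq(1) unfolding primitive_def by (metis of_nat_nat less_imp_le of_int_of_nat_eq)
  moreover have "nat p = 1" using v(2) u vp p unfolding primitive_def by (metis of_nat_nat less_imp_le of_int_of_nat_eq)
  ultimately have "q = 1" "p = 1" using p pq by auto
  then show ?thesis using vp vq by simp
qed

definition minimizers :: "(real^'n) set \<Rightarrow> real^'n \<Rightarrow> (real^'n) set" where
  "minimizers P v = {u \<in> P. \<forall>w\<in>P. u \<bullet> v \<le> w \<bullet> v}"

lemma minimizers_scale: "c > 0 \<Longrightarrow> minimizers P (c *\<^sub>R v) = minimizers P v"
  by (auto simp: minimizers_def)

text \<open>
  A cone of dimension 1 is a ray or a line; a line would make a linear functional
  constant on \<open>P\<close>, although \<open>P\<close> has interior points.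
\<close>

lemma ray_line:
  assumes int: "0 \<in> interior P" and \<rho>: "\<rho> = normal_cone P F" "F \<subseteq> P" "F \<noteq> {}" "dim \<rho> = 1"
  obtains v where "v \<noteq> 0" "\<rho> = {k *\<^sub>R v | k. k \<ge> 0}" 
proof -
  obtain B where B: "B \<subseteq> \<rho>" "independent B" "\<rho> \<subseteq> span B" "card B = dim \<rho>" by (rule basis_exists)
  then obtain v where v: "B = {v}" using \<rho>(4) by (auto simp: card_1_singleton_iff)
  have v0: "v \<noteq> 0" using B(2) v dependent_zero by blast
  have "v \<in> \<rho>" using B v by auto
  have "\<rho> = {k *\<^sub>R v | k. k \<ge> 0}"
  proof safe
    fix x assume x: "x \<in> \<rho>"
    then obtain k where k: "x = k *\<^sub>R v" using B(3) v by (auto simp: span_singleton)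
    have "k \<ge> 0"
    proof (rule ccontr)
      assume "\<not> k \<ge> 0" then have k0: "k < 0" by simp
      obtain u where u: "u \<in> F" using \<rho>(3) by blast
      have 1: "u \<bullet> v \<le> w \<bullet> v" if "w \<in> P" for w using \<open>v \<in> \<rho>\<close> u that \<rho>(1) by (auto simp: normal_cone_def)
      have 2: "w \<bullet> v \<le> u \<bullet> v" if "w \<in> P" for w
      proof -
        have "u \<bullet> x \<le> w \<bullet> x" using x u that \<rho>(1) by (auto simp: normal_cone_def)
        then show ?thesis using k k0 by simp
      qed
      obtain w where w: "w \<in> P" "w \<bullet> v < 0" using exists_negative_inner[OF int v0] .
      have "0 \<in> P" using int interior_subset by blast
      then show False using 2[of 0] 1[OF w(1)] w(2) by simp
    qed
    then show "\<exists>k. x = k *\<^sub>R v \<and> k \<ge> 0" using k by blast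
  next
    fix k :: real assume "k \<ge> 0"
    then show "k *\<^sub>R v \<in> \<rho>" using \<open>v \<in> \<rho>\<close> \<rho>(1) by (auto simp: normal_cone_def mult_left_mono)
  qed
  then show ?thesis using that v0 by blast
qed

text \<open>
  The minimizers of a functional \<open>v\<close> that spans a one-dimensional normal cone form a facet: if \<open>u\<close>
  is constant on the vertices that minimize \<open>v\<close>, then a slight perturbation of \<open>v\<close> by \<open>u\<close> does
  not leave the normal cone, as there are only finitely many vertices. Hence \<open>u\<close> is a multiple of \<open>v\<close>.
\<close>

lemma minimizers_vertices:
  assumes V: "finite V" "P = convex hull V" and F: "F \<subseteq> P" "F \<noteq> {}" and \<rho>: "normal_cone P F = {k *\<^sub>R v | k. k \<ge> 0}"
    and v0: "v \<noteq> 0"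
  obtains V' where "V' \<subseteq> V" "V' \<noteq> {}" "minimizers P v = convex hull V'"
    "\<And>u. (\<And>w w'. w \<in> V' \<Longrightarrow> w' \<in> V' \<Longrightarrow> u \<bullet> w = u \<bullet> w') \<Longrightarrow> u \<in> span {v}"
proof -
  have "1 *\<^sub>R v \<in> normal_cone P F" unfolding \<rho> by (intro CollectI exI[of _ 1]) simp
  then have vF: "v \<in> normal_cone P F" by simp
  have FG: "F \<subseteq> minimizers P v" using F vF by (auto simp: normal_cone_def minimizers_def)
  obtain u0 where u0: "u0 \<in> F" using F by blast
  have G: "minimizers P v = P \<inter> {x. v \<bullet> x = v \<bullet> u0}"
    using u0 FG by (auto simp: minimizers_def inner_commute intro: antisym)
  have cP: "convex P" unfolding V(2) by (rule convex_convex_hull)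
  have "minimizers P v face_of P" unfolding G
    by (rule face_of_Int_supporting_hyperplane_ge[OF cP]) (use u0 FG in \<open>auto simp: minimizers_def inner_commute\<close>)
  then obtain V' where V': "V' \<subseteq> V" "minimizers P v = convex hull V'"
    using face_of_convex_hull_subset[of V "minimizers P v"] V finite_imp_compact by blast
  have ne: "V' \<noteq> {}" using V' FG u0 by auto
  have "u \<in> span {v}" if u: "\<And>w w'. w \<in> V' \<Longrightarrow> w' \<in> V' \<Longrightarrow> u \<bullet> w = u \<bullet> w'" for u
  proof -
    obtain w0 where w0: "w0 \<in> V'" using ne by blast
    have uG: "u \<bullet> x = u \<bullet> w0" if "x \<in> minimizers P v" for x
    proof -
      have "convex hull V' \<subseteq> {x. u \<bullet> x = u \<bullet> w0}"
      proof (rule hull_minimal)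
        show "V' \<subseteq> {x. u \<bullet> x = u \<bullet> w0}" using u[OF _ w0] by blast
      qed (rule convex_hyperplane)
      then show ?thesis using that V' by auto
    qed
    have w0G: "w0 \<in> minimizers P v" using w0 V' hull_inc by metis
    have vG: "v \<bullet> x = v \<bullet> w0" if "x \<in> minimizers P v" for x using that w0G unfolding G by simp
    have pos: "v \<bullet> w > v \<bullet> w0" if "w \<in> V - minimizers P v" for w
    proof -
      have "w \<in> P" using that V hull_inc by (metis DiffD1)
      moreover have "v \<bullet> w \<ge> v \<bullet> w0" using w0G \<open>w \<in> P\<close> by (auto simp: minimizers_def inner_commute)
      moreover have "v \<bullet> w \<noteq> v \<bullet> w0"
      proof
        assume "v \<bullet> w = v \<bullet> w0"
        moreover have "v \<bullet> w0 = v \<bullet> u0" using w0G unfolding G by blast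
        ultimately have "w \<in> minimizers P v" unfolding G using \<open>w \<in> P\<close> by simp
        then show False using that by simp
      qed
      ultimately show ?thesis by simp
    qed
    have "\<forall>\<^sub>F e in at_right (0::real). \<forall>w\<in>V - minimizers P v. e * (u \<bullet> (w0 - w)) < v \<bullet> (w - w0)"
    proof (rule eventually_ball_finite)
      show "\<forall>w\<in>V - minimizers P v. \<forall>\<^sub>F e in at_right (0::real). e * (u \<bullet> (w0 - w)) < v \<bullet> (w - w0)"
      proof
        fix w assume "w \<in> V - minimizers P v"
        then have "0 < v \<bullet> (w - w0)" using pos by (simp add: inner_diff_right)
        moreover have "((\<lambda>e. e * (u \<bullet> (w0 - w))) \<longlongrightarrow> 0 * (u \<bullet> (w0 - w))) (at_right (0::real))"
          by (intro tendsto_intros)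
        ultimately show "\<forall>\<^sub>F e in at_right (0::real). e * (u \<bullet> (w0 - w)) < v \<bullet> (w - w0)"
          by (simp add: order_tendstoD(2))
      qed
    qed (use V in auto)
    then have "\<forall>\<^sub>F e in at_right (0::real). 0 < e \<and> (\<forall>w\<in>V - minimizers P v. e * (u \<bullet> (w0 - w)) < v \<bullet> (w - w0))"
      using eventually_at_right_less[of "0::real"] by eventually_elim auto
    then obtain e where e: "e > 0" "\<And>w. w \<in> V - minimizers P v \<Longrightarrow> e * (u \<bullet> (w0 - w)) < v \<bullet> (w - w0)"
      using eventually_happens'[OF trivial_limit_at_right_real] by blast
    \<comment> \<open>A perturbation so small that no vertex outside the facet overtakes those on it.\<close>
    define z where "z = v + e *\<^sub>R u"
    have zV: "z \<bullet> w0 \<le> z \<bullet> w" if "w \<in> V" for w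
    proof (cases "w \<in> minimizers P v")
      case True
      then show ?thesis using uG vG by (simp add: z_def inner_add_left)
    next
      case False
      then show ?thesis using e(2)[of w] that by (simp add: z_def inner_add_left inner_diff_right algebra_simps)
    qed
    have zP: "z \<bullet> w0 \<le> z \<bullet> w" if "w \<in> P" for w
    proof -
      have "convex hull V \<subseteq> {x. z \<bullet> x \<ge> z \<bullet> w0}"
        using zV by (intro hull_minimal convex_halfspace_ge) auto
      then show ?thesis using that V by auto
    qed
    have "z \<in> normal_cone P F"
      unfolding normal_cone_def
    proof (intro CollectI ballI)
      fix x w assume "x \<in> F" "w \<in> P"
      then have "x \<in> minimizers P v" using FG by blast
      then have "z \<bullet> x = z \<bullet> w0" using uG vG by (simp add: z_def inner_add_left)
      then show "x \<bullet> z \<le> w \<bullet> z" using zP[OF \<open>w \<in> P\<close>] by (simp add: inner_commute)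
    qed
    then obtain k where "z = k *\<^sub>R v" unfolding \<rho> by blast
    then have "e *\<^sub>R u = (k - 1) *\<^sub>R v" by (simp add: z_def algebra_simps)
    then have "(1 / e) *\<^sub>R (e *\<^sub>R u) = ((k - 1) / e) *\<^sub>R v" by simp
    then have "u = ((k - 1) / e) *\<^sub>R v" using e(1) by simp
    then show ?thesis by (auto simp: span_singleton)
  qed
  then show ?thesis using that V' ne by blast
qed

text \<open>
  The line spanned by \<open>v\<close> is the solution space of a homogeneous linear system with integral
  coefficients, so it contains a nonzero rational vector and hence an integral one.
\<close>

lemma rational_ray:
  fixes v :: "real^'n"
  assumes V: "V \<subseteq> int_lattice" and v: "v \<noteq> 0" "\<And>w w'. w \<in> V \<Longrightarrow> w' \<in> V \<Longrightarrow> v \<bullet> w = v \<bullet> w'"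
    and sp: "\<And>u. (\<And>w w'. w \<in> V \<Longrightarrow> w' \<in> V \<Longrightarrow> u \<bullet> w = u \<bullet> w') \<Longrightarrow> u \<in> span {v}"
  obtains c where "c > 0" "primitive (c *\<^sub>R v)"
proof -
  obtain i where i: "v $ i \<noteq> 0" using v(1) by (auto simp: vec_eq_iff)
  obtain \<phi> :: "real \<Rightarrow> rat" where \<phi>: "\<And>x y. \<phi> (x + y) = \<phi> x + \<phi> y" "\<And>q x. \<phi> (of_rat q * x) = q * \<phi> x" "\<phi> (v $ i) \<noteq> 0"
    using exists_rat_linear_functional[OF i] by blast
  have \<phi>0: "\<phi> 0 = 0" using \<phi>(1)[of 0 0] by simp
  have \<phi>s: "\<phi> (\<Sum>j\<in>J. g j) = (\<Sum>j\<in>J. \<phi> (g j))" if "finite J" for J :: "'n set" and g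
    using that by (induction J rule: finite_induct) (auto simp: \<phi> \<phi>0)
  define r where "r = (\<chi> j. real_of_rat (\<phi> (v $ j)))"
  have "r \<bullet> w = r \<bullet> w'" if w: "w \<in> V" "w' \<in> V" for w w'
  proof -
    define z where "z = w - w'"
    have "z \<in> int_lattice" unfolding z_def using V w by (intro int_lattice_closed) auto
    then have "\<forall>j. \<exists>k::int. z $ j = of_int k" by (auto simp: int_lattice_def elim: Ints_cases)
    then obtain k :: "'n \<Rightarrow> int" where k: "\<And>j. z $ j = of_int (k j)" by metis
    have "r \<bullet> z = (\<Sum>j\<in>UNIV. real_of_rat (of_int (k j) * \<phi> (v $ j)))"
      unfolding inner_vec_def by (intro sum.cong) (auto simp: k r_def of_rat_mult)
    also have "\<dots> = real_of_rat (\<Sum>j\<in>UNIV. \<phi> (of_rat (of_int (k j)) * v $ j))" by (simp only: \<phi>(2) of_rat_sum)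
    also have "\<dots> = real_of_rat (\<phi> (\<Sum>j\<in>UNIV. of_rat (of_int (k j)) * v $ j))" by (simp only: \<phi>s[OF finite])
    also have "(\<Sum>j\<in>UNIV. of_rat (of_int (k j)) * v $ j) = v \<bullet> z"
      unfolding inner_vec_def by (intro sum.cong) (auto simp: k)
    also have "\<dots> = 0" using v(2)[OF w] by (simp add: z_def inner_diff_right)
    finally show ?thesis by (simp add: \<phi>0 z_def inner_diff_right)
  qed
  then have "r \<in> span {v}" by (rule sp)
  then obtain c where c: "r = c *\<^sub>R v" by (auto simp: span_singleton)
  have r0: "r \<noteq> 0" using \<phi>(3) by (auto simp: r_def vec_eq_iff)
  then have c0: "c \<noteq> 0" using c by auto
  have "r $ j \<in> \<rat>" for j by (simp add: r_def)
  then obtain d :: nat where d: "d > 0" "of_nat d *\<^sub>R r \<in> int_lattice" using rational_vector_to_lattice by blast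
  \<comment> \<open>The sign moves the integral vector to the side of the line on which \<open>v\<close> lies.\<close>
  define s where "s = (if c > 0 then 1 else - 1 :: real)"
  define w where "w = (s * of_nat d) *\<^sub>R r"
  have "w \<in> int_lattice" using d(2) int_lattice_closed(3)[OF int_lattice_closed(1) d(2)] by (auto simp: w_def s_def)
  moreover have "w \<noteq> 0" using r0 d(1) by (auto simp: w_def s_def)
  ultimately obtain k :: nat and p where kp: "k > 0" "primitive p" "w = of_nat k *\<^sub>R p" by (rule primitive_divisor)
  have "p = (\<bar>c\<bar> * of_nat d / of_nat k) *\<^sub>R v"
  proof -
    have "p = (1 / of_nat k) *\<^sub>R w" using kp by simp
    then show ?thesis using c0 by (auto simp: w_def c s_def field_simps)
  qed
  moreover have "\<bar>c\<bar> * of_nat d / of_nat k > 0" using c0 d(1) kp(1) by simp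
  ultimately show ?thesis using that kp(2) by blast
qed

lemma ray_facts:
  fixes P :: "(real^'n) set"
  assumes P: "lattice_polytope P" and int: "0 \<in> interior P" and \<rho>: "\<rho> \<in> rays P"
  shows ray_gen_primitive: "primitive (ray_gen \<rho>)"
    and ray_eq: "\<rho> = {k *\<^sub>R ray_gen \<rho> | k. k \<ge> 0}"
    and ray_facet_vertices: "\<exists>V'. V' \<subseteq> int_lattice \<and> V' \<noteq> {} \<and> ray_facet P \<rho> = convex hull V'"
    and ray_facet_normal: "(\<And>w w'. w \<in> ray_facet P \<rho> \<Longrightarrow> w' \<in> ray_facet P \<rho> \<Longrightarrow> u \<bullet> w = u \<bullet> w') \<Longrightarrow> u \<in> span {ray_gen \<rho>}"
proof -
  obtain V where V: "finite V" "V \<subseteq> int_lattice" "P = convex hull V" using P by (auto simp: lattice_polytope_def)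
  obtain F where F: "\<rho> = normal_cone P F" "F face_of P" "F \<noteq> {}" "dim \<rho> = 1"
    using \<rho> by (auto simp: rays_def normal_fan_def)
  have FP: "F \<subseteq> P" using F(2) by (rule face_of_imp_subset)
  obtain v where v: "v \<noteq> 0" "\<rho> = {k *\<^sub>R v | k. k \<ge> 0}" using ray_line[OF int F(1) FP F(3,4)] .
  obtain V' where V': "V' \<subseteq> V" "V' \<noteq> {}" "minimizers P v = convex hull V'"
    "\<And>u. (\<And>w w'. w \<in> V' \<Longrightarrow> w' \<in> V' \<Longrightarrow> u \<bullet> w = u \<bullet> w') \<Longrightarrow> u \<in> span {v}"
    using minimizers_vertices[OF V(1,3) FP F(3) v(2)[unfolded F(1)] v(1)] by blast
  have V'm: "w \<in> minimizers P v" if "w \<in> V'" for w using that V'(3) hull_inc by metis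
  have "v \<bullet> w = v \<bullet> w'" if "w \<in> V'" "w' \<in> V'" for w w'
  proof -
    have "w \<bullet> v = w' \<bullet> v"
      using V'm[OF that(1)] V'm[OF that(2)] by (auto simp: minimizers_def intro: antisym)
    then show ?thesis by (simp add: inner_commute)
  qed
  then obtain c where c: "c > 0" "primitive (c *\<^sub>R v)"
    using rational_ray[of V' v] V' V(2) v(1) by blast
  have gen: "ray_gen \<rho> = c *\<^sub>R v" unfolding ray_gen_def
  proof (rule the_equality)
    show "c *\<^sub>R v \<in> \<rho> \<and> primitive (c *\<^sub>R v)" using c v(2) by auto
    fix p assume p: "p \<in> \<rho> \<and> primitive p"
    then obtain k where k: "p = k *\<^sub>R v" "k \<ge> 0" using v(2) by blast
    have "p \<noteq> 0" using p by (auto simp: primitive_def)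
    then have "k > 0" using k by (cases "k = 0") auto
    then have "p = (k / c) *\<^sub>R (c *\<^sub>R v)" "k / c > 0" using k c by auto
    then show "p = c *\<^sub>R v" using primitive_unique_on_ray[OF c(2)] p by blast
  qed
  show "primitive (ray_gen \<rho>)" using gen c by simp
  show "\<rho> = {k *\<^sub>R ray_gen \<rho> | k. k \<ge> 0}"
  proof -
    have "\<exists>k'. k *\<^sub>R v = k' *\<^sub>R c *\<^sub>R v \<and> k' \<ge> 0" if "k \<ge> 0" for k
      using that c(1) by (intro exI[of _ "k / c"]) simp
    moreover have "\<exists>k'. k *\<^sub>R c *\<^sub>R v = k' *\<^sub>R v \<and> k' \<ge> 0" if "k \<ge> 0" for k
      using that c(1) by (intro exI[of _ "k * c"]) simp
    ultimately show ?thesis unfolding gen using v(2) by (auto; blast)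
  qed
  have facet: "ray_facet P \<rho> = minimizers P v"
    using minimizers_scale[OF c(1), of P v] by (simp add: ray_facet_def minimizers_def gen)
  show "\<exists>V'. V' \<subseteq> int_lattice \<and> V' \<noteq> {} \<and> ray_facet P \<rho> = convex hull V'"
    using facet V' V(2) by (intro exI[of _ V']) auto
  assume "\<And>w w'. w \<in> ray_facet P \<rho> \<Longrightarrow> w' \<in> ray_facet P \<rho> \<Longrightarrow> u \<bullet> w = u \<bullet> w'"
  then have "u \<in> span {v}" using V'(4)[of u] V'm facet by metis
  then obtain k where "u = k *\<^sub>R v" by (auto simp: span_singleton)
  then have "u = (k / c) *\<^sub>R ray_gen \<rho>" using gen c by simp
  then show "u \<in> span {ray_gen \<rho>}" by (auto simp: span_singleton)
qed

lemma finite_rays: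
  assumes "lattice_polytope P"
  shows "finite (rays P)"
proof -
  have "polytope P" using assms by (auto simp: lattice_polytope_def polytope_def)
  then have "finite {F. F face_of P}" by (rule finite_polytope_faces)
  then have "finite (normal_cone P ` {F. F face_of P})" by simp
  then show ?thesis by (rule rev_finite_subset) (auto simp: rays_def normal_fan_def)
qed

lemma inj_on_ray_gen:
  assumes "lattice_polytope P" "0 \<in> interior P"
  shows "inj_on ray_gen (rays P)"
proof (rule inj_onI)
  fix \<rho> \<sigma> assume rs: "\<rho> \<in> rays P" "\<sigma> \<in> rays P" "ray_gen \<rho> = ray_gen \<sigma>"
  have "\<rho> = {k *\<^sub>R ray_gen \<rho> | k. k \<ge> 0}" by (rule ray_eq[OF assms rs(1)])
  also have "\<dots> = {k *\<^sub>R ray_gen \<sigma> | k. k \<ge> 0}" unfolding rs(3) ..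
  also have "\<dots> = \<sigma>" by (rule ray_eq[OF assms rs(2), symmetric])
  finally show "\<rho> = \<sigma>" .
qed

text \<open>
  The height of the facet is an integer, as it is attained at a lattice point; it is negative, because
  0 is an interior point, and at least \<open>-1\<close> by reflexivity. The affine hull is the whole
  hyperplane, since every functional constant on the facet is a multiple of the normal.
\<close>

lemma ray_facet_reflexive:
  fixes P :: "(real^'n) set"
  assumes P: "reflexive_polytope P" and \<rho>: "\<rho> \<in> rays P"
  shows ray_facet_height: "ray_facet P \<rho> = {u \<in> P. u \<bullet> ray_gen \<rho> = - 1}"
    and affine_hull_ray_facet: "affine hull (ray_facet P \<rho>) = {u. u \<bullet> ray_gen \<rho> = - 1}"
    and ray_facet_nonempty: "ray_facet P \<rho> \<noteq> {}"
proof -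
  have lat: "lattice_polytope P" and int: "0 \<in> interior P" using P by (auto simp: reflexive_polytope_def)
  note rf = ray_facts[OF lat int \<rho>]
  define v where "v = ray_gen \<rho>"
  have v: "v \<in> int_lattice" "v \<noteq> 0" using rf(1) by (auto simp: v_def primitive_def)
  have ge: "- 1 \<le> u \<bullet> v" if "u \<in> P" for u using P \<rho> that unfolding reflexive_polytope_def v_def by blast
  obtain V' where V': "V' \<subseteq> int_lattice" "V' \<noteq> {}" "ray_facet P \<rho> = convex hull V'" using rf(3) by blast
  obtain w0 where w0: "w0 \<in> V'" using V' by blast
  have w0f: "w0 \<in> ray_facet P \<rho>" using w0 V' hull_inc by metis
  then show ne: "ray_facet P \<rho> \<noteq> {}" by blast
  obtain w where w: "w \<in> P" "w \<bullet> v < 0" using exists_negative_inner[OF int v(2)] .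
  have "w0 \<bullet> v < 0" using w0f w unfolding ray_facet_def v_def by fastforce
  moreover have "w0 \<bullet> v \<in> \<int>" using int_lattice_inner w0 V'(1) v(1) by blast
  ultimately have "w0 \<bullet> v \<le> - 1" by (auto elim!: Ints_cases)
  then have m: "w0 \<bullet> v = - 1" using ge[of w0] w0f by (auto simp: ray_facet_def)
  have h: "ray_facet P \<rho> = {u \<in> P. u \<bullet> v = - 1}"
  proof (intro set_eqI iffI)
    fix u assume "u \<in> ray_facet P \<rho>"
    then have u: "u \<in> P" "u \<bullet> v \<le> w0 \<bullet> v" using w0f unfolding ray_facet_def v_def by blast+
    then show "u \<in> {u \<in> P. u \<bullet> v = - 1}" using ge[OF u(1)] m by simp
  next
    fix u assume "u \<in> {u \<in> P. u \<bullet> v = - 1}"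
    then show "u \<in> ray_facet P \<rho>" using ge unfolding ray_facet_def v_def[symmetric] by simp
  qed
  then show "ray_facet P \<rho> = {u \<in> P. u \<bullet> ray_gen \<rho> = - 1}" by (simp add: v_def)
  show "affine hull (ray_facet P \<rho>) = {u. u \<bullet> ray_gen \<rho> = - 1}"
    unfolding v_def[symmetric]
  proof
    have "{u. u \<bullet> v = - 1} = {u. v \<bullet> u = - 1}" by (simp add: inner_commute)
    then show "affine hull (ray_facet P \<rho>) \<subseteq> {u. u \<bullet> v = - 1}"
      using h by (intro hull_minimal) (auto simp: affine_hyperplane)
    show "{u. u \<bullet> v = - 1} \<subseteq> affine hull (ray_facet P \<rho>)"
    proof
      fix u assume u: "u \<in> {u. u \<bullet> v = - 1}"
      define D where "D = (\<lambda>x. - w0 + x) ` (ray_facet P \<rho>)"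
      obtain y z where yz: "y \<in> span D" "\<And>x. x \<in> span D \<Longrightarrow> orthogonal z x" "u - w0 = y + z"
        by (rule orthogonal_subspace_decomp_exists[of D "u - w0"]) blast
      have zw: "z \<bullet> x = z \<bullet> w0" if "x \<in> ray_facet P \<rho>" for x
      proof -
        have "x - w0 \<in> D" using that by (auto simp: D_def)
        then have "z \<bullet> (x - w0) = 0" using yz(2) span_base unfolding orthogonal_def by blast
        then show ?thesis by (simp add: inner_diff_right)
      qed
      have "z \<in> span {ray_gen \<rho>}" by (rule rf(4)) (simp add: zw)
      then obtain k where k: "z = k *\<^sub>R v" by (auto simp: span_singleton v_def)
      have "v \<bullet> x = 0" if "x \<in> D" for x using that h m by (auto simp: D_def inner_add_right inner_diff_left inner_commute[of v])
      then have "orthogonal v y"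
        by (intro orthogonal_to_span[OF yz(1)]) (auto simp: orthogonal_def)
      then have "y \<bullet> v = 0" by (simp add: orthogonal_def inner_commute)
      moreover have "(u - w0) \<bullet> v = 0" using u m by (simp add: inner_diff_left)
      then have "y \<bullet> v + k * (v \<bullet> v) = 0" unfolding yz(3) k inner_add_left inner_scaleR_left .
      ultimately have "k * (v \<bullet> v) = 0" by simp
      then have "k = 0" using v(2) by simp
      then have "u = w0 + y" using yz(3) k by (simp add: algebra_simps)
      moreover have "affine hull (ray_facet P \<rho>) = (\<lambda>x. w0 + x) ` span D"
        unfolding D_def by (rule affine_hull_span_gen) (rule hull_inc[OF w0f])
      ultimately show "u \<in> affine hull (ray_facet P \<rho>)" using yz(1) by simp
    qed
  qed
qed

section \<open>Lattice volumes of facets and cones over them\<close>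

text \<open>
  The dual basis of \<open>E\<close> is again a basis of the integer lattice: its vectors \<open>d b\<close> are integral
  because the unit vectors are integral combinations of \<open>E\<close>. All of them but \<open>d v\<close> are orthogonal
  to \<open>v\<close>, and they form the basis \<open>B\<close>; the remaining vector \<open>d v\<close> is \<open>w\<close>.
\<close>

lemma dual_lattice_basis:
  fixes E :: "(real^'n) set"
  assumes LB: "lattice_basis E int_lattice" and v: "v \<in> E"
  obtains B w where "lattice_basis B {x \<in> int_lattice. x \<bullet> v = 0}" "w \<in> int_lattice" "w \<bullet> v = 1"
proof -
  note E = lattice_basis_span[OF LB]
  have L: "int_lattice = {\<Sum>b\<in>E. of_int (k b) *\<^sub>R b | k :: real ^ 'n \<Rightarrow> int. True}"
    using LB by (simp add: lattice_basis_def)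
  have "\<exists>d. \<forall>b'\<in>E. b' \<bullet> d = (if b' = b then 1 else 0)" for b :: "real^'n"
  proof -
    obtain g :: "real^'n \<Rightarrow> real" where g: "linear g" "\<forall>x\<in>E. g x = (if x = b then 1 else 0)"
      using linear_independent_extend[OF E(4), of "\<lambda>x. if x = b then 1 else 0"] by blast
    then show ?thesis using adjoint_works[OF g(1), of _ 1] by (intro exI[of _ "adjoint g 1"]) simp
  qed
  then obtain d where d: "\<And>b b'. b' \<in> E \<Longrightarrow> b' \<bullet> d b = (if b' = b then 1 else 0)" by metis
  have dint: "d b \<in> int_lattice" if b: "b \<in> E" for b
    unfolding int_lattice_def
  proof (intro CollectI allI)
    fix i
    obtain k :: "real^'n \<Rightarrow> int" where k: "axis i 1 = (\<Sum>b\<in>E. of_int (k b) *\<^sub>R b)"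
      using axis_in_int_lattice[of i] unfolding L by blast
    have "d b $ i = axis i 1 \<bullet> d b" by (simp add: inner_axis')
    also have "\<dots> = (\<Sum>b'\<in>E. of_int (k b') * (b' \<bullet> d b))" unfolding k by (simp add: inner_sum_left)
    also have "\<dots> \<in> \<int>" by (intro Ints_sum Ints_mult) (auto simp: d)
    finally show "d b $ i \<in> \<int>" .
  qed
  have orth0: "y = 0" if y: "\<And>b. b \<in> E \<Longrightarrow> b \<bullet> y = 0" for y
  proof -
    have "orthogonal y x" if "x \<in> E" for x using y[OF that] by (simp add: orthogonal_def inner_commute)
    then have "orthogonal y y" using orthogonal_to_span[of y E y] E(1) by simp
    then show ?thesis by (simp add: orthogonal_def)
  qed
  have expand: "x = (\<Sum>b\<in>E. (b \<bullet> x) *\<^sub>R d b)" for x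
  proof -
    have "b' \<bullet> (x - (\<Sum>b\<in>E. (b \<bullet> x) *\<^sub>R d b)) = 0" if b': "b' \<in> E" for b'
    proof -
      have "(\<Sum>b\<in>E. (b \<bullet> x) * (b' \<bullet> d b)) = (\<Sum>b\<in>E. if b' = b then b \<bullet> x else 0)"
        using b' by (intro sum.cong) (auto simp: d)
      then show ?thesis using E(3) b' by (simp add: inner_diff_right inner_sum_right)
    qed
    then show ?thesis using orth0[of "x - (\<Sum>b\<in>E. (b \<bullet> x) *\<^sub>R d b)"] by simp
  qed
  have inj: "inj_on d E"
  proof (rule inj_onI)
    fix b b' assume "b \<in> E" "b' \<in> E" "d b = d b'"
    then show "b = b'" using d[of b b] d[of b b'] by (auto split: if_splits)
  qed
  define B where "B = d ` (E - {v})"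
  have injE: "inj_on d (E - {v})" using inj by (rule inj_on_subset) auto
  have fB: "finite B" using E(3) by (simp add: B_def)
  have sumB: "(\<Sum>y\<in>B. q y *\<^sub>R y) = (\<Sum>b\<in>E - {v}. q (d b) *\<^sub>R d b)" for q
    unfolding B_def by (simp add: sum.reindex[OF injE] comp_def)
  have indB: "independent B"
    unfolding independent_explicit
  proof (intro conjI allI impI ballI)
    fix q y assume q: "(\<Sum>y\<in>B. q y *\<^sub>R y) = 0" and "y \<in> B"
    then obtain b where b: "b \<in> E - {v}" "y = d b" by (auto simp: B_def)
    have "0 = b \<bullet> (\<Sum>b\<in>E - {v}. q (d b) *\<^sub>R d b)" using q sumB by simp
    also have "\<dots> = (\<Sum>b'\<in>E - {v}. if b = b' then q (d b') else 0)"
      unfolding inner_sum_right using b by (intro sum.cong) (auto simp: d)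
    also have "\<dots> = q y" using b E(3) by simp
    finally show "q y = 0" by simp
  qed (rule fB)
  have Beq: "{x \<in> int_lattice. x \<bullet> v = 0} = {\<Sum>b\<in>B. of_int (k b) *\<^sub>R b | k :: real ^ 'n \<Rightarrow> int. True}"
  proof (intro set_eqI iffI)
    fix x assume "x \<in> {x \<in> int_lattice. x \<bullet> v = 0}"
    then have x: "x \<in> int_lattice" "v \<bullet> x = 0" by (auto simp: inner_commute)
    define k where "k y = \<lfloor>inv_into (E - {v}) d y \<bullet> x\<rfloor>" for y
    have k: "of_int (k (d b)) = b \<bullet> x" if "b \<in> E - {v}" for b
    proof -
      have "b \<bullet> x \<in> \<int>" using that x E(5) by (intro int_lattice_inner) auto
      then show ?thesis using that by (simp add: k_def inv_into_f_f[OF injE] of_int_floor)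
    qed
    have "x = (\<Sum>b\<in>E. (b \<bullet> x) *\<^sub>R d b)" by (rule expand)
    also have "\<dots> = (\<Sum>b\<in>E - {v}. (b \<bullet> x) *\<^sub>R d b)"
      using E(3) v x(2) by (simp add: sum.remove[of E v])
    also have "\<dots> = (\<Sum>b\<in>E - {v}. of_int (k (d b)) *\<^sub>R d b)" by (intro sum.cong) (auto simp: k)
    also have "\<dots> = (\<Sum>y\<in>B. of_int (k y) *\<^sub>R y)" by (rule sumB[symmetric])
    finally show "x \<in> {\<Sum>b\<in>B. of_int (k b) *\<^sub>R b | k :: real ^ 'n \<Rightarrow> int. True}" by blast
  next
    fix x assume "x \<in> {\<Sum>b\<in>B. of_int (k b) *\<^sub>R b | k :: real ^ 'n \<Rightarrow> int. True}"
    then obtain k :: "real^'n \<Rightarrow> int" where k: "x = (\<Sum>b\<in>B. of_int (k b) *\<^sub>R b)" by blast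
    have "x \<in> int_lattice" unfolding k B_def using dint by (intro int_lattice_sum int_lattice_closed(4)) auto
    moreover have "v \<bullet> y = 0" if "y \<in> B" for y using that d[OF v] by (auto simp: B_def split: if_splits)
    then have "x \<bullet> v = 0" unfolding k by (simp add: inner_commute[of _ v] inner_sum_right)
    ultimately show "x \<in> {x \<in> int_lattice. x \<bullet> v = 0}" by simp
  qed
  show ?thesis
  proof (rule that)
    show "lattice_basis B {x \<in> int_lattice. x \<bullet> v = 0}" unfolding lattice_basis_def using indB Beq by blast
    show "d v \<in> int_lattice" by (rule dint[OF v])
    show "d v \<bullet> v = 1" using d[OF v, of v] by (simp add: inner_commute)
  qed
qed

lemma lattice_basis_insert:
  fixes B :: "(real^'n) set"
  assumes B: "lattice_basis B {x \<in> int_lattice. x \<bullet> v = 0}" and v: "v \<in> int_lattice"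
    and w: "w \<in> int_lattice" "w \<bullet> v = - 1"
  shows "lattice_basis (insert w B) int_lattice" "w \<notin> B"
proof -
  have Bs: "B \<subseteq> {x \<in> int_lattice. x \<bullet> v = 0}" by (rule lattice_basis_subset[OF B])
  have ind: "independent B" and L: "{x \<in> int_lattice. x \<bullet> v = 0} = {\<Sum>b\<in>B. of_int (k b) *\<^sub>R b | k :: real ^ 'n \<Rightarrow> int. True}"
    using B by (auto simp: lattice_basis_def)
  have fB: "finite B" using ind by (rule independent_imp_finite)
  show wB: "w \<notin> B" using Bs w by auto
  have "w \<notin> span B"
  proof
    assume "w \<in> span B"
    moreover have "orthogonal v x" if "x \<in> B" for x using Bs that by (auto simp: orthogonal_def inner_commute)
    ultimately have "orthogonal v w" using orthogonal_to_span by blast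
    then show False using w by (simp add: orthogonal_def inner_commute)
  qed
  then have indw: "independent (insert w B)" using ind by (simp add: independent_insert)
  have "int_lattice = {\<Sum>b\<in>insert w B. of_int (k b) *\<^sub>R b | k :: real ^ 'n \<Rightarrow> int. True}"
  proof (intro set_eqI iffI)
    fix x assume x: "x \<in> (int_lattice :: (real^'n) set)"
    have "x \<bullet> v \<in> \<int>" using x v by (rule int_lattice_inner)
    then obtain m :: int where m: "x \<bullet> v = of_int m" by (auto elim: Ints_cases)
    have "x - of_int (- m) *\<^sub>R w \<in> {x \<in> int_lattice. x \<bullet> v = 0}"
      using int_lattice_closed(3)[OF x int_lattice_closed(4)[OF w(1), of "- m"]] w(2) m
      by (simp add: inner_add_left)
    then obtain k :: "real^'n \<Rightarrow> int" where k: "x - of_int (- m) *\<^sub>R w = (\<Sum>b\<in>B. of_int (k b) *\<^sub>R b)" unfolding L by blast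
    define k' where "k' = k(w := - m)"
    have "(\<Sum>b\<in>B. of_int (k' b) *\<^sub>R b) = (\<Sum>b\<in>B. of_int (k b) *\<^sub>R b)" using wB by (intro sum.cong) (auto simp: k'_def)
    then have "x = of_int (k' w) *\<^sub>R w + (\<Sum>b\<in>B. of_int (k' b) *\<^sub>R b)" using k by (simp add: k'_def algebra_simps)
    then have "x = (\<Sum>b\<in>insert w B. of_int (k' b) *\<^sub>R b)" using wB fB by simp
    then show "x \<in> {\<Sum>b\<in>insert w B. of_int (k b) *\<^sub>R b | k :: real ^ 'n \<Rightarrow> int. True}" by blast
  next
    fix x assume "x \<in> {\<Sum>b\<in>insert w B. of_int (k b) *\<^sub>R b | k :: real ^ 'n \<Rightarrow> int. True}"
    then obtain k :: "real^'n \<Rightarrow> int" where k: "x = (\<Sum>b\<in>insert w B. of_int (k b) *\<^sub>R b)" by blast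
    show "x \<in> int_lattice" unfolding k using Bs w by (intro int_lattice_sum int_lattice_closed(4)) auto
  qed
  then show "lattice_basis (insert w B) int_lattice" using indw by (simp add: lattice_basis_def)
qed

text \<open>
  For \<open>a = 0\<close> this is the cone over \<open>F\<close> without its apex, for \<open>b = 1\<close> the outer layer of that cone.
  Leaving out the height \<open>a\<close> keeps all heights positive.
\<close>

definition cone_slab :: "real \<Rightarrow> real \<Rightarrow> 'a::real_vector set \<Rightarrow> 'a set" where
  "cone_slab a b F = {s *\<^sub>R u | s u. a < s \<and> s \<le> b \<and> u \<in> F}"

lemma cone_slab_iff:
  assumes F: "\<And>u. u \<in> F \<Longrightarrow> u \<bullet> v = - 1" and a: "0 \<le> a"
  shows "x \<in> cone_slab a b F \<longleftrightarrow> a < - (x \<bullet> v) \<and> - (x \<bullet> v) \<le> b \<and> (1 / - (x \<bullet> v)) *\<^sub>R x \<in> F"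
proof
  assume "x \<in> cone_slab a b F"
  then obtain s u where su: "x = s *\<^sub>R u" "a < s" "s \<le> b" "u \<in> F" by (auto simp: cone_slab_def)
  then have "- (x \<bullet> v) = s" using F by simp
  moreover have "(1 / s) *\<^sub>R x = u" using su a by simp
  ultimately show "a < - (x \<bullet> v) \<and> - (x \<bullet> v) \<le> b \<and> (1 / - (x \<bullet> v)) *\<^sub>R x \<in> F" using su by simp
next
  assume h: "a < - (x \<bullet> v) \<and> - (x \<bullet> v) \<le> b \<and> (1 / - (x \<bullet> v)) *\<^sub>R x \<in> F"
  then have "x = (- (x \<bullet> v)) *\<^sub>R ((1 / - (x \<bullet> v)) *\<^sub>R x)" using a by simp
  then show "x \<in> cone_slab a b F" using h unfolding cone_slab_def by blast
qed

lemma cone_slab_borel: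
  fixes v :: "'a::euclidean_space"
  assumes F: "\<And>u. u \<in> F \<Longrightarrow> u \<bullet> v = - 1" and a: "0 \<le> a" and cl: "closed F"
  shows "cone_slab a b F \<in> sets borel"
proof -
  have [measurable]: "F \<in> sets borel" using cl by (rule borel_closed)
  have "cone_slab a b F = {x \<in> space borel. a < - (x \<bullet> v) \<and> - (x \<bullet> v) \<le> b \<and> (1 / - (x \<bullet> v)) *\<^sub>R x \<in> F}"
    using cone_slab_iff[OF F a] by auto
  also have "\<dots> \<in> sets borel" by measurable
  finally show ?thesis .
qed

text \<open>
  In the coordinates of the lattice basis \<open>insert w B\<close>, the slice of the cone at height \<open>s\<close> is a
  translate of \<open>F\<close> scaled by \<open>s\<close>, and integrating \<open>s ^ (n - 1)\<close> over the heights gives the factor. The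
  base point \<open>p\<close> need not be integral; replacing \<open>w\<close> by \<open>p\<close> only translates the slices.
\<close>

lemma emeasure_cone_slab:
  fixes F :: "(real^'n) set"
  assumes B: "lattice_basis B {x \<in> int_lattice. x \<bullet> v = 0}" and v: "v \<in> int_lattice"
    and w: "w \<in> int_lattice" "w \<bullet> v = - 1" and p: "p \<bullet> v = - 1"
    and F: "\<And>u. u \<in> F \<Longrightarrow> u \<bullet> v = - 1" and cl: "closed F" and ab: "0 \<le> a" "a \<le> b"
  shows "emeasure lborel (cone_slab a b F) = ennreal ((b ^ CARD('n) - a ^ CARD('n)) / CARD('n)) *
     emeasure (\<Pi>\<^sub>M b\<in>B. lborel) {c \<in> B \<rightarrow>\<^sub>E UNIV. p + (\<Sum>b\<in>B. c b *\<^sub>R b) \<in> F}"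
    and "card B = CARD('n) - 1"
proof -
  interpret product_sigma_finite "\<lambda>_::real^'n. lborel :: real measure" by standard
  have Bw: "lattice_basis (insert w B) int_lattice" "w \<notin> B" using lattice_basis_insert[OF B v w] by auto
  note span = lattice_basis_span[OF Bw(1)]
  have fB: "finite B" using span(3) by simp
  show cB: "card B = CARD('n) - 1" using span(2) fB Bw(2) by simp
  have bv: "b \<bullet> v = 0" if "b \<in> B" for b using lattice_basis_subset[OF B] that by auto
  have Sv: "(\<Sum>b\<in>B. c b *\<^sub>R b) \<bullet> v = 0" for c by (simp add: inner_sum_left bv)
  \<comment> \<open>Both \<open>p\<close> and \<open>w\<close> pair to \<open>-1\<close> with \<open>v\<close>, so they differ by an element of the span of \<open>B\<close>.\<close>
  obtain r where r: "p = w + (\<Sum>b\<in>B. r b *\<^sub>R b)"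
  proof -
    have "p \<in> span (insert w B)" using span(1) by simp
    then obtain k where k: "p - k *\<^sub>R w \<in> span B" using span_breakdown_eq by blast
    then obtain r where r: "p - k *\<^sub>R w = (\<Sum>b\<in>B. r b *\<^sub>R b)" using span_finite[OF fB] by auto
    have "(p - k *\<^sub>R w) \<bullet> v = 0" unfolding r by (rule Sv)
    then have "k = 1" using p w by (simp add: inner_diff_left)
    then show ?thesis using that[of r] r by (simp add: algebra_simps)
  qed
  let ?C = "cone_slab a b F"
  let ?M = "\<Pi>\<^sub>M b\<in>B. (lborel :: real measure)"
  let ?X = "{c \<in> B \<rightarrow>\<^sub>E UNIV. p + (\<Sum>b\<in>B. c b *\<^sub>R b) \<in> F}"
  have [measurable]: "?C \<in> sets borel" by (rule cone_slab_borel[OF F ab(1) cl])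
  have [measurable]: "F \<in> sets borel" using cl by (rule borel_closed)
  have X: "?X \<in> sets ?M"
  proof -
    have "?X = {c \<in> space ?M. p + (\<Sum>b\<in>B. c b *\<^sub>R b) \<in> F}" by (auto simp: space_PiM)
    also have "\<dots> \<in> sets ?M" by measurable
    finally show ?thesis .
  qed
  have upd: "(\<Sum>b\<in>insert w B. (c(w := s)) b *\<^sub>R b) = s *\<^sub>R w + (\<Sum>b\<in>B. c b *\<^sub>R b)" for c s
  proof -
    have "(\<Sum>b\<in>B. (c(w := s)) b *\<^sub>R b) = (\<Sum>b\<in>B. c b *\<^sub>R b)" using Bw(2) by (intro sum.cong) auto
    then show ?thesis using Bw(2) fB by simp
  qed
  have "emeasure lborel ?C = emeasure (distr (\<Pi>\<^sub>M b\<in>insert w B. lborel) borel (\<lambda>c. \<Sum>b\<in>insert w B. c b *\<^sub>R b)) ?C"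
    using lborel_lattice_basis[OF Bw(1)] by (rule arg_cong)
  also have "\<dots> = (\<integral>\<^sup>+x. indicator ?C x \<partial>distr (\<Pi>\<^sub>M b\<in>insert w B. lborel) borel (\<lambda>c. \<Sum>b\<in>insert w B. c b *\<^sub>R b))"
    by (rule nn_integral_indicator[symmetric]) simp
  also have "\<dots> = (\<integral>\<^sup>+c. indicator ?C (\<Sum>b\<in>insert w B. c b *\<^sub>R b) \<partial>(\<Pi>\<^sub>M b\<in>insert w B. lborel))"
    by (rule nn_integral_distr) measurable
  also have "\<dots> = (\<integral>\<^sup>+s. (\<integral>\<^sup>+c. indicator ?C (\<Sum>b\<in>insert w B. (c(w := s)) b *\<^sub>R b) \<partial>?M) \<partial>lborel)"
    by (rule product_nn_integral_insert_rev[OF fB Bw(2)]) measurable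
  also have "\<dots> = (\<integral>\<^sup>+s. (\<integral>\<^sup>+c. indicator ?C (s *\<^sub>R w + (\<Sum>b\<in>B. c b *\<^sub>R b)) \<partial>?M) \<partial>lborel)"
    by (simp only: upd)
  also have "\<dots> = (\<integral>\<^sup>+s. ennreal (s ^ (CARD('n) - 1)) * indicator {a<..b} s * emeasure ?M ?X \<partial>lborel)"
  proof (rule nn_integral_cong)
    fix s :: real
    have sv: "(s *\<^sub>R w + (\<Sum>b\<in>B. c b *\<^sub>R b)) \<bullet> v = - s" for c using w by (simp add: inner_add_left Sv)
    show "(\<integral>\<^sup>+c. indicator ?C (s *\<^sub>R w + (\<Sum>b\<in>B. c b *\<^sub>R b)) \<partial>?M) = ennreal (s ^ (CARD('n) - 1)) * indicator {a<..b} s * emeasure ?M ?X"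
    proof (cases "s \<in> {a<..b}")
      case False
      then have "s *\<^sub>R w + (\<Sum>b\<in>B. c b *\<^sub>R b) \<notin> ?C" for c
        using cone_slab_iff[OF F ab(1), where x = "s *\<^sub>R w + (\<Sum>b\<in>B. c b *\<^sub>R b)" and b = b] sv[of c] by auto
      then show ?thesis using False by (simp add: indicator_def)
    next
      case True
      then have s: "s > 0" using ab by auto
      have sum: "s *\<^sub>R w + (\<Sum>b\<in>B. (\<lambda>b\<in>B. s * r b + s * c b) b *\<^sub>R b) = s *\<^sub>R (p + (\<Sum>b\<in>B. c b *\<^sub>R b))" for c
      proof -
        have "(\<Sum>b\<in>B. (\<lambda>b\<in>B. s * r b + s * c b) b *\<^sub>R b) = (\<Sum>b\<in>B. s *\<^sub>R (r b *\<^sub>R b) + s *\<^sub>R (c b *\<^sub>R b))"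
          by (intro sum.cong) (auto simp: algebra_simps)
        then show ?thesis unfolding r by (simp add: sum.distrib scaleR_sum_right scaleR_add_right)
      qed
      have ind: "indicator ?C (s *\<^sub>R (p + (\<Sum>b\<in>B. c b *\<^sub>R b))) = (indicator F (p + (\<Sum>b\<in>B. c b *\<^sub>R b)) :: ennreal)" for c
      proof -
        have "(s *\<^sub>R (p + (\<Sum>b\<in>B. c b *\<^sub>R b))) \<bullet> v = - s" using p by (simp add: inner_add_left Sv)
        then have "s *\<^sub>R (p + (\<Sum>b\<in>B. c b *\<^sub>R b)) \<in> ?C \<longleftrightarrow> p + (\<Sum>b\<in>B. c b *\<^sub>R b) \<in> F"
          using cone_slab_iff[OF F ab(1), where x = "s *\<^sub>R (p + (\<Sum>b\<in>B. c b *\<^sub>R b))" and b = b] True s by simp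
        then show ?thesis by (simp add: indicator_def)
      qed
      have "(\<integral>\<^sup>+c. indicator ?C (s *\<^sub>R w + (\<Sum>b\<in>B. c b *\<^sub>R b)) \<partial>?M)
         = ennreal (s ^ card B) * (\<integral>\<^sup>+c. indicator ?C (s *\<^sub>R w + (\<Sum>b\<in>B. (\<lambda>b\<in>B. s * r b + s * c b) b *\<^sub>R b)) \<partial>?M)"
        by (rule nn_integral_PiM_scale_shift[OF fB s]) measurable
      also have "\<dots> = ennreal (s ^ card B) * (\<integral>\<^sup>+c. indicator F (p + (\<Sum>b\<in>B. c b *\<^sub>R b)) \<partial>?M)"
        unfolding sum ind ..
      also have "(\<integral>\<^sup>+c. indicator F (p + (\<Sum>b\<in>B. c b *\<^sub>R b)) \<partial>?M) = (\<integral>\<^sup>+c. indicator ?X c \<partial>?M)"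
        by (rule nn_integral_cong) (auto simp: indicator_def space_PiM)
      also have "\<dots> = emeasure ?M ?X" using X by simp
      finally show ?thesis using True by (simp add: cB)
    qed
  qed
  also have "\<dots> = (\<integral>\<^sup>+s. ennreal (s ^ (CARD('n) - 1)) * indicator {a<..b} s \<partial>lborel) * emeasure ?M ?X"
    by (rule nn_integral_multc) measurable
  also have "(\<integral>\<^sup>+s. ennreal (s ^ (CARD('n) - 1)) * indicator {a<..b} s \<partial>lborel)
     = (\<integral>\<^sup>+s. ennreal (s ^ (CARD('n) - 1)) * indicator {a..b} s \<partial>lborel)"
  proof (rule nn_integral_cong_AE)
    show "AE s in lborel. ennreal (s ^ (CARD('n) - 1)) * indicator {a<..b} s = ennreal (s ^ (CARD('n) - 1)) * indicator {a..b} s"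
      using AE_lborel_singleton[of a] by eventually_elim (auto simp: indicator_def)
  qed
  also have "\<dots> = ennreal (b ^ CARD('n) / CARD('n) - a ^ CARD('n) / CARD('n))"
  proof (rule nn_integral_FTC_Icc)
    fix x assume "x \<in> {a..b}"
    have "((\<lambda>x. x ^ CARD('n) / CARD('n)) has_real_derivative (real CARD('n) * x ^ (CARD('n) - 1)) / CARD('n)) (at x)"
      by (auto intro!: derivative_eq_intros)
    then show "((\<lambda>x. x ^ CARD('n) / CARD('n)) has_real_derivative x ^ (CARD('n) - 1)) (at x)"
      by simp
    show "0 \<le> x ^ (CARD('n) - 1)" using \<open>x \<in> {a..b}\<close> ab by simp
  qed (use ab in auto)
  finally show "emeasure lborel ?C = ennreal ((b ^ CARD('n) - a ^ CARD('n)) / CARD('n)) * emeasure ?M ?X"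
    by (simp add: diff_divide_distrib)
qed

text \<open>
  The normals at a vertex of the facet form a lattice basis by smoothness, and their dual
  basis provides the lattice bases in which both volumes are computed.
\<close>

lemma measure_cone_slab_ray_facet:
  fixes P :: "(real^'n) set"
  assumes S: "smooth_polytope P" and R: "reflexive_polytope P" and \<rho>: "\<rho> \<in> rays P" and ab: "0 \<le> a" "a \<le> b"
  shows "measure lborel (cone_slab a b (ray_facet P \<rho>)) = (b ^ CARD('n) - a ^ CARD('n)) * (lattice_volume (ray_facet P \<rho>) / fact CARD('n))"
proof -
  have lat: "lattice_polytope P" and int: "0 \<in> interior P" using R by (auto simp: reflexive_polytope_def)
  define v where "v = ray_gen \<rho>"
  define F where "F = ray_facet P \<rho>"
  have v: "v \<in> int_lattice" using ray_gen_primitive[OF lat int \<rho>] by (simp add: v_def primitive_def)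
  have Feq: "F = {u \<in> P. u \<bullet> v = - 1}" unfolding F_def v_def by (rule ray_facet_height[OF R \<rho>])
  have aff: "affine hull F = {u. u \<bullet> v = - 1}" unfolding F_def v_def by (rule affine_hull_ray_facet[OF R \<rho>])
  have ne: "F \<noteq> {}" unfolding F_def by (rule ray_facet_nonempty[OF R \<rho>])
  obtain V where V: "finite V" "P = convex hull V" using lat by (auto simp: lattice_polytope_def)
  have cP: "compact P" "convex P" unfolding V(2) using finite_imp_compact_convex_hull[OF V(1)] by auto
  have Fi: "F = P \<inter> {u. v \<bullet> u = - 1}" using Feq by (auto simp: inner_commute)
  have cF: "compact F" unfolding Fi by (intro compact_Int_closed cP closed_hyperplane)
  have Fface: "F face_of P" unfolding Fi
    by (rule face_of_Int_supporting_hyperplane_ge[OF cP(2)])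
      (use R \<rho> in \<open>auto simp: reflexive_polytope_def v_def inner_commute\<close>)
  have "convex F" using Fface face_of_imp_convex by blast
  then obtain x where "x extreme_point_of F" using extreme_point_exists_convex[OF cF _ ne] by blast
  then have x: "x extreme_point_of P" "x \<in> F" 
    using extreme_point_of_face[OF Fface] by auto
  have LB: "lattice_basis {ray_gen \<rho> | \<rho>. \<rho> \<in> rays P \<and> x \<in> ray_facet P \<rho>} int_lattice"
    using S x(1) by (auto simp: smooth_polytope_def)
  have vin: "v \<in> {ray_gen \<rho> | \<rho>. \<rho> \<in> rays P \<and> x \<in> ray_facet P \<rho>}"
    using \<rho> x(2) by (auto simp: v_def F_def)
  obtain B0 w0 where B0: "lattice_basis B0 {x \<in> int_lattice. x \<bullet> v = 0}" and w0: "w0 \<in> int_lattice" "w0 \<bullet> v = 1"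
    using dual_lattice_basis[OF LB vin] .
  \<comment> \<open>The normals point inwards, so the points of the facet pair to \<open>-1\<close> with \<open>v\<close>.\<close>
  define w where "w = - w0"
  have w: "w \<in> int_lattice" "w \<bullet> v = - 1" 
    using int_lattice_closed(3)[OF int_lattice_closed(1) w0(1)] w0(2) by (auto simp: w_def)
  have ind: "induced_lattice F = {x \<in> int_lattice. x \<bullet> v = 0}"
  proof -
    have "{x - y | x y. x \<bullet> v = - 1 \<and> y \<bullet> v = - 1} = {z. z \<bullet> v = 0}"
    proof (intro set_eqI iffI)
      fix z assume "z \<in> {z. z \<bullet> v = 0}"
      then have "z = (w + z) - w" "(w + z) \<bullet> v = - 1" using w by (auto simp: inner_add_left)
      then show "z \<in> {x - y | x y. x \<bullet> v = - 1 \<and> y \<bullet> v = - 1}" using w(2) by blast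
    qed (auto simp: inner_diff_left)
    then show ?thesis unfolding induced_lattice_def aff by auto
  qed
  define B where "B = (SOME B. lattice_basis B (induced_lattice F))"
  define p where "p = (SOME p. p \<in> affine hull F)"
  have B: "lattice_basis B {x \<in> int_lattice. x \<bullet> v = 0}"
    unfolding B_def ind by (rule someI[where P = "\<lambda>B. lattice_basis B _", OF B0])
  have "w \<in> affine hull F" using aff w by simp
  then have "p \<in> affine hull F" unfolding p_def by (rule someI)
  then have p: "p \<bullet> v = - 1" using aff by simp
  let ?m = "measure (\<Pi>\<^sub>M b\<in>B. lborel) {c \<in> B \<rightarrow>\<^sub>E UNIV. p + (\<Sum>b\<in>B. c b *\<^sub>R b) \<in> F}"
  have Fv: "\<And>u. u \<in> F \<Longrightarrow> u \<bullet> v = - 1" using Feq by auto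
  have em: "emeasure lborel (cone_slab a b F) = ennreal ((b ^ CARD('n) - a ^ CARD('n)) / CARD('n)) *
     emeasure (\<Pi>\<^sub>M b\<in>B. lborel) {c \<in> B \<rightarrow>\<^sub>E UNIV. p + (\<Sum>b\<in>B. c b *\<^sub>R b) \<in> F}"
    using Fv compact_imp_closed[OF cF] ab by (rule emeasure_cone_slab(1)[OF B v w p])
  have cB: "card B = CARD('n) - 1"
    using Fv compact_imp_closed[OF cF] ab by (rule emeasure_cone_slab(2)[OF B v w p])
  have lv: "lattice_volume F = fact (CARD('n) - 1) * ?m"
    unfolding lattice_volume_def Let_def B_def[symmetric] p_def[symmetric] by (simp add: cB)
  have ge: "a ^ CARD('n) \<le> b ^ CARD('n)" using ab by (intro power_mono) auto
  have "measure lborel (cone_slab a b F) = (b ^ CARD('n) - a ^ CARD('n)) / CARD('n) * ?m"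
    unfolding measure_def em using ge by (simp add: enn2real_mult)
  also have "\<dots> = (b ^ CARD('n) - a ^ CARD('n)) * (lattice_volume F / fact CARD('n))"
    using fact_num_eq_if[of "CARD('n)", where 'a = real] unfolding lv by simp
  finally show ?thesis by (simp add: F_def)
qed

lemma lattice_volume_nonneg: "0 \<le> lattice_volume S"
  by (simp add: lattice_volume_def Let_def)

section \<open>Cone volumes of a reflexive polytope\<close>

text \<open>
  A rational basis of \<open>F\<close> spans, over the reals, a space containing \<open>F\<close>.
\<close>

lemma dim_span_of_rat_vec:
  fixes F :: "(rat ^ 'n) set"
  shows "dim (span (of_rat_vec ` F)) \<le> vec.dim F"
proof -
  obtain B where B: "B \<subseteq> F" "vec.independent B" "F \<subseteq> vec.span B" "card B = vec.dim F"
    by (rule vec.basis_exists)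
  have fin: "finite B" using B(2) by (rule vec.finiteI_independent) 
  have add: "of_rat_vec (x + y) = of_rat_vec x + of_rat_vec y"
    and scale: "of_rat_vec (c *s x) = of_rat c *\<^sub>R of_rat_vec x"
    and zero: "of_rat_vec 0 = 0" for x y :: "rat^'n" and c
    by (simp_all add: of_rat_vec_def vec_eq_iff of_rat_add of_rat_mult)
  have "vec.subspace {x. of_rat_vec x \<in> span (of_rat_vec ` B)}"
    by (auto simp: vec.subspace_def add scale zero intro: span_add span_scale span_zero)
  then have "vec.span B \<subseteq> {x. of_rat_vec x \<in> span (of_rat_vec ` B)}"
    by (intro vec.span_minimal) (auto intro: span_base)
  then have "of_rat_vec ` F \<subseteq> span (of_rat_vec ` B)" using B(3) by auto
  then have "dim (span (of_rat_vec ` F)) \<le> dim (span (of_rat_vec ` B))"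
    by (intro dim_subset span_minimal) auto
  also have "\<dots> \<le> card (of_rat_vec ` B)" using fin by (simp add: dim_le_card')
  also have "\<dots> \<le> card B" using fin by (rule card_image_le)
  finally show ?thesis using B(4) by simp
qed

lemma cone_slab_subset_convex:
  assumes "convex P" "0 \<in> P" "F \<subseteq> P" "0 \<le> a" "b \<le> 1"
  shows "cone_slab a b F \<subseteq> P"
proof
  fix x assume "x \<in> cone_slab a b F"
  then obtain s u where su: "x = s *\<^sub>R u" "a < s" "s \<le> b" "u \<in> F" by (auto simp: cone_slab_def)
  then have "(1 - s) *\<^sub>R 0 + s *\<^sub>R u \<in> P" using assms by (intro convexD) auto
  then show "x \<in> P" using su by simp
qed

text \<open>
  The ray from 0 through \<open>x\<close> leaves \<open>P\<close> through the facet whose normal takes the smallest value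
  at \<open>x\<close>.
\<close>

lemma facet_cones_cover:
  fixes P :: "(real^'n) set"
  assumes R: "reflexive_polytope P"
  shows "P \<subseteq> insert 0 (\<Union>\<rho>\<in>rays P. cone_slab 0 1 (ray_facet P \<rho>))"
proof
  fix x assume x: "x \<in> P"
  have lat: "lattice_polytope P" and Peq: "P = {u. \<forall>\<rho>\<in>rays P. - 1 \<le> u \<bullet> ray_gen \<rho>}"
    using R by (auto simp: reflexive_polytope_def)
  have fin: "finite (rays P)" by (rule finite_rays[OF lat])
  obtain V where V: "finite V" "P = convex hull V" using lat by (auto simp: lattice_polytope_def)
  have bP: "bounded P" unfolding V(2) using finite_imp_bounded_convex_hull[OF V(1)] .
  show "x \<in> insert 0 (\<Union>\<rho>\<in>rays P. cone_slab 0 1 (ray_facet P \<rho>))"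
  proof (cases "x = 0")
    case False
    have "\<exists>\<rho>\<in>rays P. x \<bullet> ray_gen \<rho> < 0"
    proof (rule ccontr)
      assume "\<not> ?thesis"
      then have nn: "\<And>\<rho>. \<rho> \<in> rays P \<Longrightarrow> 0 \<le> x \<bullet> ray_gen \<rho>" by (auto simp: not_less)
      have kP: "k *\<^sub>R x \<in> P" if "k \<ge> 0" for k
      proof -
        have "- 1 \<le> k * (x \<bullet> ray_gen \<rho>)" if "\<rho> \<in> rays P" for \<rho>
          using mult_nonneg_nonneg[OF \<open>k \<ge> 0\<close> nn[OF that]] by simp
        then show ?thesis by (subst Peq) simp
      qed
      obtain M where M: "\<And>y. y \<in> P \<Longrightarrow> norm y \<le> M" using bP by (auto simp: bounded_iff)
      \<comment> \<open>\<open>P\<close> would contain the whole ray through \<open>x\<close>, in particular a point of norm \<open>\<bar>M\<bar> + 1\<close>.\<close>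
      have "norm (((\<bar>M\<bar> + 1) / norm x) *\<^sub>R x) \<le> M" by (intro M kP) simp
      then show False using False by simp
    qed
    then obtain \<rho>0 where \<rho>0: "\<rho>0 \<in> rays P" "x \<bullet> ray_gen \<rho>0 < 0" by blast
    obtain \<rho> where \<rho>: "\<rho> \<in> rays P" "\<And>\<sigma>. \<sigma> \<in> rays P \<Longrightarrow> x \<bullet> ray_gen \<rho> \<le> x \<bullet> ray_gen \<sigma>"
      using arg_min_if_finite[OF fin, of "\<lambda>\<rho>. x \<bullet> ray_gen \<rho>"] \<rho>0(1) by (metis empty_iff linorder_not_less)
    define s where "s = - (x \<bullet> ray_gen \<rho>)"
    have s: "0 < s" "s \<le> 1" using \<rho>(2)[OF \<rho>0(1)] \<rho>0(2) x \<rho>(1) Peq by (auto simp: s_def)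
    have "- 1 \<le> ((1 / s) *\<^sub>R x) \<bullet> ray_gen \<sigma>" if "\<sigma> \<in> rays P" for \<sigma>
      using \<rho>(2)[OF that] s by (simp add: s_def field_simps)
    then have "(1 / s) *\<^sub>R x \<in> P" by (subst Peq) simp
    moreover have "((1 / s) *\<^sub>R x) \<bullet> ray_gen \<rho> = - 1" using s by (simp add: s_def)
    ultimately have "(1 / s) *\<^sub>R x \<in> ray_facet P \<rho>" using ray_facet_height[OF R \<rho>(1)] by simp
    moreover have "x = s *\<^sub>R ((1 / s) *\<^sub>R x)" using s by simp
    ultimately have "x \<in> cone_slab 0 1 (ray_facet P \<rho>)" using s unfolding cone_slab_def by blast
    then show ?thesis using \<rho>(1) by blast
  qed simp
qed

text \<open>
  On the cone over a facet, the value of the facet's own normal is minimal among all the ray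
  generators. Hence both generators take the same value on the intersection of the cones, which
  therefore lies in a hyperplane.
\<close>

lemma negligible_cone_slab_overlap:
  fixes P :: "(real^'n) set"
  assumes R: "reflexive_polytope P" and \<rho>: "\<rho> \<in> rays P" "\<sigma> \<in> rays P" "\<rho> \<noteq> \<sigma>" and a: "0 \<le> a"
  shows "negligible (cone_slab a 1 (ray_facet P \<rho>) \<inter> cone_slab a 1 (ray_facet P \<sigma>))"
proof -
  have lat: "lattice_polytope P" and int: "0 \<in> interior P" and
    ge: "\<And>u \<rho>. u \<in> P \<Longrightarrow> \<rho> \<in> rays P \<Longrightarrow> - 1 \<le> u \<bullet> ray_gen \<rho>"
    using R unfolding reflexive_polytope_def by blast+
  have ne: "ray_gen \<rho> - ray_gen \<sigma> \<noteq> 0" using inj_on_ray_gen[OF lat int] \<rho> by (auto simp: inj_on_def)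
  have le: "x \<bullet> ray_gen \<rho> \<le> x \<bullet> ray_gen \<sigma>"
    if x: "x \<in> cone_slab a 1 (ray_facet P \<rho>)" and rays: "\<rho> \<in> rays P" "\<sigma> \<in> rays P" for x \<rho> \<sigma>
  proof -
    obtain s u where su: "x = s *\<^sub>R u" "a < s" "u \<in> ray_facet P \<rho>" using x by (auto simp: cone_slab_def)
    have u: "u \<in> P" "u \<bullet> ray_gen \<rho> = - 1" using su(3) ray_facet_height[OF R rays(1)] by auto
    have "s * (u \<bullet> ray_gen \<rho>) \<le> s * (u \<bullet> ray_gen \<sigma>)"
      using ge[OF u(1) rays(2)] u(2) su(2) a by (intro mult_left_mono) auto
    then show ?thesis using su(1) by simp
  qed
  have "cone_slab a 1 (ray_facet P \<rho>) \<inter> cone_slab a 1 (ray_facet P \<sigma>) \<subseteq> {x. (ray_gen \<rho> - ray_gen \<sigma>) \<bullet> x = 0}"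
  proof
    fix x assume "x \<in> cone_slab a 1 (ray_facet P \<rho>) \<inter> cone_slab a 1 (ray_facet P \<sigma>)"
    then have "x \<bullet> ray_gen \<rho> = x \<bullet> ray_gen \<sigma>" using le \<rho> by (intro antisym) auto
    then show "x \<in> {x. (ray_gen \<rho> - ray_gen \<sigma>) \<bullet> x = 0}" by (simp add: inner_diff_right inner_commute[of _ x])
  qed
  then show ?thesis using negligible_hyperplane[of "ray_gen \<rho> - ray_gen \<sigma>" 0] ne negligible_subset by blast
qed

text \<open>
  Divide by \<open>1 - t\<close> and let \<open>t\<close> tend to 1.
\<close>

lemma power_gap_limit:
  fixes S V :: real
  assumes "\<And>t. 0 < t \<Longrightarrow> t < 1 \<Longrightarrow> (1 - t ^ n) * S \<le> (1 - t ^ d) * V"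
  shows "real n * S \<le> real d * V"
proof -
  have "(\<Sum>i<n. t ^ i) * S \<le> (\<Sum>i<d. t ^ i) * V" if t: "0 < t" "t < 1" for t :: real
  proof -
    have "(1 - t) * ((\<Sum>i<n. t ^ i) * S) \<le> (1 - t) * ((\<Sum>i<d. t ^ i) * V)"
      using assms[OF t] unfolding one_diff_power_eq[of t n] one_diff_power_eq[of t d] by (simp add: mult.assoc)
    then show ?thesis using t by simp
  qed
  then have ev: "\<forall>\<^sub>F t in at_left (1::real). (\<Sum>i<n. t ^ i) * S \<le> (\<Sum>i<d. t ^ i) * V"
    using eventually_at_left_real[of 0 1] by (auto elim!: eventually_mono)
  have lim: "((\<lambda>t::real. (\<Sum>i<m. t ^ i) * C) \<longlongrightarrow> (\<Sum>i<m. 1 ^ i) * C) (at_left 1)" for m C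
    by (intro tendsto_intros)
  show ?thesis using tendsto_le[OF _ lim lim ev] by simp
qed

theorem corollary1p7:
  fixes P :: "(real ^ 'n) set" and F :: "(rat ^ 'n) set"
  assumes "smooth_polytope P"
    and "reflexive_polytope P"
    and "aff_dim P = int CARD('n)"
    and "barycenter P = 0"
    and "vec.subspace F"
    and "F \<noteq> {0}"
    and "F \<noteq> UNIV"
  shows "1 / real (vec.dim F) *
           (\<Sum>\<rho> | \<rho> \<in> rays P \<and> ray_gen \<rho> \<in> of_rat_vec ` F. lattice_volume (ray_facet P \<rho>))
         \<le> 1 / real CARD('n) * (\<Sum>\<rho>\<in>rays P. lattice_volume (ray_facet P \<rho>))"
proof -
  note S = assms(1) and R = assms(2)
  have lat: "lattice_polytope P" and int: "0 \<in> interior P" and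
    ge: "\<And>u \<rho>. u \<in> P \<Longrightarrow> \<rho> \<in> rays P \<Longrightarrow> - 1 \<le> u \<bullet> ray_gen \<rho>"
    using R unfolding reflexive_polytope_def by blast+
  obtain W where W: "finite W" "P = convex hull W" using lat by (auto simp: lattice_polytope_def)
  have cP: "compact P" "convex P" unfolding W(2) using finite_imp_compact_convex_hull[OF W(1)] by auto
  have P0: "0 \<in> P" using int interior_subset by blast
  have Pb: "P \<in> sets borel" using cP(1) by (rule borel_compact)
  have Pl: "P \<in> lmeasurable" using cP(1) by (rule lmeasurable_compact)
  have fin: "finite (rays P)" by (rule finite_rays[OF lat])
  define V where "V = measure lborel P"
  have Vpos: "0 < V"
  proof -
    obtain r where r: "r > 0" "ball 0 r \<subseteq> P" using int by (auto simp: mem_interior)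
    have "0 < measure lebesgue (ball (0::real^'n) r)" using content_ball_pos[OF r(1)] by simp
    also have "\<dots> \<le> measure lebesgue P" using r(2) Pl by (intro measure_mono_fmeasurable) auto
    also have "\<dots> = V" using Pb by (simp add: V_def)
    finally show ?thesis .
  qed
  have cent: "(LINT x:P|lborel. x) = 0"
    using assms(4) Vpos by (auto simp: barycenter_def V_def)
  define n where "n = CARD('n)"
  define lv where "lv \<rho> = lattice_volume (ray_facet P \<rho>) / fact n" for \<rho>
  define A where "A = {\<rho>. \<rho> \<in> rays P \<and> ray_gen \<rho> \<in> of_rat_vec ` F}"
  have A: "A \<subseteq> rays P" "finite A" using fin by (auto simp: A_def)
  define U where "U = span (of_rat_vec ` F :: (real^'n) set)"
  have facetP: "ray_facet P \<rho> \<subseteq> P" for \<rho> by (auto simp: ray_facet_def)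
  have height: "u \<bullet> ray_gen \<rho> = - 1" if "\<rho> \<in> rays P" "u \<in> ray_facet P \<rho>" for \<rho> u
    using ray_facet_height[OF R that(1)] that(2) by auto
  have facet_closed: "closed (ray_facet P \<rho>)" if "\<rho> \<in> rays P" for \<rho>
  proof -
    have "ray_facet P \<rho> = P \<inter> {u. ray_gen \<rho> \<bullet> u = - 1}"
      using ray_facet_height[OF R that] by (auto simp: inner_commute)
    then show ?thesis using cP(1) by (simp add: closed_Int compact_imp_closed closed_hyperplane)
  qed
  have slab_borel: "cone_slab a 1 (ray_facet P \<rho>) \<in> sets borel" if "\<rho> \<in> rays P" "0 \<le> a" for \<rho> a
    by (rule cone_slab_borel[OF height[OF that(1)] that(2) facet_closed[OF that(1)]])
  have slabP: "cone_slab a 1 (ray_facet P \<rho>) \<subseteq> P" if "0 \<le> a" for \<rho> a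
    by (rule cone_slab_subset_convex[OF cP(2) P0 facetP that]) simp
  have slab_meas: "cone_slab a 1 (ray_facet P \<rho>) \<in> lmeasurable" if "\<rho> \<in> rays P" "0 \<le> a" for \<rho> a
    using slab_borel[OF that] by (intro fmeasurableI2[OF Pl slabP[OF that(2)]]) simp
  have slab_vol: "measure lebesgue (cone_slab a 1 (ray_facet P \<rho>)) = (1 - a ^ n) * lv \<rho>"
    if "\<rho> \<in> rays P" "0 \<le> a" "a \<le> 1" for \<rho> a
    using measure_cone_slab_ray_facet[OF S R that(1), of a 1] that slab_borel[OF that(1,2)]
    by (simp add: lv_def n_def)
  have total: "V \<le> (\<Sum>\<rho>\<in>rays P. lv \<rho>)"
  proof -
    let ?C = "\<lambda>\<rho>. cone_slab 0 1 (ray_facet P \<rho>)"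
    have "V = measure lebesgue P" using Pb by (simp add: V_def)
    also have "\<dots> \<le> measure lebesgue ({0} \<union> (\<Union>\<rho>\<in>rays P. ?C \<rho>))"
      using facet_cones_cover[OF R] Pl fin slab_meas
      by (intro measure_mono_fmeasurable fmeasurable.Un fmeasurable.finite_UN) (auto intro: lmeasurable_compact[of "{0}"])
    also have "\<dots> \<le> measure lebesgue {0 :: real^'n} + measure lebesgue (\<Union>\<rho>\<in>rays P. ?C \<rho>)"
      using fin slab_meas by (intro measure_Un_le sets.finite_UN) auto
    also have "\<dots> \<le> 0 + (\<Sum>\<rho>\<in>rays P. measure lebesgue (?C \<rho>))"
      using fin slab_meas by (intro add_mono measure_UNION_le) auto
    also have "\<dots> = (\<Sum>\<rho>\<in>rays P. lv \<rho>)"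
      by (simp, intro sum.cong) (simp_all add: slab_vol n_def)
    finally show ?thesis .
  qed
  have gap: "(1 - t ^ n) * (\<Sum>\<rho>\<in>A. lv \<rho>) \<le> (1 - t ^ dim U) * V" if t: "0 < t" "t < 1" for t
  proof -
    define K where "K = {x \<in> P. \<forall>v\<in>ray_gen ` A. - t \<le> x \<bullet> v}"
    have "t ^ dim U * V \<le> measure lborel K"
      unfolding K_def V_def
    proof (rule centered_convex_body_squeeze[OF cP(2,1) int cent _ _ _ _ t])
      show "ray_gen ` A \<subseteq> U" by (auto simp: A_def U_def intro: span_base)
      show "- 1 \<le> x \<bullet> v" if "x \<in> P" "v \<in> ray_gen ` A" for x v using that ge A(1) by auto
    qed (use A in \<open>auto simp: U_def\<close>)
    have K_closed: "closed K"
    proof -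
      have "K = P \<inter> (\<Inter>v\<in>ray_gen ` A. {x. - t \<le> x \<bullet> v})" by (auto simp: K_def)
      also have "closed \<dots>"
        by (intro closed_Int compact_imp_closed[OF cP(1)] closed_INT ballI closed_Collect_le continuous_intros)
      finally show ?thesis .
    qed
    have KP: "K \<subseteq> P" by (auto simp: K_def)
    have Kl: "K \<in> lmeasurable" using K_closed KP cP(1)
      by (meson bounded_subset compact_eq_bounded_closed lmeasurable_compact)
    let ?C = "\<lambda>\<rho>. cone_slab t 1 (ray_facet P \<rho>)"
    let ?U = "\<Union>\<rho>\<in>A. ?C \<rho>"
    have Ul: "?U \<in> lmeasurable" using A slab_meas t by (intro fmeasurable.finite_UN) auto
    have "K \<inter> ?U = {}"
    proof (rule ccontr)
      assume "K \<inter> ?U \<noteq> {}"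
      then obtain x \<rho> where x: "x \<in> K" "\<rho> \<in> A" "x \<in> ?C \<rho>" by blast
      then obtain s u where su: "x = s *\<^sub>R u" "t < s" "u \<in> ray_facet P \<rho>" by (auto simp: cone_slab_def)
      have "x \<bullet> ray_gen \<rho> = - s" using su height[of \<rho> u] x(2) A(1) by auto
      moreover have "- t \<le> x \<bullet> ray_gen \<rho>" using x by (auto simp: K_def)
      ultimately show False using su(2) by simp
    qed
    then have "measure lebesgue (K \<union> ?U) = measure lebesgue K + measure lebesgue ?U"
      using Kl Ul by (intro measure_Un2[THEN trans]) (auto simp: Diff_triv Int_commute)
    moreover have "measure lebesgue ?U = (\<Sum>\<rho>\<in>A. measure lebesgue (?C \<rho>))"
      using A slab_meas t negligible_cone_slab_overlap[OF R]
      by (intro measure_negligible_finite_Union_image) (auto simp: pairwise_def subset_iff)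
    moreover have "\<dots> = (1 - t ^ n) * (\<Sum>\<rho>\<in>A. lv \<rho>)"
      unfolding sum_distrib_left using A t slab_vol by (intro sum.cong) auto
    moreover have "measure lebesgue (K \<union> ?U) \<le> measure lebesgue P"
    proof (rule measure_mono_fmeasurable[OF _ _ Pl])
      show "K \<union> ?U \<subseteq> P" using KP slabP[of t] t by (intro Un_least UN_least) auto
      show "K \<union> ?U \<in> sets lebesgue" by (rule fmeasurableD[OF fmeasurable.Un[OF Kl Ul]])
    qed
    moreover have "measure lebesgue P = V" "measure lebesgue K = measure lborel K"
      using Pb K_closed by (simp_all add: V_def borel_closed)
    ultimately show ?thesis using \<open>t ^ dim U * V \<le> measure lborel K\<close> by (simp add: algebra_simps)
  qed
  have lv0: "0 \<le> lv \<rho>" for \<rho> by (simp add: lv_def lattice_volume_nonneg)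
  have n0: "0 < n" by (simp add: n_def)
  have d0: "0 < vec.dim F"
  proof (rule ccontr)
    assume "\<not> 0 < vec.dim F"
    then have "F \<subseteq> {0}" by simp
    then show False using assms(6) vec.subspace_0[OF assms(5)] by auto
  qed
  have "real n * (\<Sum>\<rho>\<in>A. lv \<rho>) \<le> real (dim U) * V" using gap by (rule power_gap_limit)
  also have "\<dots> \<le> real (vec.dim F) * V"
    using dim_span_of_rat_vec[of F] Vpos unfolding U_def by (intro mult_right_mono) auto
  also have "\<dots> \<le> real (vec.dim F) * (\<Sum>\<rho>\<in>rays P. lv \<rho>)" using total by (intro mult_left_mono) auto
  finally have "1 / real (vec.dim F) * (\<Sum>\<rho>\<in>A. lv \<rho>) \<le> 1 / real n * (\<Sum>\<rho>\<in>rays P. lv \<rho>)"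
    using n0 d0 by (simp add: field_simps)
  then have "fact n * (1 / real (vec.dim F) * (\<Sum>\<rho>\<in>A. lv \<rho>)) \<le> fact n * (1 / real n * (\<Sum>\<rho>\<in>rays P. lv \<rho>))"
    by (rule mult_left_mono) simp
  moreover have "lattice_volume (ray_facet P \<rho>) = fact n * lv \<rho>" for \<rho> by (simp add: lv_def)
  ultimately show ?thesis
    by (simp add: A_def n_def mult.left_commute flip: sum_distrib_left)
qed

end
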